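(* Let $\lambda=\lambda^{(1)}\cup\cdots\cup\lambda^{(t)}$ be a partition with $\lambda^{(j)}\vdash n_j$ such that the smallest part of $\lambda^{(i)}$ is greater than the largest part of $\lambda^{(i+1)}$ for all $i\in[t-1]$. Suppose that $\mathcal A(\lambda^{(j)},\nu)$ is a refined $(\lambda^{(j)},\nu)$-Thrall subset for all $j\in[t]$ and $\nu\vdash n_j$. Let $n=n_1+\cdots+n_t$ and $$I_j=[n_1+\cdots+n_{j-1}+1,\;n_1+\cdots+n_j].$$ Then for any $\mu\vdash n$, the set $$\{T\in\operatorname{SYT}_\lambda(\mu): T^{I_j}\in\mathcal A(\lambda^{(j)},\operatorname{sh}(T^{I_j}))\text{ for all }j\}$$ is a refined $(\lambda,\mu)$-Thrall subset.
   Context: Let $V=\mathbb{C}^N$, let $\operatorname{Lie}(V)$ be the free Lie algebra on $V$ inside the tensor algebra $T(V)$ (generated by $V$ under the commutator bracket), and $\mathcal L_m(V)=\operatorname{Lie}(V)\cap V^{\otimes m}$. For a partition $\lambda$ with $m_i(\lambda)$ parts equal to $i$, the higher Lie module is the $\operatorname{GL}(V)$-module $L_\lambda=\bigotimes_{i\ge1}\operatorname{Sym}^{m_i(\lambda)}(\mathcal L_i(V))$, and $L_n:=L_{(n)}$. $\operatorname{ch}(L_\lambda)$ denotes its character as a symmetric function of the eigenvalues $x_1,\dots,x_N$ of $g\in \operatorname{GL}(V)$, in the limit $N\to\infty$ (a symmetric function in infinitely many variables). Equivalently $\operatorname{ch}(L_\lambda)=\prod_{i\ge1}h_{m_i(\lambda)}[\operatorname{ch}(L_i)]$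 (plethysm). For $\lambda\vdash n$, the coefficients $c_{\lambda,\mu}$ are defined by the Schur expansion $\operatorname{ch}(L_\lambda)=\sum_{\mu\vdash n}c_{\lambda,\mu}s_\mu$. $\lambda\cup\mu$ is the partition with $m_i(\lambda)+m_i(\mu)$ parts equal to $i$ for each $i$. $\operatorname{SYT}(\mu)$ is the set of standard Young tableaux of shape $\mu$ (English notation); $\operatorname{sh}(T)$ is the shape of $T$. $[a,b]$ is the set of integers from $a$ to $b$, $[a]=[1,a]$. For a standard Young tableau $T$ with $n$ cells and a set $I\subseteq[n]$ of consecutive integers, $T_I$ is the restriction of $T$ to the cells with entries in $I$, $\operatorname{st}(T_I)$ is obtained by replacing the entries order-preservingly by $1,\dots,|I|$, and $T^I:=\operatorname{rect}(\operatorname{st}(T_I))$, where $\operatorname{rect}$ is jeu de taquin rectification. $\operatorname{Des}(T)=\{i: i+1$ lies in a lower row of $T$ than $i\}$. For $\lambda=(\lambda_1,\dots,\lambda_r)\vdash n$ let $B_{\lambda,i}=[\lambda_1+\cdots+\lambda_{i-1}+1,\lambda_1+\cdots+\lambda_i]$, let $\operatorname{Des}_{\lambda,i}(T)=\{d-(\lambda_1+\cdots+\lambda_{i-1}): d\in \operatorname{Des}(T),\ d,d+1\in B_{\lambda,i}\}$, and let $\operatorname{maj}_{\lambda,i}(T)$ be the sum of the elements of $\operatorname{Des}_{\lambda,i}(T)$. Set $\operatorname{SYT}_\lambda(\mu)=\{T\in\operatorname{SYT}(\mu):\operatorname{maj}_{\lambda,i}(T)\equiv1\pmod{\lambda_i}\text{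 for all }i\}$. A refined $(\lambda,\mu)$-Thrall subset is a subset of $\operatorname{SYT}_\lambda(\mu)$ whose cardinality is $c_{\lambda,\mu}$. *)

theory Defs
  imports
    "HOL-Library.Function_Algebras"
    "HOL-Combinatorics.Permutations"
    "HOL-Number_Theory.Cong"
    "Jordan_Normal_Form.Char_Poly"
begin

section \<open>Partitions\<close>

definition partition_of :: "nat list \<Rightarrow> nat \<Rightarrow> bool"  (infix "\<turnstile>p" 50) where
  "\<kappa> \<turnstile>p n \<longleftrightarrow> sorted_wrt (\<ge>) \<kappa> \<and> 0 \<notin> set \<kappa> \<and> sum_list \<kappa> = n"

definition partition_union :: "nat list list \<Rightarrow> nat list" where
  "partition_union \<Lambda> = rev (sort (concat \<Lambda>))"

text \<open>Cells are (row, column), counted from 0, with rows numbered from top to bottom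
  (English notation).\<close>

type_synonym cell = "nat \<times> nat"

definition diagram :: "nat list \<Rightarrow> cell set" where
  "diagram \<mu> = {(i, j). i < length \<mu> \<and> j < \<mu> ! i}"


section \<open>Schur polynomials\<close>

text \<open>A tableau is a partial map from cells to entries; its domain is its (possibly skew)
  diagram.\<close>

type_synonym tableau = "cell \<rightharpoonup> nat"

definition semistandard_tableaux :: "nat list \<Rightarrow> nat \<Rightarrow> tableau set" where
  "semistandard_tableaux \<mu> N =
     {T. dom T = diagram \<mu> \<and> ran T \<subseteq> {..<N} \<and>
         (\<forall>i j a b. T (i, j) = Some a \<longrightarrow> T (i, Suc j) = Some b \<longrightarrow> a \<le> b) \<and>
         (\<forall>i j a b. T (i, j) = Some a \<longrightarrow> T (Suc i, j) = Some b \<longrightarrow> a < b)}"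

text \<open>The Schur function of \<open>\<mu>\<close> in the variables listed in \<open>xs\<close>, all others being set to 0.\<close>

definition schur_poly :: "nat list \<Rightarrow> complex list \<Rightarrow> complex" where
  "schur_poly \<mu> xs =
     (\<Sum>T\<in>semistandard_tableaux \<mu> (length xs). \<Prod>c\<in>diagram \<mu>. xs ! the (T c))"


section \<open>The tensor algebra and the free Lie algebra\<close>

text \<open>For \<open>V\<close> the space of complex \<open>N\<close>-vectors, a tensor is given by its coefficients in the basis
  of words over \<open>{..<N}\<close>.\<close>

type_synonym tensor = "nat list \<Rightarrow> complex"

definition tscale :: "complex \<Rightarrow> tensor \<Rightarrow> tensor" where
  "tscale a f = (\<lambda>w. a * f w)"

interpretation tensor: vector_space tscale
  by unfold_locales (auto simp: tscale_def fun_eq_iff algebra_simps)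

definition tone :: tensor where
  "tone = (\<lambda>w. if w = [] then 1 else 0)"

definition tmult :: "tensor \<Rightarrow> tensor \<Rightarrow> tensor"  (infixl "\<otimes>t" 70) where
  "f \<otimes>t g = (\<lambda>w. \<Sum>k\<le>length w. f (take k w) * g (drop k w))"

definition tensor_power :: "nat \<Rightarrow> nat \<Rightarrow> tensor set" where
  "tensor_power N m = {f. \<forall>w. f w \<noteq> 0 \<longrightarrow> length w = m \<and> set w \<subseteq> {..<N}}"

inductive_set free_lie :: "nat \<Rightarrow> tensor set" for N where
  generator: "v \<in> tensor_power N 1 \<Longrightarrow> v \<in> free_lie N"
| add: "f \<in> free_lie N \<Longrightarrow> g \<in> free_lie N \<Longrightarrow> f + g \<in> free_lie N"
| scale: "f \<in> free_lie N \<Longrightarrow> tscale a f \<in> free_lie N"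
| bracket: "f \<in> free_lie N \<Longrightarrow> g \<in> free_lie N \<Longrightarrow> f \<otimes>t g - g \<otimes>t f \<in> free_lie N"

definition lie_part :: "nat \<Rightarrow> nat \<Rightarrow> tensor set" where
  "lie_part N m = free_lie N \<inter> tensor_power N m"


section \<open>Higher Lie modules and their characters\<close>

text \<open>The product of tensors identifies the tensor product of two subspaces, one of
  \<open>tensor_power N a\<close> and one of \<open>tensor_power N b\<close>, with a subspace of \<open>tensor_power N (a + b)\<close>,
  compatibly with the action of \<open>GL(V)\<close>.  The modules below are only formed from such
  homogeneous subspaces.\<close>

definition tensor_prod_space :: "tensor set \<Rightarrow> tensor set \<Rightarrow> tensor set" where
  "tensor_prod_space X Y = tensor.span {x \<otimes>t y | x y. x \<in> X \<and> y \<in> Y}"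

text \<open>The symmetric power is realised as the space of symmetric tensors: the product of
  \<open>w\<^sub>1, \<dots>, w\<^sub>k\<close> in \<open>Sym\<^sup>k W\<close> is represented by the sum of the \<open>k!\<close> permuted
  tensors, which over the complex numbers is an isomorphism.\<close>

definition sym_prod :: "tensor list \<Rightarrow> tensor" where
  "sym_prod ws =
     (\<Sum>\<sigma> | \<sigma> permutes {..<length ws}. foldr (\<otimes>t) (map (\<lambda>i. ws ! \<sigma> i) [0..<length ws]) tone)"

definition sym_power :: "nat \<Rightarrow> tensor set \<Rightarrow> tensor set" where
  "sym_power k W = tensor.span (sym_prod ` {ws. length ws = k \<and> set ws \<subseteq> W})"

definition higher_lie :: "nat \<Rightarrow> nat list \<Rightarrow> tensor set" where
  "higher_lie N \<kappa> =
     foldr tensor_prod_space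
       (map (\<lambda>i. sym_power (count_list \<kappa> i) (lie_part N i)) [1..<Suc (sum_list \<kappa>)])
       (tensor.span {tone})"

text \<open>The diagonal action of an \<open>N \<times> N\<close> matrix on tensors.\<close>

definition gl_action :: "nat \<Rightarrow> complex mat \<Rightarrow> tensor \<Rightarrow> tensor" where
  "gl_action N g f =
     (\<lambda>w. if set w \<subseteq> {..<N}
          then \<Sum>u | length u = length w \<and> set u \<subseteq> {..<N}.
                 (\<Prod>k<length w. g $$ (w ! k, u ! k)) * f u
          else 0)"

definition trace_on :: "tensor set \<Rightarrow> (tensor \<Rightarrow> tensor) \<Rightarrow> complex" where
  "trace_on W \<phi> =
     (let B = (SOME B. tensor.independent B \<and> tensor.span B = W)
      in \<Sum>b\<in>B. tensor.representation B (\<phi> b) b)"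

definition eigenvalues_of :: "complex mat \<Rightarrow> complex list \<Rightarrow> bool" where
  "eigenvalues_of g xs \<longleftrightarrow> char_poly g = (\<Prod>x\<leftarrow>xs. [:- x, 1:])"

text \<open>\<open>ch(L\<^sub>\<kappa>) = \<Sum>\<^sub>\<mu> c\<^sub>\<mu> s\<^sub>\<mu>\<close>.  The character is the symmetric function whose
  specialisation to \<open>N\<close> variables, for every \<open>N\<close>, gives the trace of \<open>g\<close> in terms of the
  eigenvalues of \<open>g\<close>; and two symmetric functions are equal iff all these
  specialisations are.\<close>

definition schur_expansion :: "nat list \<Rightarrow> (nat list \<Rightarrow> complex) \<Rightarrow> bool" where
  "schur_expansion \<kappa> c \<longleftrightarrow>
     (\<forall>N g xs. g \<in> carrier_mat N N \<longrightarrow> invertible_mat g \<longrightarrow> eigenvalues_of g xs \<longrightarrow>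
        trace_on (higher_lie N \<kappa>) (gl_action N g) =
          (\<Sum>\<mu> | \<mu> \<turnstile>p sum_list \<kappa>. c \<mu> * schur_poly \<mu> xs))"

text \<open>The relation \<open>c\<^sub>\<kappa>\<^sub>,\<^sub>\<mu> = a\<close>.  The expansion exists, and it is unique on the
  partitions of the size of \<open>\<kappa>\<close>, by linear independence of the Schur functions.\<close>

definition has_schur_coeff :: "nat list \<Rightarrow> nat list \<Rightarrow> complex \<Rightarrow> bool" where
  "has_schur_coeff \<kappa> \<mu> a \<longleftrightarrow> \<mu> \<turnstile>p sum_list \<kappa> \<and> (\<exists>c. schur_expansion \<kappa> c \<and> c \<mu> = a)"


section \<open>Standard Young tableaux\<close>

definition SYT :: "nat list \<Rightarrow> tableau set" where
  "SYT \<mu> =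
     {T. dom T = diagram \<mu> \<and> bij_betw (\<lambda>c. the (T c)) (diagram \<mu>) {1..sum_list \<mu>} \<and>
         (\<forall>i j a b. T (i, j) = Some a \<longrightarrow> T (i, Suc j) = Some b \<longrightarrow> a < b) \<and>
         (\<forall>i j a b. T (i, j) = Some a \<longrightarrow> T (Suc i, j) = Some b \<longrightarrow> a < b)}"

definition shape :: "tableau \<Rightarrow> nat list" where
  "shape T = (THE \<nu>. \<nu> \<turnstile>p card (dom T) \<and> dom T = diagram \<nu>)"

definition Des :: "tableau \<Rightarrow> nat set" where
  "Des T = {d. \<exists>i j i' j'. T (i, j) = Some d \<and> T (i', j') = Some (Suc d) \<and> i < i'}"

text \<open>Parts and blocks are indexed from 0.\<close>

definition block :: "nat list \<Rightarrow> nat \<Rightarrow> nat set" where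
  "block \<kappa> i = {sum_list (take i \<kappa>) + 1..sum_list (take (Suc i) \<kappa>)}"

definition block_Des :: "nat list \<Rightarrow> nat \<Rightarrow> tableau \<Rightarrow> nat set" where
  "block_Des \<kappa> i T =
     {d - sum_list (take i \<kappa>) | d. d \<in> Des T \<and> d \<in> block \<kappa> i \<and> Suc d \<in> block \<kappa> i}"

definition block_maj :: "nat list \<Rightarrow> nat \<Rightarrow> tableau \<Rightarrow> nat" where
  "block_maj \<kappa> i T = \<Sum>(block_Des \<kappa> i T)"

definition SYT_maj :: "nat list \<Rightarrow> nat list \<Rightarrow> tableau set" where
  "SYT_maj \<kappa> \<mu> = {T \<in> SYT \<mu>. \<forall>i<length \<kappa>. [block_maj \<kappa> i T = 1] (mod \<kappa> ! i)}"

definition refined_thrall :: "nat list \<Rightarrow> nat list \<Rightarrow> tableau set \<Rightarrow> bool" where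
  "refined_thrall \<kappa> \<mu> A \<longleftrightarrow>
     A \<subseteq> SYT_maj \<kappa> \<mu> \<and> has_schur_coeff \<kappa> \<mu> (of_nat (card A))"


section \<open>Jeu de taquin\<close>

text \<open>The cells of the inner partition of a skew tableau, taken as small as possible: a skew
  diagram may be written as a difference of partitions in several ways, but a jeu de taquin slide
  into a corner of the inner partition outside this set changes nothing.\<close>

definition inner_cells :: "tableau \<Rightarrow> cell set" where
  "inner_cells T = {(i, j). (i, j) \<notin> dom T \<and> (\<exists>(k, l)\<in>dom T. i \<le> k \<and> j \<le> l)}"

definition inner_corner :: "tableau \<Rightarrow> cell \<Rightarrow> bool" where
  "inner_corner T c \<longleftrightarrow>
     c \<in> inner_cells T \<and> (fst c, Suc (snd c)) \<notin> inner_cells T \<and> (Suc (fst c), snd c) \<notin> inner_cells T"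

text \<open>\<open>slide T c S\<close>: moving the hole \<open>c\<close> of \<open>T\<close> outwards until it leaves the tableau
  results in \<open>S\<close>.\<close>

inductive slide :: "tableau \<Rightarrow> cell \<Rightarrow> tableau \<Rightarrow> bool" where
  stop: "T (i, Suc j) = None \<Longrightarrow> T (Suc i, j) = None \<Longrightarrow> slide T (i, j) T"
| right: "T (i, Suc j) = Some a \<Longrightarrow> (\<And>b. T (Suc i, j) = Some b \<Longrightarrow> a < b) \<Longrightarrow>
    slide (T((i, j) := Some a, (i, Suc j) := None)) (i, Suc j) S \<Longrightarrow> slide T (i, j) S"
| down: "T (Suc i, j) = Some b \<Longrightarrow> (\<And>a. T (i, Suc j) = Some a \<Longrightarrow> b < a) \<Longrightarrow>
    slide (T((i, j) := Some b, (Suc i, j) := None)) (Suc i, j) S \<Longrightarrow> slide T (i, j) S"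

definition jdt_step :: "tableau \<Rightarrow> tableau \<Rightarrow> bool" where
  "jdt_step T S \<longleftrightarrow> (\<exists>c. inner_corner T c \<and> slide T c S)"

definition rect :: "tableau \<Rightarrow> tableau" where
  "rect T = (THE S. jdt_step\<^sup>*\<^sup>* T S \<and> inner_cells S = {})"

definition restrict_entries :: "tableau \<Rightarrow> nat set \<Rightarrow> tableau" where
  "restrict_entries T I = T |` {c. \<exists>v\<in>I. T c = Some v}"

definition standardize :: "tableau \<Rightarrow> tableau" where
  "standardize T = (\<lambda>c. map_option (\<lambda>v. card {u \<in> ran T. u \<le> v}) (T c))"

definition interval_rect :: "tableau \<Rightarrow> nat set \<Rightarrow> tableau" where
  "interval_rect T I = rect (standardize (restrict_entries T I))"

end

(* For a word w over {0..<N} let (P w, Q w) be its Robinson-Schensted-Knuth pair, so that for a fixed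
   standard T of shape mu the words with Q w = T have generating function s_mu. Deleting the first
   letter of w performs one jeu de taquin slide on Q w: row and column insertion commute, which on the
   level of local growth rules is a finite case check. Hence Q of a factor v of w is the rectification
   of the corresponding interval of Q w, independently of the order of the slides, and ascents are
   preserved. Cutting words of length n into factors of lengths n_j and summing their weights therefore
   multiplies the expansions sum_nu |A(lambda^(j), nu)| s_nu into the one claimed.

   On the other side, the part sizes of the lambda^(j) are disjoint, so L_lambda is the tensor product of
   the L_{lambda^(j)} and its trace is the product of their traces; independence of the Schur functions
   makes the coefficients of each factor well defined. *)

theory Submission
  imports Defs
begin

text \<open>\<open>rect\<close> is defined through arbitrary sequences of slides, so independence of
  the order has to be known before it can be evaluated at all. Two orders are never compared. The
  recording of \<open>v\<close> after \<open>u\<close> depends on \<open>u\<close> only through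
  \<open>P_tab u\<close>, and by bijectivity of the correspondence \<open>u\<close> may be replaced
  by a word with the same insertion tableau and any recording tableau of the same shape. For each
  corner of the inner shape, a reverse slide produces a recording tableau for which deleting the
  first letter vacates exactly this corner. The slide into the corner is then a deletion of a letter
  in front of \<open>v\<close>, and the candidate result \<open>Q_tab v\<close> stays the same.

  The local rules see only shapes and rows of new boxes. Hence the combinatorics is done on row
  sequences, and cells appear only in the translation by \<open>tab\<close>. The price is an
  explicit inner shape, which can be larger than the minimal one behind \<open>inner_cells\<close>;
  slides that move no entry bridge the difference.\<close>

section \<open>Shapes and their growth by single boxes\<close>

text \<open>A shape is the function giving its row lengths. A standard tableau on an inner shape is encoded
  by the sequence of the rows of its entries \<open>1, 2, \<dots>\<close>, a semistandard one by the list of pairs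
  (entry, row).\<close>

definition decr :: "(nat \<Rightarrow> nat) \<Rightarrow> bool" where
  "decr \<kappa> \<longleftrightarrow> (\<forall>i. \<kappa> (Suc i) \<le> \<kappa> i)"

abbreviation no_boxes :: "nat \<Rightarrow> nat" where
  "no_boxes \<equiv> \<lambda>_. 0"

definition add_box :: "(nat \<Rightarrow> nat) \<Rightarrow> nat \<Rightarrow> nat \<Rightarrow> nat" where
  "add_box \<kappa> s = \<kappa>(s := Suc (\<kappa> s))"

definition addable :: "(nat \<Rightarrow> nat) \<Rightarrow> nat \<Rightarrow> bool" where
  "addable \<kappa> s \<longleftrightarrow> (\<forall>t. s = Suc t \<longrightarrow> \<kappa> s < \<kappa> t)"

lemma add_box_apply: "add_box \<kappa> s i = (if i = s then Suc (\<kappa> i) else \<kappa> i)"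
  by (simp add: add_box_def)

lemma add_box_commute: "add_box (add_box \<kappa> s) t = add_box (add_box \<kappa> t) s"
  by (auto simp: add_box_apply fun_eq_iff)

lemma add_box_inject [simp]: "add_box \<kappa> s = add_box \<kappa>' s \<longleftrightarrow> \<kappa> = \<kappa>'"
  by (auto simp: add_box_apply fun_eq_iff split: if_splits)

lemma decr_antimono: "decr \<kappa> \<Longrightarrow> i \<le> j \<Longrightarrow> \<kappa> j \<le> \<kappa> i"
  unfolding decr_def by (rule lift_Suc_antimono_le) auto

lemma decr_add_box: "decr \<kappa> \<Longrightarrow> decr (add_box \<kappa> s) \<longleftrightarrow> addable \<kappa> s"
proof
  assume d: "decr (add_box \<kappa> s)"
  show "addable \<kappa> s"
    unfolding addable_def
  proof (intro allI impI)
    fix t assume "s = Suc t"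
    then show "\<kappa> s < \<kappa> t"
      using d[unfolded decr_def, rule_format, of t] by (simp add: add_box_apply)
  qed
next
  assume "decr \<kappa>" "addable \<kappa> s"
  show "decr (add_box \<kappa> s)"
    unfolding decr_def
  proof
    fix i
    show "add_box \<kappa> s (Suc i) \<le> add_box \<kappa> s i"
      using \<open>decr \<kappa>\<close>[unfolded decr_def, rule_format, of i] \<open>addable \<kappa> s\<close>[unfolded addable_def, rule_format, of i]
      by (auto simp: add_box_apply)
  qed
qed

lemma addable_0 [simp]: "addable \<kappa> 0"
  by (simp add: addable_def)

lemma addable_Suc [simp]: "addable \<kappa> (Suc t) \<longleftrightarrow> \<kappa> (Suc t) < \<kappa> t"
  by (simp add: addable_def)

lemma addable_less: "addable \<kappa> h \<Longrightarrow> decr \<kappa> \<Longrightarrow> i < h \<Longrightarrow> \<kappa> h < \<kappa> i"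
  using decr_antimono[of \<kappa> i "h - 1"] by (cases h) auto

fun ballot :: "(nat \<Rightarrow> nat) \<Rightarrow> nat list \<Rightarrow> bool" where
  "ballot \<kappa> [] \<longleftrightarrow> decr \<kappa>"
| "ballot \<kappa> (s # r) \<longleftrightarrow> decr \<kappa> \<and> addable \<kappa> s \<and> ballot (add_box \<kappa> s) r"

fun grow :: "(nat \<Rightarrow> nat) \<Rightarrow> nat list \<Rightarrow> nat \<Rightarrow> nat" where
  "grow \<kappa> [] = \<kappa>"
| "grow \<kappa> (s # r) = grow (add_box \<kappa> s) r"

lemma grow_apply: "grow \<kappa> r i = \<kappa> i + count_list r i"
  by (induction r arbitrary: \<kappa>) (auto simp: add_box_apply)

lemma grow_append [simp]: "grow \<kappa> (q @ r) = grow (grow \<kappa> q) r"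
  by (induction q arbitrary: \<kappa>) auto

lemma ballot_decr: "ballot \<kappa> r \<Longrightarrow> decr \<kappa>"
  by (cases r) auto

lemma ballot_append [simp]: "ballot \<kappa> (q @ r) \<longleftrightarrow> ballot \<kappa> q \<and> ballot (grow \<kappa> q) r"
  by (induction q arbitrary: \<kappa>) (auto dest: ballot_decr)

lemma ballot_grow_decr: "ballot \<kappa> r \<Longrightarrow> decr (grow \<kappa> r)"
  by (induction r arbitrary: \<kappa>) auto

abbreviation rows :: "(nat \<times> nat) list \<Rightarrow> nat list" where
  "rows l \<equiv> map snd l"

section \<open>Row insertion\<close>

text \<open>Fomin's local rule: the carry is the row of the box by which the shape of the entries read so far
  has grown, and it moves down when the next entry wants the same box.\<close>

fun bump :: "nat \<Rightarrow> (nat \<times> nat) list \<Rightarrow> (nat \<times> nat) list" where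
  "bump c [] = []"
| "bump c ((y, s) # l) = (if s = c then (y, Suc c) # bump (Suc c) l else (y, s) # bump c l)"

fun bump_carry :: "nat \<Rightarrow> (nat \<times> nat) list \<Rightarrow> nat" where
  "bump_carry c [] = c"
| "bump_carry c ((y, s) # l) = (if s = c then bump_carry (Suc c) l else bump_carry c l)"

text \<open>Entries equal to \<open>x\<close> are passed over, so \<open>x\<close> bumps the first
  strictly larger letter of row 0; the box that it adds there is the carry for all larger
  entries.\<close>

fun ins :: "nat \<Rightarrow> (nat \<times> nat) list \<Rightarrow> (nat \<times> nat) list" where
  "ins x [] = [(x, 0)]"
| "ins x ((y, s) # l) = (if y \<le> x then (y, s) # ins x l else (x, 0) # bump 0 ((y, s) # l))"

fun ins_row :: "nat \<Rightarrow> (nat \<times> nat) list \<Rightarrow> nat" where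
  "ins_row x [] = 0"
| "ins_row x ((y, s) # l) = (if y \<le> x then ins_row x l else bump_carry 0 ((y, s) # l))"

lemma addable_both: "addable \<kappa> c \<Longrightarrow> addable \<kappa> s \<Longrightarrow> s \<noteq> c \<Longrightarrow> addable (add_box \<kappa> c) s"
  by (cases s) (auto simp: add_box_apply)

lemma addable_next: "decr \<kappa> \<Longrightarrow> addable (add_box \<kappa> c) (Suc c)"
  by (auto simp: add_box_apply decr_def less_Suc_eq_le)

text \<open>At every stage the new shape is the old one plus the carry box. On a collision the next
  row can take a box, since row \<open>c\<close> has just become longer than row
  \<open>Suc c\<close>.\<close>

lemma bump_ballot:
  assumes "ballot \<kappa> (rows l)" "addable \<kappa> c"
  shows "ballot (add_box \<kappa> c) (rows (bump c l))"
    and "grow (add_box \<kappa> c) (rows (bump c l)) = add_box (grow \<kappa> (rows l)) (bump_carry c l)"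
proof -
  have "ballot (add_box \<kappa> c) (rows (bump c l)) \<and>
      grow (add_box \<kappa> c) (rows (bump c l)) = add_box (grow \<kappa> (rows l)) (bump_carry c l)"
    using assms
  proof (induction c l arbitrary: \<kappa> rule: bump.induct)
    case (1 c)
    then show ?case by (simp add: decr_add_box)
  next
    case (2 c y s l)
    then show ?case
    proof (cases "s = c")
      case True
      then show ?thesis using 2 by (auto simp: decr_add_box addable_next simp del: addable_Suc)
    next
      case False
      then show ?thesis using 2
        by (auto simp: decr_add_box addable_both add_box_commute[of \<kappa> c s])
    qed
  qed
  then show "ballot (add_box \<kappa> c) (rows (bump c l))"
    and "grow (add_box \<kappa> c) (rows (bump c l)) = add_box (grow \<kappa> (rows l)) (bump_carry c l)"
    by auto
qed

lemma ins_ballot: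
  assumes "ballot \<kappa> (rows l)"
  shows "ballot \<kappa> (rows (ins x l))"
    and "grow \<kappa> (rows (ins x l)) = add_box (grow \<kappa> (rows l)) (ins_row x l)"
proof -
  have "ballot \<kappa> (rows (ins x l)) \<and> grow \<kappa> (rows (ins x l)) = add_box (grow \<kappa> (rows l)) (ins_row x l)"
    using assms
  proof (induction x l arbitrary: \<kappa> rule: ins.induct)
    case (1 x)
    then show ?case by (simp add: decr_add_box)
  next
    case (2 x y s l)
    then show ?case
    proof (cases "y \<le> x")
      case True
      then show ?thesis using 2 by auto
    next
      case False
      then show ?thesis
        using bump_ballot[OF 2(2), of 0] ballot_decr[OF 2(2)] by simp
    qed
  qed
  then show "ballot \<kappa> (rows (ins x l))"
    and "grow \<kappa> (rows (ins x l)) = add_box (grow \<kappa> (rows l)) (ins_row x l)"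
    by auto
qed

text \<open>Ties among letters are ordered from left to right in the tableau, hence by weakly decreasing
  row.\<close>

fun valid :: "(nat \<times> nat) list \<Rightarrow> bool" where
  "valid ((y, s) # (z, t) # l) \<longleftrightarrow> (y < z \<or> y = z \<and> t \<le> s) \<and> valid ((z, t) # l)"
| "valid _ \<longleftrightarrow> True"

lemma map_fst_bump [simp]: "map fst (bump c l) = map fst l"
  by (induction c l rule: bump.induct) auto

text \<open>The comparison of neighbouring rows survives a bump. If the first of them leaves row
  \<open>c\<close>, a neighbour in row \<open>Suc c\<close> is pushed on as well. If only the second
  leaves row \<open>c\<close>, the first is not in row \<open>c\<close>, so a step of one row cannot
  reverse their order.\<close>

lemma valid_bump: "valid (bump c l) \<longleftrightarrow> valid l"
proof (induction l arbitrary: c rule: valid.induct)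
  case (1 y s z t l)
  show ?case
    using "1.IH"[of c] "1.IH"[of "Suc c"] by (cases "s = c"; cases "t = c"; cases "t = Suc c") auto
qed auto

lemma valid_tl: "valid (p # l) \<Longrightarrow> valid l"
  by (cases l; cases p; cases "hd l") auto

text \<open>The new \<open>x\<close> comes last among its equals and enters row 0, as weakly
  decreasing rows within a tie demand.\<close>

lemma valid_ins: "valid l \<Longrightarrow> valid (ins x l)"
proof (induction x l rule: ins.induct)
  case (2 x y s l)
  note two = this
  show ?case
  proof (cases "y \<le> x")
    case True
    then show ?thesis using two valid_tl[OF two(2)]
      by (cases l) (auto split: if_splits)
  next
    case False
    obtain p where "bump 0 ((y, s) # l) = (y, p) # tl (bump 0 ((y, s) # l))"
      by (cases "s = 0") auto
    moreover have "valid (bump 0 ((y, s) # l))" using two(2) by (simp only: valid_bump)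
    ultimately have "valid ((x, 0) # bump 0 ((y, s) # l))"
      using False by (metis not_le valid.simps(1))
    then show ?thesis using False by (simp del: bump.simps)
  qed
qed auto

lemma valid_ins_iff: "valid (ins x l) \<Longrightarrow> valid l"
proof (induction x l rule: ins.induct)
  case (2 x y s l)
  note two = this
  show ?case
  proof (cases "y \<le> x")
    case True
    have v: "valid l" using two True by (auto dest: valid_tl)
    show ?thesis
    proof (cases l)
      case (Cons p l')
      obtain z t where p: "p = (z, t)" by fastforce
      show ?thesis using two(2) True v Cons p by (auto split: if_splits)
    qed auto
  next
    case False
    then show ?thesis using two(2) valid_bump[of 0 "(y, s) # l"] 
      by (auto dest: valid_tl simp del: bump.simps)
  qed
qed auto

lemma ins_neq_Nil [simp]: "ins x l \<noteq> []" "[] \<noteq> ins x l"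
proof -
  show "ins x l \<noteq> []" by (induction x l rule: ins.induct) auto
  then show "[] \<noteq> ins x l" by metis
qed

section \<open>Invertibility of row insertion\<close>

text \<open>The local rule can be undone from the right: an entry was pushed exactly when its new
  row equals the carry after it.\<close>

lemma bump_inject:
  "bump c l = bump c' l' \<Longrightarrow> bump_carry c l = bump_carry c' l' \<Longrightarrow> c = c' \<and> l = l'"
proof (induction c l arbitrary: c' l' rule: bump.induct)
  case (1 c)
  then show ?case by (cases l') (auto split: if_splits)
next
  case (2 c y s l)
  from 2(3) obtain y' s' m' where l': "l' = (y', s') # m'"
    by (cases l') (auto split: if_splits)
  show ?case
    using "2.prems" "2.IH"(1)[of "Suc c'" m'] "2.IH"(1)[of c' m'] "2.IH"(2)[of "Suc c'" m'] "2.IH"(2)[of c' m']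
    unfolding l' by (auto split: if_splits)
qed

text \<open>Undoing from the right, the inserted letter is met as row 0 with carry 0. A bump never
  yields this pair, because equal row and carry mean a push, and a push ends in a positive
  row.\<close>

lemma bump_neq_ins: "bump c l = ins x m \<Longrightarrow> bump_carry c l \<noteq> ins_row x m"
proof (induction c l arbitrary: m rule: bump.induct)
  case (1 c)
  then show ?case by (cases m) (auto split: if_splits)
next
  case (2 c y s l)
  show ?case
  proof (cases m)
    case Nil
    then show ?thesis using 2 by (cases l) (auto split: if_splits)
  next
    case (Cons p m')
    obtain z t where p: "p = (z, t)" by fastforce
    show ?thesis
    proof (cases "z \<le> x")
      case True
      then show ?thesis using 2 Cons p by (auto split: if_splits)
    next
      case False
      then show ?thesis using 2(3) bump_inject[of c l 0 m] unfolding Cons p by (auto split: if_splits)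
    qed
  qed
qed

lemma ins_inject:
  "ins x l = ins x' l' \<Longrightarrow> ins_row x l = ins_row x' l' \<Longrightarrow> x = x' \<and> l = l'"
proof (induction x l arbitrary: l' rule: ins.induct)
  case (1 x)
  then show ?case by (cases l') (auto split: if_splits)
next
  case (2 x y s l)
  show ?case
  proof (cases l')
    case Nil
    have "bump 0 ((y, s) # l) \<noteq> []" by auto
    then show ?thesis using 2 Nil by (auto split: if_splits)
  next
    case (Cons p m')
    obtain z t where p: "p = (z, t)" by fastforce
    show ?thesis
    proof (cases "y \<le> x"; cases "z \<le> x'")
      assume "y \<le> x" "z \<le> x'"
      then show ?thesis using 2 Cons p by auto
    next
      assume "y \<le> x" "\<not> z \<le> x'"
      then show ?thesis using 2(2,3) bump_neq_ins[of 0 l' x l] unfolding Cons p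
        by (auto simp del: bump.simps bump_carry.simps)
    next
      assume "\<not> y \<le> x" "z \<le> x'"
      then show ?thesis using 2(2,3) bump_neq_ins[of 0 "(y, s) # l" x' m'] unfolding Cons p
        by (auto simp del: bump.simps bump_carry.simps)
    next
      assume "\<not> y \<le> x" "\<not> z \<le> x'"
      then show ?thesis using 2(2,3) bump_inject[of 0 "(y, s) # l" 0 l'] unfolding Cons p
        by (auto simp del: bump.simps bump_carry.simps)
    qed
  qed
qed

lemma mset_ins: "mset (map fst (ins x l)) = add_mset x (mset (map fst l))"
proof (induction x l rule: ins.induct)
  case (2 x y s l)
  have "mset (map fst (bump 0 ((y, s) # l))) = mset (map fst ((y, s) # l))"
    by (simp only: map_fst_bump)
  then show ?case using 2 by (simp del: bump.simps mset_map)
qed auto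

lemma bump_no_0: "bump 0 l = (y, t) # m \<Longrightarrow> t \<noteq> 0"
  by (cases l) (auto split: if_splits)

text \<open>Two different partitions covered by the same partition both cover their intersection,
  which is \<open>\<kappa>0\<close>.\<close>

lemma remove_common_box:
  assumes "decr K" "decr (add_box K t)" "decr \<kappa>1" "add_box K t = add_box \<kappa>1 c" "t \<noteq> c"
  obtains \<kappa>0 where "decr \<kappa>0" "K = add_box \<kappa>0 c" "\<kappa>1 = add_box \<kappa>0 t" "addable \<kappa>0 c" "addable \<kappa>0 t"
proof -
  let ?k = "K(c := K c - 1)"
  have e: "add_box K t i = add_box \<kappa>1 c i" for i using assms by simp
  have Kc: "K c = Suc (\<kappa>1 c)" using e[of c] assms(5) by (simp add: add_box_apply)
  have K1: "\<kappa>1 = add_box ?k t"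
  proof
    fix i
    show "\<kappa>1 i = add_box ?k t i"
      using e[of i] Kc assms(5) by (auto simp: add_box_apply split: if_splits)
  qed
  have Kk: "K = add_box ?k c" using Kc by (auto simp: add_box_apply fun_eq_iff)
  have d: "decr ?k"
    unfolding decr_def
  proof
    fix i
    show "?k (Suc i) \<le> ?k i"
      using assms(1)[unfolded decr_def, rule_format, of i] assms(3)[unfolded decr_def, rule_format, of i]
        K1[THEN fun_cong, of i] K1[THEN fun_cong, of "Suc i"] assms(5)
      by (auto simp: add_box_apply split: if_splits)
  qed
  have "addable ?k c" "addable ?k t"
    unfolding decr_add_box[OF d, symmetric] using assms(1,3) by (simp_all only: Kk[symmetric] K1[symmetric])
  then show ?thesis using that[OF d Kk K1] by auto
qed

text \<open>Undoing an insertion from the right: either the carry is still present on the left of the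
  list, or the inserted letter has been met.\<close>

lemma unbump:
  assumes "ballot K (rows l')" "valid l'" "grow K (rows l') = add_box \<kappa> c" "decr \<kappa>"
  shows "(\<exists>c0 l \<kappa>0. bump c0 l = l' \<and> bump_carry c0 l = c \<and> K = add_box \<kappa>0 c0 \<and> decr \<kappa>0 \<and> addable \<kappa>0 c0 \<and> ballot \<kappa>0 (rows l))
    \<or> (\<exists>x l. ins x l = l' \<and> ins_row x l = c \<and> ballot K (rows l))"
  using assms
proof (induction l' arbitrary: K)
  case Nil
  then have "bump c [] = [] \<and> bump_carry c [] = c \<and> K = add_box \<kappa> c \<and> decr \<kappa> \<and> addable \<kappa> c \<and> ballot \<kappa> (rows [])"
    using decr_add_box[of \<kappa> c] by auto
  then show ?case by blast
next
  case (Cons p m')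
  obtain y t where p: "p = (y, t)" by fastforce
  have bm: "ballot (add_box K t) (rows m')" "decr K" "addable K t"
    using Cons.prems p by auto
  have dKt: "decr (add_box K t)" using bm decr_add_box by blast
  consider (A) c1 l1 \<kappa>1 where "bump c1 l1 = m'" "bump_carry c1 l1 = c" "add_box K t = add_box \<kappa>1 c1" "decr \<kappa>1"
      "addable \<kappa>1 c1" "ballot \<kappa>1 (rows l1)"
    | (B) x l1 where "ins x l1 = m'" "ins_row x l1 = c" "ballot (add_box K t) (rows l1)"
    using Cons.IH[OF bm(1) valid_tl[OF Cons.prems(2)] _ Cons.prems(4)] Cons.prems(3) p
    by auto
  then show ?case
  proof cases
    case A
    show ?thesis
    proof (cases "t = c1")
      case False
      obtain \<kappa>0 where k0: "decr \<kappa>0" "K = add_box \<kappa>0 c1" "\<kappa>1 = add_box \<kappa>0 t" "addable \<kappa>0 c1" "addable \<kappa>0 t"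
        using remove_common_box[OF bm(2) dKt A(4,3) False] by blast
      have "bump c1 ((y, t) # l1) = p # m'" "bump_carry c1 ((y, t) # l1) = c" "ballot \<kappa>0 (rows ((y, t) # l1))"
        using A False k0 p by auto
      then show ?thesis using k0 by blast
    next
      case True
      then have k1: "\<kappa>1 = K" using A by auto
      show ?thesis
      proof (cases t)
        \<comment> \<open>Row and carry agree and are positive: the entry was pushed here from row
          \<open>u\<close>, where the carry was before.\<close>
        case (Suc u)
        let ?k = "K(u := K u - 1)"
        have lt: "K (Suc u) < K u" using bm(3) Suc by simp
        have Kk: "K = add_box ?k u" using lt by (auto simp: add_box_apply fun_eq_iff)
        have d: "decr ?k"
          unfolding decr_def
        proof
          fix i
          show "?k (Suc i) \<le> ?k i"
            using bm(2)[unfolded decr_def, rule_format, of i] lt by (auto split: if_splits)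
        qed
        have a: "addable ?k u" unfolding decr_add_box[OF d, symmetric] using bm(2) by (simp only: Kk[symmetric])
        have "bump u ((y, u) # l1) = p # m'" "bump_carry u ((y, u) # l1) = c" "ballot ?k (rows ((y, u) # l1))"
          using A True k1 p Suc d a Kk[symmetric] by auto
        then show ?thesis using Kk d a by blast
      next
        \<comment> \<open>Nothing is ever pushed into row 0, so an entry in row 0 with carry 0 is
          the inserted letter itself.\<close>
        case 0
        \<comment> \<open>Strictness, needed for \<open>ins\<close> to stop here, comes from the
          order of ties: the next entry is not in row 0 and so cannot tie with one that is.\<close>
        have hd: "y < fst (hd l1)" if ne: "l1 \<noteq> []"
        proof -
          obtain y2 t2 l2 where m': "m' = (y2, t2) # l2" using A(1) ne
            by (cases m'; cases l1) (auto split: if_splits)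
          have "y2 = fst (hd l1)" using arg_cong[OF A(1), of "map fst"] m' ne by (cases l1) auto
          moreover have "t2 \<noteq> 0" using bump_no_0[of l1] A(1) True 0 m' by blast
          ultimately show ?thesis using Cons.prems(2) m' p 0 by auto
        qed
        have "ins y l1 = p # m' \<and> ins_row y l1 = c"
          using hd A(1,2) True 0 p by (cases l1) (auto simp del: bump.simps bump_carry.simps simp: bump.simps(1) bump_carry.simps(1))
        moreover have "ballot K (rows l1)" using A(6) k1 by simp
        ultimately show ?thesis by blast
      qed
    qed
  next
    case B
    have "y \<le> x"
    proof -
      have sm: "valid (q # l) \<Longrightarrow> z \<in> set (map fst l) \<Longrightarrow> fst q \<le> z" for q z l
      proof (induction l arbitrary: q)
        case (Cons a l)
        then show ?case by (cases q; cases a) fastforce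
      qed auto
      have "x \<in> set (map fst m')"
        using arg_cong[OF mset_ins[of x l1], of set_mset] B(1) by (simp del: mset_map)
      then show ?thesis using sm[of p m' x] Cons.prems(2) p by auto
    qed
    then have "ins x ((y, t) # l1) = p # m'" "ins_row x ((y, t) # l1) = c" "ballot K (rows ((y, t) # l1))"
      using B bm p by auto
    then show ?thesis by blast
  qed
qed

text \<open>Over the empty shape the first alternative of \<open>unbump\<close> is impossible, as it
  would put the carry box into the empty shape.\<close>

lemma ins_surj:
  assumes "ballot no_boxes (rows l')" "valid l'" "grow no_boxes (rows l') = add_box \<kappa> c" "decr \<kappa>"
  obtains x l where "ins x l = l'" "ins_row x l = c" "ballot no_boxes (rows l)" "valid l"
proof -
  have "no_boxes \<noteq> add_box \<kappa>0 c0" for \<kappa>0 c0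
    by (metis add_box_apply nat.distinct(1))
  then obtain x l where "ins x l = l'" "ins_row x l = c" "ballot no_boxes (rows l)"
    using unbump[OF assms] by blast
  then show ?thesis using that valid_ins_iff assms(2) by blast
qed

section \<open>The Robinson-Schensted-Knuth correspondence\<close>

fun ins_list :: "(nat \<times> nat) list \<Rightarrow> nat list \<Rightarrow> (nat \<times> nat) list" where
  "ins_list l [] = l"
| "ins_list l (x # v) = ins_list (ins x l) v"

fun rec_list :: "(nat \<times> nat) list \<Rightarrow> nat list \<Rightarrow> nat list" where
  "rec_list l [] = []"
| "rec_list l (x # v) = ins_row x l # rec_list (ins x l) v"

abbreviation P_tab :: "nat list \<Rightarrow> (nat \<times> nat) list" where "P_tab \<equiv> ins_list []"
abbreviation Q_tab :: "nat list \<Rightarrow> nat list" where "Q_tab \<equiv> rec_list []"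

lemma ins_list_append [simp]: "ins_list l (u @ v) = ins_list (ins_list l u) v"
  by (induction u arbitrary: l) auto

lemma rec_list_append [simp]: "rec_list l (u @ v) = rec_list l u @ rec_list (ins_list l u) v"
  by (induction u arbitrary: l) auto

lemma length_rec_list [simp]: "length (rec_list l v) = length v"
  by (induction v arbitrary: l) auto

lemma ins_list_ballot: "ballot \<kappa> (rows l) \<Longrightarrow> ballot \<kappa> (rows (ins_list l v))"
  by (induction v arbitrary: l) (auto simp: ins_ballot)

lemma rec_list_ballot:
  "ballot \<kappa> (rows l) \<Longrightarrow> ballot (grow \<kappa> (rows l)) (rec_list l v) \<and>
     grow \<kappa> (rows (ins_list l v)) = grow (grow \<kappa> (rows l)) (rec_list l v)"
proof (induction v arbitrary: l)
  case Nil
  then show ?case by (auto dest: ballot_grow_decr)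
next
  case (Cons x v)
  have "decr (grow \<kappa> (rows (ins x l)))"
    using ins_ballot(1)[OF Cons.prems] ballot_grow_decr by blast
  then show ?case
    using Cons.IH[OF ins_ballot(1)[OF Cons.prems]] ins_ballot(2)[OF Cons.prems]
      ballot_grow_decr[OF Cons.prems] decr_add_box by auto
qed

lemma decr_zero [simp]: "decr no_boxes"
  by (simp add: decr_def)

lemma P_tab_ballot: "ballot no_boxes (rows (P_tab w))"
  by (rule ins_list_ballot) simp

lemma Q_tab_ballot: "ballot no_boxes (Q_tab w)"
  using rec_list_ballot[of no_boxes "[]"] by simp

lemma grow_P_Q: "grow no_boxes (rows (P_tab w)) = grow no_boxes (Q_tab w)"
  using rec_list_ballot[of no_boxes "[]"] by simp

lemma valid_ins_list: "valid l \<Longrightarrow> valid (ins_list l v)"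
  by (induction v arbitrary: l) (auto simp: valid_ins)

lemma mset_P_tab: "mset (map fst (P_tab w)) = mset w"
proof (induction w rule: rev_induct)
  case (snoc x w)
  show ?case unfolding ins_list_append ins_list.simps mset_ins using snoc by simp
qed simp

lemma rsk_inject: "P_tab w = P_tab w' \<Longrightarrow> Q_tab w = Q_tab w' \<Longrightarrow> w = w'"
proof (induction w arbitrary: w' rule: rev_induct)
  case Nil
  then have "length w' = 0" by (metis length_rec_list list.size(3))
  then show ?case by simp
next
  case (snoc x w)
  have "length w' = Suc (length w)" using snoc.prems(2) by (metis length_rec_list length_append_singleton)
  then obtain x' v where w': "w' = v @ [x']" by (metis length_Suc_conv_rev)
  have "x = x' \<and> P_tab w = P_tab v"
    by (rule ins_inject) (use snoc.prems w' in auto)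
  then show ?case using snoc w' by auto
qed

text \<open>The last element of \<open>q\<close> is the carry with which the last insertion ended,
  so the letters are recovered from the end of the word.\<close>

lemma rsk_surj:
  assumes "ballot no_boxes (rows l)" "valid l" "ballot no_boxes q" "grow no_boxes (rows l) = grow no_boxes q"
  obtains w where "P_tab w = l" "Q_tab w = q"
proof -
  have "\<exists>w. P_tab w = l \<and> Q_tab w = q" using assms
  proof (induction q arbitrary: l rule: rev_induct)
    case Nil
    have "l = []"
    proof (cases l)
      case (Cons p l')
      then have "grow no_boxes (rows l) (snd p) \<noteq> 0" by (simp add: grow_apply add_box_apply)
      then show ?thesis using Nil by simp
    qed
    then have "P_tab [] = l \<and> Q_tab [] = []" by simp
    then show ?case by blast
  next
    case (snoc c q)
    have d: "decr (grow no_boxes q)" using snoc.prems(3) ballot_grow_decr by auto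
    obtain x l1 where l1: "ins x l1 = l" "ins_row x l1 = c" "ballot no_boxes (rows l1)" "valid l1"
      using ins_surj[OF snoc.prems(1,2) _ d] snoc.prems(4) by auto
    have "add_box (grow no_boxes (rows l1)) c = add_box (grow no_boxes q) c"
      using ins_ballot(2)[OF l1(3), of x] l1 snoc.prems(4) by simp
    then obtain w where "P_tab w = l1" "Q_tab w = q"
      using snoc.IH[OF l1(3,4)] snoc.prems(3) by auto
    then have "P_tab (w @ [x]) = l \<and> Q_tab (w @ [x]) = q @ [c]" using l1 by simp
    then show ?case by blast
  qed
  then show ?thesis using that by blast
qed

section \<open>Local rules for slides and for column insertion\<close>

text \<open>One step of a jeu de taquin slide with the hole at the end of row \<open>h\<close> of the shape of the entries
  already processed: the next entry, in row \<open>S\<close>, moves left, up, or not at all.\<close>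

fun jstep :: "(nat \<Rightarrow> nat) \<Rightarrow> nat \<Rightarrow> nat \<Rightarrow> nat \<times> nat" where
  "jstep \<kappa> h S = (if S = h then (h, h) else if S = Suc h \<and> \<kappa> h = \<kappa> (Suc h) then (h, Suc h) else (S, h))"

text \<open>A whole slide on the level of shapes: \<open>jout\<close> collects the rows of the
  entries after it, and \<open>jhole\<close> below is the row of the outer box that becomes
  vacant.\<close>

fun jout :: "(nat \<Rightarrow> nat) \<Rightarrow> nat \<Rightarrow> nat list \<Rightarrow> nat list" where
  "jout \<kappa> h [] = []"
| "jout \<kappa> h (S # Q) = fst (jstep \<kappa> h S) # jout (add_box \<kappa> (fst (jstep \<kappa> h S))) (snd (jstep \<kappa> h S)) Q"

fun jhole :: "(nat \<Rightarrow> nat) \<Rightarrow> nat \<Rightarrow> nat list \<Rightarrow> nat" where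
  "jhole \<kappa> h [] = h"
| "jhole \<kappa> h (S # Q) = jhole (add_box \<kappa> (fst (jstep \<kappa> h S))) (snd (jstep \<kappa> h S)) Q"

declare jstep.simps [simp del]

text \<open>The transpose of the local rule: an entry that wants the box of the carry moves to the next column.\<close>

definition cstep :: "(nat \<Rightarrow> nat) \<Rightarrow> nat \<Rightarrow> nat \<Rightarrow> nat \<Rightarrow> nat \<Rightarrow> bool" where
  "cstep \<kappa> h s S H \<longleftrightarrow> (if s = h then S = H \<and> add_box \<kappa> h S = Suc (\<kappa> h) else S = s \<and> H = h)"

text \<open>One step of \<open>bump\<close>, isolated so that it can be a face of the cube in
  \<open>local_rules_commute\<close>.\<close>

definition rstep :: "nat \<Rightarrow> nat \<Rightarrow> nat \<times> nat" where
  "rstep c s = (if s = c then (Suc c, Suc c) else (s, c))"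

lemma jstep_elim:
  assumes "jstep \<kappa> h S = (s, H)"
  obtains (J1) "S = h" "s = h" "H = h"
    | (J3) "S = Suc h" "\<kappa> h = \<kappa> (Suc h)" "s = h" "H = Suc h"
    | (J2) "S \<noteq> h" "\<not> (S = Suc h \<and> \<kappa> h = \<kappa> (Suc h))" "s = S" "H = h"
proof (cases "S = h")
  case True
  then show thesis using assms by (intro J1) (simp_all add: jstep.simps)
next
  case False
  show thesis
  proof (cases "S = Suc h \<and> \<kappa> h = \<kappa> (Suc h)")
    case True
    then show thesis using assms by (intro J3) (simp_all add: jstep.simps)
  next
    case n: False
    then have "(S, h) = (s, H)" using assms False unfolding jstep.simps by metis
    then show thesis using False n by (intro J2) auto
  qed
qed

text \<open>This is Fomin's form of jeu de taquin: between \<open>\<kappa>\<close> and the shape two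
  boxes larger, the slide passes to the other intermediate shape if there is one, and keeps the only
  one otherwise.\<close>

lemma jstep_addable:
  assumes "decr \<kappa>" "addable \<kappa> h" "addable (add_box \<kappa> h) S" "jstep \<kappa> h S = (s, H)"
  shows "addable \<kappa> s" "addable (add_box \<kappa> s) H" "add_box (add_box \<kappa> h) S = add_box (add_box \<kappa> s) H"
proof -
  have "addable \<kappa> s \<and> addable (add_box \<kappa> s) H \<and> add_box (add_box \<kappa> h) S = add_box (add_box \<kappa> s) H"
    using assms(4)
  proof (cases rule: jstep_elim)
    case J2
    have "addable \<kappa> S"
    proof (cases S)
      case (Suc t)
      then show ?thesis using assms(3) J2(1,2) by (cases "t = h") (auto simp: add_box_apply)
    qed simp
    then show ?thesis
      using J2(1,3,4) assms(2) addable_both[of \<kappa> S h] add_box_commute[of \<kappa> h S] by simp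
  qed (use assms(2,3) in simp_all)
  then show "addable \<kappa> s" "addable (add_box \<kappa> s) H" "add_box (add_box \<kappa> h) S = add_box (add_box \<kappa> s) H"
    by blast+
qed

text \<open>A cube of shapes, spanned by a letter appended to the word (\<open>c\<close>,
  \<open>C\<close>), a letter put in front of it (\<open>h\<close>, \<open>h'\<close>) and the next
  tableau entry (\<open>s\<close>, \<open>S\<close>). The two row insertion faces together with the
  near column and slide faces force the column and slide rules on the opposite faces. The slide rule
  lives on the faces without the entry direction, which is how it comes to act on recording
  rows.\<close>

lemma local_rules_commute:
  assumes d: "decr \<kappa>" and h: "addable \<kappa> h" and s: "addable \<kappa> s" and S: "addable (add_box \<kappa> h) S"
    and c: "addable \<kappa> c" and C: "addable (add_box \<kappa> h) C"
    and M: "cstep \<kappa> h s S H" and J: "jstep \<kappa> h C = (c, h')"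
    and r: "rstep c s = (s', c')" and R: "rstep C S = (S', C')"
  shows "\<exists>H'. cstep (add_box \<kappa> c) h' s' S' H' \<and> jstep (add_box \<kappa> s) H C' = (c', H')"
proof -
  have mono: "\<And>i j. i \<le> j \<Longrightarrow> \<kappa> j \<le> \<kappa> i" using d by (rule decr_antimono)
  from J show ?thesis
  proof (cases rule: jstep_elim)
    case J1
    show ?thesis
    proof (cases "s = h")
      case True
      \<comment> \<open>If the free box of the next column lay in another row \<open>S\<close>, all
        rows from \<open>S\<close> to \<open>h\<close> would be equally long after adding
        \<open>h\<close>, and \<open>C = h\<close> could not be added.\<close>
      have Sh: "S = h"
      proof (rule ccontr)
        assume n: "S \<noteq> h"
        have col: "\<kappa> S = Suc (\<kappa> h)" using M True n by (auto simp: cstep_def add_box_apply)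
        then have "S < h" using mono[of h S] by (metis Suc_n_not_le_n not_le)
        then have "add_box \<kappa> h h < add_box \<kappa> h S"
          using addable_less[of "add_box \<kappa> h" h S] C J1 decr_add_box[OF d] h by auto
        then show False using col n by (simp add: add_box_apply)
      qed
      then show ?thesis
        using True J1 M r R mono[of h "Suc h"] by (auto simp: cstep_def rstep_def jstep.simps add_box_apply)
    next
      case False
      then show ?thesis
        using J1 M r R by (auto simp: cstep_def rstep_def jstep.simps add_box_apply)
    qed
  next
    case J3
    show ?thesis
    proof (cases "s = h")
      case True
      have le: "S \<le> h"
      proof (rule ccontr)
        assume n: "\<not> S \<le> h"
        then show False using M True mono[of h S] by (auto simp: cstep_def add_box_apply)
      qed
      show ?thesis
        using True J3 M r R le by (auto simp: cstep_def rstep_def jstep.simps add_box_apply)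
    next
      case False
      have "s \<noteq> Suc h" using s J3 by auto
      then show ?thesis
        using False J3 M r R by (auto simp: cstep_def rstep_def jstep.simps add_box_apply)
    qed
  next
    case J2
    show ?thesis
    proof (cases "s = h")
      case True
      have SH: "S = H" "add_box \<kappa> h S = Suc (\<kappa> h)" using M True by (auto simp: cstep_def)
      have S_le: "S \<le> h"
      proof (rule ccontr)
        assume n: "\<not> S \<le> h"
        then show False using SH mono[of h S] by (auto simp: add_box_apply)
      qed
      show ?thesis
      proof (cases "C = S")
        case False
        have "\<not> (C = Suc S \<and> add_box \<kappa> h S = add_box \<kappa> h (Suc S))"
          using C by (auto simp: add_box_apply)
        then show ?thesis
          using True False J2 SH r R by (auto simp: cstep_def rstep_def jstep.simps add_box_apply)
      next
        \<comment> \<open>A double collision: the entry pushed into row \<open>S\<close> by the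
          column rule meets the row carry there. By \<open>kS\<close> and \<open>kS1\<close> the
          rows \<open>S\<close> and \<open>Suc S\<close> are equally long once \<open>h\<close> is
          added, so the push by the row rule stays in the same column and the slide rule moves
          up.\<close>
        case eq: True
        then have Sh: "S < h" using S_le J2 by auto
        have kS: "\<kappa> S = Suc (\<kappa> h)" using SH Sh by (simp add: add_box_apply)
        have kS1: "add_box \<kappa> h (Suc S) = Suc (\<kappa> h)"
        proof (cases "Suc S = h")
          case False
          then have "Suc S < h" using Sh by auto
          then have "\<kappa> h < \<kappa> (Suc S)" using addable_less[OF h d] by blast
          moreover have "\<kappa> (Suc S) \<le> \<kappa> S" using mono[of S "Suc S"] by simp
          ultimately show ?thesis using kS False by (simp add: add_box_apply)
        qed (simp add: add_box_apply)
        have r': "s' = h" "c' = C" "S' = Suc C" "C' = Suc C"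
          using r R True eq J2 by (auto simp: rstep_def)
        show ?thesis
          using kS kS1 r' eq J2 True SH Sh
          by (auto simp: cstep_def rstep_def jstep.simps add_box_apply split: if_splits)
      qed
    next
      case False
      have SH: "S = s" "H = h" using M False by (auto simp: cstep_def)
      have "\<not> (C = Suc h \<and> \<kappa> h = \<kappa> (Suc h))" using J2 by blast
      show ?thesis
      proof (cases "s = c")
        case True
        have r': "s' = Suc c" "c' = Suc c" "S' = Suc c" "C' = Suc c"
          using r R True SH J2 by (auto simp: rstep_def)
        have "\<not> (Suc c = Suc h)" using J2 by auto
        then show ?thesis
          using r' True SH J2 False
          by (auto simp: cstep_def rstep_def jstep.simps add_box_apply split: if_splits)
      next
        case nc: False
        have r': "s' = s" "c' = c" "S' = s" "C' = c"
          using r R nc SH J2 by (auto simp: rstep_def)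
        have "\<not> (c = Suc h \<and> add_box \<kappa> s h = add_box \<kappa> s (Suc h))"
          using c J2 nc False by (auto simp: add_box_apply)
        then show ?thesis
          using r' SH J2 False nc
          by (auto simp: cstep_def rstep_def jstep.simps)
      qed
    qed
  qed
qed

section \<open>Commutation of row and column insertion\<close>

text \<open>Column insertion of \<open>y\<close>, which is how a tableau changes when \<open>y\<close> is put in front of its word,
  as a relation; \<open>col_insert_after\<close> treats the entries after \<open>y\<close>.\<close>

inductive col_insert_after :: "(nat \<Rightarrow> nat) \<Rightarrow> nat \<Rightarrow> (nat \<times> nat) list \<Rightarrow> (nat \<times> nat) list \<Rightarrow> nat \<Rightarrow> bool" where
  Nil: "col_insert_after \<kappa> h [] [] h"
| Cons: "cstep \<kappa> h s S H \<Longrightarrow> col_insert_after (add_box \<kappa> s) H l L hf \<Longrightarrow> col_insert_after \<kappa> h ((a, s) # l) ((a, S) # L) hf"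

inductive col_insert :: "(nat \<Rightarrow> nat) \<Rightarrow> nat \<Rightarrow> (nat \<times> nat) list \<Rightarrow> (nat \<times> nat) list \<Rightarrow> nat \<Rightarrow> bool" where
  here: "\<kappa> H = 0 \<Longrightarrow> addable \<kappa> H \<Longrightarrow> col_insert_after \<kappa> H l L hf \<Longrightarrow> (l = [] \<or> y \<le> fst (hd l)) \<Longrightarrow> col_insert \<kappa> y l ((y, H) # L) hf"
| there: "a < y \<Longrightarrow> col_insert (add_box \<kappa> s) y l L hf \<Longrightarrow> col_insert \<kappa> y ((a, s) # l) ((a, s) # L) hf"

lemma bump_rstep: "bump c ((y, s) # l) = (y, fst (rstep c s)) # bump (snd (rstep c s)) l"
  "bump_carry c ((y, s) # l) = bump_carry (snd (rstep c s)) l"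
  by (auto simp: rstep_def)

lemma cstep_commute: "cstep \<kappa> h s S H \<Longrightarrow> add_box (add_box \<kappa> h) S = add_box (add_box \<kappa> s) H"
  by (auto simp: cstep_def add_box_commute split: if_splits)

lemma rstep_addable:
  assumes "decr \<kappa>" "addable \<kappa> c" "addable \<kappa> s"
  shows "addable (add_box \<kappa> s) (snd (rstep c s))"
    "add_box (add_box \<kappa> s) (snd (rstep c s)) = add_box (add_box \<kappa> c) (fst (rstep c s))"
  using assms by (auto simp: rstep_def addable_next addable_both add_box_commute simp del: addable_Suc)

text \<open>Cubes are stacked along the entries. The slide face at the far end relates the two final
  row carries, that is, the two recorded rows.\<close>

lemma col_insert_after_bump:
  assumes "col_insert_after \<kappa> h l L hf" "ballot \<kappa> (rows l)" "ballot (add_box \<kappa> h) (rows L)"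
    "addable \<kappa> h" "addable (add_box \<kappa> h) C" "jstep \<kappa> h C = (c, h')"
  shows "\<exists>hf'. col_insert_after (add_box \<kappa> c) h' (bump c l) (bump C L) hf' \<and>
    jstep (grow \<kappa> (rows l)) hf (bump_carry C L) = (bump_carry c l, hf')"
  using assms
proof (induction arbitrary: C c h' rule: col_insert_after.induct)
  case (Nil \<kappa> h)
  then show ?case by (auto intro: col_insert_after.Nil)
next
  case (Cons \<kappa> h s S H l L hf a)
  obtain s' c' S' C' where r: "rstep c s = (s', c')" and R: "rstep C S = (S', C')" by fastforce
  have d: "decr \<kappa>" "addable \<kappa> s" "addable (add_box \<kappa> h) S" "decr (add_box \<kappa> h)" using Cons.prems by auto
  note ja = jstep_addable[OF d(1) Cons.prems(3,4,5)]
  obtain H' where H': "cstep (add_box \<kappa> c) h' s' S' H'" "jstep (add_box \<kappa> s) H C' = (c', H')"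
    using local_rules_commute[OF d(1) Cons.prems(3) d(2,3) ja(1) Cons.prems(4) Cons.hyps(1) Cons.prems(5) r R] by blast
  note cc = cstep_commute[OF Cons.hyps(1)]
  have "addable (add_box \<kappa> s) H"
    using cc d(3,4) decr_add_box[OF d(4), of S] decr_add_box[of "add_box \<kappa> s" H] decr_add_box[OF d(1)] d(2) by auto
  moreover have "addable (add_box (add_box \<kappa> s) H) C'"
    using rstep_addable(1)[OF d(4) Cons.prems(4) d(3)] cc R by simp
  ultimately obtain hf' where hf': "col_insert_after (add_box (add_box \<kappa> s) c') H' (bump c' l) (bump C' L) hf'"
    "jstep (grow (add_box \<kappa> s) (rows l)) hf (bump_carry C' L) = (bump_carry c' l, hf')"
    using Cons.IH[of C' c' H'] H'(2) Cons.prems(1,2) cc by auto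
  have "add_box (add_box \<kappa> s) c' = add_box (add_box \<kappa> c) s'"
    using rstep_addable(2)[OF d(1) ja(1) d(2)] r by simp
  then have "col_insert_after (add_box \<kappa> c) h' ((a, s') # bump c' l) ((a, S') # bump C' L) hf'"
    using col_insert_after.Cons[OF H'(1)] hf'(1) by simp
  then show ?case using hf'(2) r R unfolding bump_rstep by auto
qed

text \<open>Admitting the new letter leaves the column carry where it is, even in row 0: the free
  box of the next column is then again at the end of row 0.\<close>

lemma col_insert_after_insert_0: "col_insert_after (add_box \<kappa> 0) h (bump 0 l) (bump 0 L) hf \<Longrightarrow>
   col_insert_after \<kappa> h ((x, 0) # bump 0 l) ((x, 0) # bump 0 L) hf"
  by (rule col_insert_after.Cons) (auto simp: cstep_def add_box_apply)

lemma jstep_0: "jstep \<kappa> h 0 = (0, h)"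
  by (simp add: jstep.simps)

lemma col_insert_after_ins:
  assumes "col_insert_after \<kappa> h l L hf" "ballot \<kappa> (rows l)" "ballot (add_box \<kappa> h) (rows L)" "addable \<kappa> h"
  shows "\<exists>hf'. col_insert_after \<kappa> h (ins x l) (ins x L) hf' \<and>
    jstep (grow \<kappa> (rows l)) hf (ins_row x L) = (ins_row x l, hf')"
  using assms
proof (induction rule: col_insert_after.induct)
  case (Nil \<kappa> h)
  have "col_insert_after \<kappa> h ((x, 0) # bump 0 []) ((x, 0) # bump 0 []) h"
    by (rule col_insert_after_insert_0) (auto intro: col_insert_after.Nil)
  then show ?case by (auto simp: jstep_0)
next
  case (Cons \<kappa> h s S H l L hf a)
  have d: "decr \<kappa>" "addable \<kappa> s" "addable (add_box \<kappa> h) S" "decr (add_box \<kappa> h)" using Cons.prems by auto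
  note cc = cstep_commute[OF Cons.hyps(1)]
  show ?case
  proof (cases "a \<le> x")
    case True
    have "addable (add_box \<kappa> s) H"
      using cc d(3,4) decr_add_box[OF d(4), of S] decr_add_box[of "add_box \<kappa> s" H] decr_add_box[OF d(1)] d(2) by auto
    then obtain hf' where hf': "col_insert_after (add_box \<kappa> s) H (ins x l) (ins x L) hf'"
      "jstep (grow (add_box \<kappa> s) (rows l)) hf (ins_row x L) = (ins_row x l, hf')"
      using Cons.IH Cons.prems cc by auto
    then show ?thesis using True col_insert_after.Cons[OF Cons.hyps(1) hf'(1)] by auto
  next
    case False
    have c2: "col_insert_after \<kappa> h ((a, s) # l) ((a, S) # L) hf" using Cons.hyps(1,2) by (rule col_insert_after.Cons)
    obtain hf' where hf': "col_insert_after (add_box \<kappa> 0) h (bump 0 ((a, s) # l)) (bump 0 ((a, S) # L)) hf'"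
      "jstep (grow \<kappa> (rows ((a, s) # l))) hf (bump_carry 0 ((a, S) # L)) = (bump_carry 0 ((a, s) # l), hf')"
      using col_insert_after_bump[OF c2 Cons.prems addable_0 jstep_0] by blast
    have "col_insert_after \<kappa> h (ins x ((a, s) # l)) (ins x ((a, S) # L)) hf'"
      using col_insert_after_insert_0[OF hf'(1), of x] False by simp
    then show ?thesis using hf'(2) False by (auto simp del: bump_carry.simps)
  qed
qed

text \<open>The bump starts before the place of \<open>y\<close>, so beyond the stacked cubes there
  is one new situation, the entry \<open>y\<close> that exists only in \<open>L\<close>.\<close>

lemma col_insert_bump:
  assumes "col_insert \<kappa> y l L hf" "ballot \<kappa> (rows l)" "ballot \<kappa> (rows L)" "addable \<kappa> c"
  shows "\<exists>hf'. col_insert (add_box \<kappa> c) y (bump c l) (bump c L) hf' \<and>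
    jstep (grow \<kappa> (rows l)) hf (bump_carry c L) = (bump_carry c l, hf')"
  using assms
proof (induction arbitrary: c rule: col_insert.induct)
  case (here \<kappa> H l L hf y)
  have hd: "bump c l = [] \<or> y \<le> fst (hd (bump c l))" for c
  proof (cases l)
    case (Cons p l')
    then show ?thesis using here.hyps(4) by (cases p) auto
  qed simp
  have d: "decr \<kappa>" using here.prems by auto
  show ?case
  proof (cases "H = c")
    \<comment> \<open>The bump wants the very row in which \<open>y\<close> extends the first
      column, so in \<open>L\<close> it pushes \<open>y\<close> down by one. Both rows are empty in
      \<open>\<kappa>\<close>, so the slide rule takes the carry of \<open>L\<close> back
      up.\<close>
    case True
    have 0: "\<kappa> (Suc H) = 0" using decr_antimono[OF d, of H "Suc H"] here.hyps(1) by simp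
    have j: "jstep \<kappa> H (Suc H) = (H, Suc H)" using 0 here.hyps(1) by (simp add: jstep.simps)
    obtain hf' where hf': "col_insert_after (add_box \<kappa> H) (Suc H) (bump H l) (bump (Suc H) L) hf'"
      "jstep (grow \<kappa> (rows l)) hf (bump_carry (Suc H) L) = (bump_carry H l, hf')"
      by (rule exE[OF col_insert_after_bump[OF here.hyps(3) _ _ here.hyps(2) _ j]]) (use here.prems 0 in \<open>auto simp: add_box_apply\<close>)
    have k: "add_box \<kappa> H (Suc H) = 0" "addable (add_box \<kappa> H) (Suc H)"
      using 0 by (simp_all add: add_box_apply)
    show ?thesis
      using True hf'(2) col_insert.here[OF k hf'(1) hd] by auto
  next
    case False
    have j: "jstep \<kappa> H c = (c, H)" using here.prems(3) here.hyps(1) False by (auto simp: jstep.simps)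
    have ac: "addable (add_box \<kappa> H) c" "addable (add_box \<kappa> c) H"
      using addable_both here.hyps(2) here.prems(3) False by blast+
    obtain hf' where hf': "col_insert_after (add_box \<kappa> c) H (bump c l) (bump c L) hf'"
      "jstep (grow \<kappa> (rows l)) hf (bump_carry c L) = (bump_carry c l, hf')"
      by (rule exE[OF col_insert_after_bump[OF here.hyps(3) _ _ here.hyps(2) ac(1) j]]) (use here.prems in auto)
    have k: "add_box \<kappa> c H = 0"
      using here.hyps(1) False by (simp add: add_box_apply)
    show ?thesis
      using False hf'(2) col_insert.here[OF k ac(2) hf'(1) hd] by auto
  qed
next
  case (there a y \<kappa> s l L hf)
  have d: "decr \<kappa>" "addable \<kappa> s" using there.prems by auto
  obtain s' c' where r: "rstep c s = (s', c')" by fastforce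
  have "addable (add_box \<kappa> s) c'"
    using rstep_addable(1)[OF d(1) there.prems(3) d(2)] r by simp
  then obtain hf' where hf': "col_insert (add_box (add_box \<kappa> s) c') y (bump c' l) (bump c' L) hf'"
    "jstep (grow (add_box \<kappa> s) (rows l)) hf (bump_carry c' L) = (bump_carry c' l, hf')"
    using there.IH[of c'] there.prems by auto
  have "add_box (add_box \<kappa> s) c' = add_box (add_box \<kappa> c) s'"
    using rstep_addable(2)[OF d(1) there.prems(3) d(2)] r by simp
  then have "col_insert (add_box \<kappa> c) y ((a, s') # bump c' l) ((a, s') # bump c' L) hf'"
    using hf'(1) there.hyps(1) by (auto intro: col_insert.there)
  then show ?case using hf'(2) r unfolding bump_rstep by auto
qed

text \<open>For \<open>y \<le> x\<close> the insertion begins behind \<open>y\<close>; for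
  \<open>x < y\<close> the resulting bump runs through the place of \<open>y\<close>. In a tie
  \<open>y\<close>, the earlier letter of the word, keeps its place in front.\<close>

lemma col_insert_ins:
  assumes "col_insert \<kappa> y l L hf" "ballot \<kappa> (rows l)" "ballot \<kappa> (rows L)"
  shows "\<exists>hf'. col_insert \<kappa> y (ins x l) (ins x L) hf' \<and>
    jstep (grow \<kappa> (rows l)) hf (ins_row x L) = (ins_row x l, hf')"
  using assms
proof (induction rule: col_insert.induct)
  case (here \<kappa> H l L hf y)
  show ?case
  proof (cases "y \<le> x")
    case True
    obtain hf' where hf': "col_insert_after \<kappa> H (ins x l) (ins x L) hf'"
      "jstep (grow \<kappa> (rows l)) hf (ins_row x L) = (ins_row x l, hf')"
      using col_insert_after_ins[OF here.hyps(3) here.prems(1) _ here.hyps(2)] here.prems(2) by auto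
    have "y \<le> fst (hd (ins x l))"
      using here.hyps(4) True by (cases l) auto
    then show ?thesis using True hf' here.hyps by (auto intro!: col_insert.here)
  next
    case False
    have c: "col_insert \<kappa> y l ((y, H) # L) hf" using here.hyps by (rule col_insert.here)
    have i: "ins x l = (x, 0) # bump 0 l" "ins_row x l = bump_carry 0 l"
      using False here.hyps(4) by (cases l; cases "hd l"; simp)+
    obtain hf' where hf': "col_insert (add_box \<kappa> 0) y (bump 0 l) (bump 0 ((y, H) # L)) hf'"
      "jstep (grow \<kappa> (rows l)) hf (bump_carry 0 ((y, H) # L)) = (bump_carry 0 l, hf')"
      using col_insert_bump[OF c here.prems addable_0] by blast
    have "col_insert \<kappa> y (ins x l) (ins x ((y, H) # L)) hf'"
      using col_insert.there[OF _ hf'(1), of x] False i by simp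
    then show ?thesis using hf'(2) False i by auto
  qed
next
  case (there a y \<kappa> s l L hf)
  show ?case
  proof (cases "a \<le> x")
    case True
    then show ?thesis using there by (auto intro!: col_insert.there)
  next
    case False
    have c: "col_insert \<kappa> y ((a, s) # l) ((a, s) # L) hf" using there.hyps by (rule col_insert.there)
    have "x < y" using False there.hyps(1) by simp
    moreover obtain hf' where hf': "col_insert (add_box \<kappa> 0) y (bump 0 ((a, s) # l)) (bump 0 ((a, s) # L)) hf'"
      "jstep (grow \<kappa> (rows ((a, s) # l))) hf (bump_carry 0 ((a, s) # L)) = (bump_carry 0 ((a, s) # l), hf')"
      using col_insert_bump[OF c there.prems addable_0] by blast
    ultimately have "col_insert \<kappa> y (ins x ((a, s) # l)) (ins x ((a, s) # L)) hf'"
      using col_insert.there[OF _ hf'(1), of x] False by simp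
    then show ?thesis using hf'(2) False by (auto simp del: bump_carry.simps)
  qed
qed

lemma col_insert_rec_list:
  assumes "col_insert no_boxes y l L hf" "ballot no_boxes (rows l)" "ballot no_boxes (rows L)"
  shows "rec_list l v = jout (grow no_boxes (rows l)) hf (rec_list L v)"
  using assms
proof (induction v arbitrary: l L hf)
  case (Cons x v)
  obtain hf' where hf': "col_insert no_boxes y (ins x l) (ins x L) hf'"
    "jstep (grow no_boxes (rows l)) hf (ins_row x L) = (ins_row x l, hf')"
    using col_insert_ins[OF Cons.prems] by blast
  then show ?case
    using Cons.IH[OF hf'(1)] Cons.prems by (auto simp: ins_ballot)
qed simp

theorem Q_tab_tl: "Q_tab v = jout no_boxes 0 (tl (Q_tab (y # v)))"
proof -
  have "col_insert no_boxes y [] [(y, 0)] 0"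
    by (rule col_insert.here) (auto intro: col_insert_after.Nil)
  from col_insert_rec_list[OF this] show ?thesis by (simp add: decr_add_box)
qed

section \<open>Slides of row sequences and their inverses\<close>

lemma jout_append:
  "jout \<kappa> h (q @ r) = jout \<kappa> h q @ jout (grow \<kappa> (jout \<kappa> h q)) (jhole \<kappa> h q) r"
  by (induction q arbitrary: \<kappa> h) auto

lemma length_jout [simp]: "length (jout \<kappa> h q) = length q"
  by (induction q arbitrary: \<kappa> h) auto

lemma jout_ballot:
  assumes "decr \<kappa>" "addable \<kappa> h" "ballot (add_box \<kappa> h) q"
  shows "ballot \<kappa> (jout \<kappa> h q) \<and> addable (grow \<kappa> (jout \<kappa> h q)) (jhole \<kappa> h q) \<and>
    add_box (grow \<kappa> (jout \<kappa> h q)) (jhole \<kappa> h q) = grow (add_box \<kappa> h) q"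
  using assms
proof (induction q arbitrary: \<kappa> h)
  case (Cons S q)
  obtain s H where j: "jstep \<kappa> h S = (s, H)" by fastforce
  have S: "addable (add_box \<kappa> h) S" "ballot (add_box (add_box \<kappa> h) S) q" using Cons.prems by auto
  note a = jstep_addable[OF Cons.prems(1,2) S(1) j]
  have "decr (add_box \<kappa> s)" using decr_add_box Cons.prems(1) a(1) by blast
  moreover have "ballot (add_box (add_box \<kappa> s) H) q" using S(2) a(3) by simp
  ultimately show ?case using Cons.IH[of "add_box \<kappa> s" H] a Cons.prems(1) j by auto
qed auto

text \<open>Reverse slides: \<open>jstep\<close> is inverted from the outer end, the case being
  recognised from the new row and the new hole. This allows the vacated box \<open>H\<close> to be
  prescribed.\<close>

lemma jout_surj:
  assumes "ballot \<kappa> q" "addable (grow \<kappa> q) H"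
  shows "\<exists>h Q. addable \<kappa> h \<and> ballot (add_box \<kappa> h) Q \<and> jout \<kappa> h Q = q \<and> jhole \<kappa> h Q = H"
  using assms
proof (induction q arbitrary: \<kappa>)
  case Nil
  then have "addable \<kappa> H \<and> ballot (add_box \<kappa> H) [] \<and> jout \<kappa> H [] = [] \<and> jhole \<kappa> H [] = H"
    by (auto simp: decr_add_box)
  then show ?case by blast
next
  case (Cons s q)
  have d: "decr \<kappa>" "addable \<kappa> s" using Cons.prems by auto
  obtain h1 Q1 where 1: "addable (add_box \<kappa> s) h1" "ballot (add_box (add_box \<kappa> s) h1) Q1"
    "jout (add_box \<kappa> s) h1 Q1 = q" "jhole (add_box \<kappa> s) h1 Q1 = H"
    using Cons.IH[of "add_box \<kappa> s"] Cons.prems by auto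
  have "\<exists>h S. jstep \<kappa> h S = (s, h1) \<and> addable \<kappa> h \<and> addable (add_box \<kappa> h) S \<and>
    add_box (add_box \<kappa> h) S = add_box (add_box \<kappa> s) h1"
  proof (cases "s = h1")
    case True
    then have "jstep \<kappa> s s = (s, h1) \<and> addable \<kappa> s \<and> addable (add_box \<kappa> s) s \<and>
      add_box (add_box \<kappa> s) s = add_box (add_box \<kappa> s) h1" using d 1 by (simp add: jstep.simps)
    then show ?thesis by blast
  next
    case n: False
    show ?thesis
    proof (cases "h1 = Suc s \<and> \<kappa> s = \<kappa> (Suc s)")
      case True
      then have "jstep \<kappa> s (Suc s) = (s, h1) \<and> addable \<kappa> s \<and> addable (add_box \<kappa> s) (Suc s) \<and>
        add_box (add_box \<kappa> s) (Suc s) = add_box (add_box \<kappa> s) h1" using d 1 by (simp add: jstep.simps)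
      then show ?thesis by blast
    next
      case False
      have h1: "addable \<kappa> h1"
      proof (cases h1)
        case (Suc t)
        then have "\<kappa> (Suc t) < add_box \<kappa> s t" using 1(1) n by (simp add: add_box_apply)
        moreover have "\<kappa> (Suc t) \<le> \<kappa> t" using decr_antimono[OF d(1), of t "Suc t"] by simp
        ultimately show ?thesis using False Suc by (cases "t = s") (auto simp: add_box_apply)
      qed simp
      have "\<not> (s = Suc h1 \<and> \<kappa> h1 = \<kappa> (Suc h1))" using d(2) by auto
      then have "jstep \<kappa> h1 s = (s, h1) \<and> addable \<kappa> h1 \<and> addable (add_box \<kappa> h1) s \<and>
        add_box (add_box \<kappa> h1) s = add_box (add_box \<kappa> s) h1"
        using n h1 d addable_both[of \<kappa> h1 s] add_box_commute[of \<kappa> h1 s] unfolding jstep.simps by auto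
      then show ?thesis by blast
    qed
  qed
  then obtain h S where hS: "jstep \<kappa> h S = (s, h1)" "addable \<kappa> h" "addable (add_box \<kappa> h) S"
    "add_box (add_box \<kappa> h) S = add_box (add_box \<kappa> s) h1" by blast
  have "addable \<kappa> h \<and> ballot (add_box \<kappa> h) (S # Q1) \<and> jout \<kappa> h (S # Q1) = s # q \<and> jhole \<kappa> h (S # Q1) = H"
    using hS 1 d by (simp add: decr_add_box)
  then show ?case by blast
qed

text \<open>Removing the last box of the lowest nonempty row always leaves a partition;
  \<open>k\<close> bounds the support and makes the number of boxes a finite sum.\<close>

lemma ballot_exists:
  assumes "decr \<rho>" "\<And>i. k \<le> i \<Longrightarrow> \<rho> i = 0"
  shows "\<exists>R. ballot no_boxes R \<and> grow no_boxes R = \<rho>"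
  using assms
proof (induction "sum \<rho> {..<k}" arbitrary: \<rho>)
  case 0
  have "\<rho> i = 0" for i using 0 by (cases "i < k") auto
  then have "ballot no_boxes [] \<and> grow no_boxes [] = \<rho>" by auto
  then show ?case by blast
next
  case (Suc n)
  have ne: "{i. \<rho> i \<noteq> 0} \<noteq> {}" using Suc(2) by (metis (mono_tags, lifting) Zero_not_Suc empty_Collect_eq sum.neutral)
  have fin: "finite {i. \<rho> i \<noteq> 0}" 
  proof (rule finite_subset)
    show "{i. \<rho> i \<noteq> 0} \<subseteq> {..<k}"
    proof
      fix i assume "i \<in> {i. \<rho> i \<noteq> 0}"
      then have "\<not> k \<le> i" using Suc.prems(2) by auto
      then show "i \<in> {..<k}" by simp
    qed
  qed simp
  define d where "d = Max {i. \<rho> i \<noteq> 0}"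
  have d: "\<rho> d \<noteq> 0" using Max_in[OF fin ne] by (simp add: d_def)
  have gt: "\<rho> i = 0" if "d < i" for i using Max_ge[OF fin, of i] that by (auto simp: d_def)
  define \<rho>' where "\<rho>' = \<rho>(d := \<rho> d - 1)"
  have dk: "d < k" using d Suc.prems(2)[of d] by (cases "d < k") simp_all
  have e: "\<rho> = add_box \<rho>' d" using d by (simp add: \<rho>'_def add_box_def)
  have dec: "decr \<rho>'" unfolding decr_def
  proof
    fix i
    show "\<rho>' (Suc i) \<le> \<rho>' i"
      using decr_antimono[OF Suc.prems(1), of i "Suc i"] gt[of "Suc d"]
      by (cases "i = d"; cases "Suc i = d") (simp_all add: \<rho>'_def)
  qed
  have "sum \<rho> {..<k} = Suc (sum \<rho>' {..<k})"
    
  proof -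
    have "sum \<rho> {..<k} = \<rho> d + sum \<rho> ({..<k} - {d})" "sum \<rho>' {..<k} = \<rho>' d + sum \<rho>' ({..<k} - {d})"
      using dk sum.remove[of "{..<k}" d] by simp_all
    moreover have "sum \<rho>' ({..<k} - {d}) = sum \<rho> ({..<k} - {d})" by (rule sum.cong) (auto simp: \<rho>'_def)
    ultimately show ?thesis using d by (simp add: \<rho>'_def)
  qed
  moreover have "\<rho>' i = 0" if "k \<le> i" for i using Suc.prems(2) that by (simp add: \<rho>'_def)
  ultimately obtain R where R: "ballot no_boxes R" "grow no_boxes R = \<rho>'"
    using Suc.hyps(1)[of \<rho>'] Suc.hyps(2) dec by auto
  have "addable \<rho>' d" using Suc.prems(1) e decr_add_box[OF dec] by simp
  then have "ballot no_boxes (R @ [d]) \<and> grow no_boxes (R @ [d]) = \<rho>"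
    using R dec e Suc.prems(1) by auto
  then show ?case by blast
qed

lemma grow_0_finite: "grow no_boxes R i = 0" if "Suc (Max (insert 0 (set R))) \<le> i"
proof -
  have "i \<notin> set R"
  proof
    assume "i \<in> set R"
    then have "i \<le> Max (insert 0 (set R))" by (intro Max_ge) auto
    then show False using that by simp
  qed
  then show ?thesis by (simp add: grow_apply count_list_0_iff)
qed

section \<open>Rectification of words\<close>

text \<open>\<open>rectifies n \<rho> q z\<close>: the skew tableau \<open>q\<close> on \<open>\<rho>\<close> records the insertion of a word \<open>v\<close> after a word
  of length \<open>n\<close>, and \<open>z\<close> records that of \<open>v\<close> alone. The first word can be traded for any other one with
  the same insertion tableau, so every order of the slides is available.\<close>

definition rectifies :: "nat \<Rightarrow> (nat \<Rightarrow> nat) \<Rightarrow> nat list \<Rightarrow> nat list \<Rightarrow> bool" where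
  "rectifies n \<rho> q z \<longleftrightarrow>
     (\<exists>u v. length u = n \<and> grow no_boxes (Q_tab u) = \<rho> \<and> rec_list (P_tab u) v = q \<and> z = Q_tab v)"

lemma rectifies_ballot: "rectifies n \<rho> q z \<Longrightarrow> ballot \<rho> q"
  unfolding rectifies_def using rec_list_ballot P_tab_ballot grow_P_Q by metis

lemma rectifies_decr: "rectifies n \<rho> q z \<Longrightarrow> decr \<rho>"
  using rectifies_ballot ballot_decr by blast

lemma rectifies_0: "rectifies n no_boxes q z \<Longrightarrow> z = q"
proof -
  assume "rectifies n no_boxes q z"
  then obtain u v where u: "grow no_boxes (Q_tab u) = no_boxes" "rec_list (P_tab u) v = q" "z = Q_tab v"
    unfolding rectifies_def by blast
  have "Q_tab u = []"
  proof (rule ccontr)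
    assume "Q_tab u \<noteq> []"
    then obtain s where "s \<in> set (Q_tab u)" by (meson last_in_set)
    then show False using fun_cong[OF u(1), of s] by (simp add: grow_apply count_list_0_iff)
  qed
  then have "u = []" by (metis length_0_conv length_rec_list)
  then show "z = q" using u by simp
qed

lemma rectifies_append: "rectifies (length u) (grow no_boxes (Q_tab u)) (rec_list (P_tab u) v) (Q_tab v)"
  unfolding rectifies_def by blast

lemma rectifies_step:
  assumes "rectifies n (add_box \<rho> d) q z" "decr \<rho>"
  shows "\<exists>m. n = Suc m \<and> rectifies m \<rho> (jout \<rho> d q) z"
proof -
  obtain u v where u: "length u = n" "grow no_boxes (Q_tab u) = add_box \<rho> d" "rec_list (P_tab u) v = q" "z = Q_tab v"
    using assms(1) unfolding rectifies_def by blast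
  have "\<rho> i = 0" if i: "Suc (Max (insert 0 (set (Q_tab u)))) \<le> i" for i
    using grow_0_finite[OF i] unfolding u(2) add_box_apply by (auto split: if_splits)
  then obtain R1 where R1: "ballot no_boxes R1" "grow no_boxes R1 = \<rho>"
    using ballot_exists[OF assms(2)] by blast
  have ad: "addable \<rho> d" using rectifies_decr[OF assms(1)] decr_add_box[OF assms(2)] by blast
  \<comment> \<open>A reverse slide from the corner \<open>d\<close> through a filling of
    \<open>\<rho>\<close>: a first letter recorded in front of \<open>Q\<close> vacates
    \<open>d\<close> when it is deleted.\<close>
  obtain h Q where Q: "addable no_boxes h" "ballot (add_box no_boxes h) Q"
    "jout no_boxes h Q = R1" "jhole no_boxes h Q = d"
    using jout_surj[OF R1(1), of d] R1(2) ad by auto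
  have h: "h = 0" using Q(1) by (cases h) auto
  have bR: "ballot no_boxes (0 # Q)" using Q(2) h by simp
  have gR: "grow no_boxes (0 # Q) = add_box \<rho> d"
    using jout_ballot[of no_boxes h Q] Q h R1(2) by simp
  \<comment> \<open>The exchange of words: \<open>w\<close> has the insertion tableau of
    \<open>u\<close>, so the recording of \<open>v\<close> after \<open>w\<close> is still
    \<open>q\<close>.\<close>
  obtain w where w: "P_tab w = P_tab u" "Q_tab w = 0 # Q"
    using rsk_surj[of "P_tab u" "0 # Q"] P_tab_ballot bR valid_ins_list u(2) gR grow_P_Q
    by (metis valid.simps(2))
  have lw: "length w = Suc (length Q)" using w(2) by (metis length_rec_list length_Cons)
  then obtain y u1 where yu: "w = y # u1" "length u1 = length Q" by (cases w) auto
  have "Q_tab (u1 @ v) = jout no_boxes 0 (tl (Q_tab (w @ v)))"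
    using Q_tab_tl[of "u1 @ v" y] yu by simp
  also have "\<dots> = jout no_boxes 0 (Q @ q)"
    using w u(3) by simp
  also have "\<dots> = R1 @ jout \<rho> d q"
    using Q h R1(2) by (simp add: jout_append)
  finally have "Q_tab u1 = R1 \<and> rec_list (P_tab u1) v = jout \<rho> d q"
    using yu(2) Q(3) by (auto simp: append_eq_append_conv)
  moreover have "length u = length w"
  proof -
    have "length (Q_tab u) = length (Q_tab w)"
    proof -
      have "mset (Q_tab u) = mset (Q_tab w)"
      proof (rule multiset_eqI)
        fix i
        have "count_list (Q_tab u) i = count_list (Q_tab w) i"
          using fun_cong[OF u(2), of i] fun_cong[OF gR, of i] w(2) by (simp only: grow_apply)
        then show "count (mset (Q_tab u)) i = count (mset (Q_tab w)) i"
          by (simp add: count_mset)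
      qed
      then show ?thesis by (metis size_mset)
    qed
    then show ?thesis by simp
  qed
  ultimately have "n = Suc (length u1) \<and> rectifies (length u1) \<rho> (jout \<rho> d q) z"
    unfolding rectifies_def using u(1,4) yu R1(2) by auto
  then show ?thesis by blast
qed

section \<open>Tableaux from words\<close>

fun tab :: "(nat \<Rightarrow> nat) \<Rightarrow> (nat \<times> nat) list \<Rightarrow> tableau" where
  "tab \<kappa> [] = Map.empty"
| "tab \<kappa> ((a, s) # l) = (tab (add_box \<kappa> s) l)((s, \<kappa> s) \<mapsto> a)"

declare tab.simps(2) [simp del]

lemma tab_Cons [simp]: "tab \<kappa> ((a, s) # l) = (tab (add_box \<kappa> s) l)((s, \<kappa> s) \<mapsto> a)"
  by (rule tab.simps)

lemma dom_tab: "dom (tab \<kappa> l) = {(i, j). \<kappa> i \<le> j \<and> j < grow \<kappa> (rows l) i}"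
proof (induction l arbitrary: \<kappa>)
  case (Cons p l)
  obtain a s where p: "p = (a, s)" by fastforce
  have "\<kappa> s < grow (add_box \<kappa> s) (rows l) s" by (simp add: grow_apply add_box_apply)
  moreover have "dom (tab \<kappa> (p # l)) = insert (s, \<kappa> s) {(i, j). add_box \<kappa> s i \<le> j \<and> j < grow (add_box \<kappa> s) (rows l) i}"
    using Cons.IH[of "add_box \<kappa> s"] p by simp
  moreover have "rows (p # l) = s # rows l" using p by simp
  ultimately show ?case by (auto simp: add_box_apply[of \<kappa> s] split: if_splits)
qed auto

lemma tab_None: "tab \<kappa> l (i, j) = None \<longleftrightarrow> j < \<kappa> i \<or> grow \<kappa> (rows l) i \<le> j"
proof -
  have "tab \<kappa> l (i, j) = None \<longleftrightarrow> (i, j) \<notin> dom (tab \<kappa> l)" by (simp add: domIff)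
  then show ?thesis by (auto simp: dom_tab)
qed

lemma ran_tab: "ran (tab \<kappa> l) = fst ` set l"
proof (induction l arbitrary: \<kappa>)
  case (Cons p l)
  obtain a s where p: "p = (a, s)" by fastforce
  have "tab (add_box \<kappa> s) l (s, \<kappa> s) = None" by (simp add: tab_None add_box_apply)
  then have r: "ran (tab \<kappa> (p # l)) = insert a (ran (tab (add_box \<kappa> s) l))"
    unfolding p tab_Cons by (rule ran_map_upd)
  show ?case unfolding r Cons.IH using p by simp
qed auto

lemma tab_enumerate_ge: "tab \<kappa> (List.enumerate k q) c = Some b \<Longrightarrow> k \<le> b \<and> b < k + length q"
  using ranI[of "tab \<kappa> (List.enumerate k q)" c b] unfolding ran_tab by (auto simp: in_set_enumerate_eq)

text \<open>The comparisons in the rules \<open>right\<close> and \<open>down\<close> are strict and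
  exclude each other.\<close>

lemma slide_deterministic: "slide T c S \<Longrightarrow> slide T c S' \<Longrightarrow> S = S'"
proof (induction arbitrary: S' rule: slide.induct)
  case (stop T i j)
  from stop(3,1,2) show ?case by (cases rule: slide.cases) auto
next
  case (right T i j a S)
  from right.prems show ?case
  proof (cases rule: slide.cases)
    case (right a')
    then have "slide (T((i, j) := Some a, (i, Suc j) := None)) (i, Suc j) S'"
      using \<open>T (i, Suc j) = Some a\<close> by simp
    then show ?thesis by (rule right.IH)
  next
    case (down b)
    then show ?thesis using right.hyps(1,2) by fastforce
  qed (use right.hyps in auto)
next
  case (down T i j b S)
  from down.prems show ?case
  proof (cases rule: slide.cases)
    case (right a)
    then show ?thesis using down.hyps(1,2) by fastforce
  next
    case (down b')
    then have "slide (T((i, j) := Some b, (Suc i, j) := None)) (Suc i, j) S'"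
      using \<open>T (Suc i, j) = Some b\<close> by simp
    then show ?thesis by (rule down.IH)
  qed (use down.hyps in auto)
qed

text \<open>A slide reads and writes only cells weakly south-east of its hole. An entry that has
  already been processed can therefore be put back afterwards.\<close>

lemma slide_frame:
  "slide T c S \<Longrightarrow> \<not> (fst c \<le> fst x \<and> snd c \<le> snd x) \<Longrightarrow> slide (T(x := v)) c (S(x := v))"
proof (induction rule: slide.induct)
  case (stop T i j)
  then have "x \<noteq> (i, Suc j)" "x \<noteq> (Suc i, j)" by auto
  then show ?case using stop.hyps by (intro slide.stop) simp_all
next
  case (right T i j a S)
  have n: "x \<noteq> (i, j)" "x \<noteq> (i, Suc j)" "x \<noteq> (Suc i, j)" using right.prems by auto
  have "slide ((T((i, j) := Some a, (i, Suc j) := None))(x := v)) (i, Suc j) (S(x := v))"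
  proof (rule right.IH)
    show "\<not> (fst (i, Suc j) \<le> fst x \<and> snd (i, Suc j) \<le> snd x)" using right.prems by auto
  qed
  moreover have "(T((i, j) := Some a, (i, Suc j) := None))(x := v) = (T(x := v))((i, j) := Some a, (i, Suc j) := None)"
    using n by (auto simp: fun_eq_iff)
  ultimately have "slide ((T(x := v))((i, j) := Some a, (i, Suc j) := None)) (i, Suc j) (S(x := v))"
    by (simp only:)
  then show ?case by (rule slide.right[rotated 2]) (use n right.hyps(1,2) in simp_all)
next
  case (down T i j b S)
  have n: "x \<noteq> (i, j)" "x \<noteq> (i, Suc j)" "x \<noteq> (Suc i, j)" using down.prems by auto
  have "slide ((T((i, j) := Some b, (Suc i, j) := None))(x := v)) (Suc i, j) (S(x := v))"
  proof (rule down.IH)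
    show "\<not> (fst (Suc i, j) \<le> fst x \<and> snd (Suc i, j) \<le> snd x)" using down.prems by auto
  qed
  moreover have "(T((i, j) := Some b, (Suc i, j) := None))(x := v) = (T(x := v))((i, j) := Some b, (Suc i, j) := None)"
    using n by (auto simp: fun_eq_iff)
  ultimately have "slide ((T(x := v))((i, j) := Some b, (Suc i, j) := None)) (Suc i, j) (S(x := v))"
    by (simp only:)
  then show ?case by (rule slide.down[rotated 2]) (use n down.hyps(1,2) in simp_all)
qed

text \<open>Entries are processed in increasing order. All those still in \<open>T\<close> exceed
  \<open>k\<close>, so whenever \<open>k\<close> is adjacent to the hole it wins the
  comparison.\<close>

lemma slide_tab:
  assumes "decr \<kappa>" "addable \<kappa> h" "ballot (add_box \<kappa> h) q"
  shows "slide (tab (add_box \<kappa> h) (List.enumerate k q)) (h, \<kappa> h) (tab \<kappa> (List.enumerate k (jout \<kappa> h q)))"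
  using assms
proof (induction q arbitrary: \<kappa> h k)
  case Nil
  then show ?case by (auto intro: slide.stop)
next
  case (Cons S q)
  obtain s H where j: "jstep \<kappa> h S = (s, H)" by fastforce
  have S: "addable (add_box \<kappa> h) S" "ballot (add_box (add_box \<kappa> h) S) q" using Cons.prems by auto
  note a = jstep_addable[OF Cons.prems(1,2) S(1) j]
  define T where "T = tab (add_box (add_box \<kappa> h) S) (List.enumerate (Suc k) q)"
  define U where "U = tab (add_box \<kappa> s) (List.enumerate (Suc k) (jout (add_box \<kappa> s) H q))"
  have IH: "slide T (H, add_box \<kappa> s H) U"
    using Cons.IH[of "add_box \<kappa> s" H "Suc k"] decr_add_box[OF Cons.prems(1)] a S(2)
    by (simp add: T_def U_def)
  have lhs: "tab (add_box \<kappa> h) (List.enumerate k (S # q)) = T((S, add_box \<kappa> h S) \<mapsto> k)"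
    by (simp add: T_def enumerate_simps)
  have rhs: "tab \<kappa> (List.enumerate k (jout \<kappa> h (S # q))) = U((s, \<kappa> s) \<mapsto> k)"
    using j by (simp add: U_def enumerate_simps)
  have ge: "k < b" if "T c = Some b" for b c
    using tab_enumerate_ge that unfolding T_def by (metis Suc_le_eq)
  have TS: "T (S, add_box \<kappa> h S) = None" by (simp add: T_def tab_None add_box_apply)
  show ?case
    unfolding lhs rhs using j
  proof (cases rule: jstep_elim)
    case J1
    have "slide (T((h, \<kappa> h) \<mapsto> k)) (h, Suc (\<kappa> h)) (U((h, \<kappa> h) \<mapsto> k))"
      using slide_frame[OF IH, of "(h, \<kappa> h)" "Some k"] J1 by (simp add: add_box_apply)
    moreover have "T((h, Suc (\<kappa> h)) \<mapsto> k, (h, \<kappa> h) \<mapsto> k, (h, Suc (\<kappa> h)) := None) = T((h, \<kappa> h) \<mapsto> k)"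
      using TS J1(1) by (auto simp: fun_eq_iff add_box_apply)
    ultimately have f: "slide (T((h, Suc (\<kappa> h)) \<mapsto> k, (h, \<kappa> h) \<mapsto> k, (h, Suc (\<kappa> h)) := None)) (h, Suc (\<kappa> h)) (U((h, \<kappa> h) \<mapsto> k))"
      by (simp only:)
    have "slide (T((h, Suc (\<kappa> h)) \<mapsto> k)) (h, \<kappa> h) (U((h, \<kappa> h) \<mapsto> k))"
      by (rule slide.right[OF _ _ f]) (simp_all add: ge)
    moreover have "add_box \<kappa> h h = Suc (\<kappa> h)" by (simp add: add_box_apply)
    ultimately show "slide (T((S, add_box \<kappa> h S) \<mapsto> k)) (h, \<kappa> h) (U((s, \<kappa> s) \<mapsto> k))"
      using J1(1,2) by (simp only:)
  next
    case J3
    have "slide (T((h, \<kappa> h) \<mapsto> k)) (Suc h, \<kappa> h) (U((h, \<kappa> h) \<mapsto> k))"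
      using slide_frame[OF IH, of "(h, \<kappa> h)" "Some k"] J3 by (simp add: add_box_apply)
    moreover have "T((Suc h, \<kappa> h) \<mapsto> k, (h, \<kappa> h) \<mapsto> k, (Suc h, \<kappa> h) := None) = T((h, \<kappa> h) \<mapsto> k)"
      using TS J3(1,2) by (auto simp: fun_eq_iff add_box_apply)
    ultimately have f: "slide (T((Suc h, \<kappa> h) \<mapsto> k, (h, \<kappa> h) \<mapsto> k, (Suc h, \<kappa> h) := None)) (Suc h, \<kappa> h) (U((h, \<kappa> h) \<mapsto> k))"
      by (simp only:)
    have "slide (T((Suc h, \<kappa> h) \<mapsto> k)) (h, \<kappa> h) (U((h, \<kappa> h) \<mapsto> k))"
      by (rule slide.down[OF _ _ f]) (simp_all add: ge)
    moreover have "add_box \<kappa> h (Suc h) = \<kappa> h" using J3(2) by (simp add: add_box_apply)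
    ultimately show "slide (T((S, add_box \<kappa> h S) \<mapsto> k)) (h, \<kappa> h) (U((s, \<kappa> s) \<mapsto> k))"
      using J3(1,3) by (simp only:)
  next
    case J2
    \<comment> \<open>In a row below the hole the free box is strictly to the left of the hole, so
      this entry is outside the region touched by the slide.\<close>
    have "\<not> (h \<le> S \<and> \<kappa> h \<le> \<kappa> S)"
      using addable_less[of \<kappa> S h] a(1) J2 Cons.prems(1) by auto
    then show "slide (T((S, add_box \<kappa> h S) \<mapsto> k)) (h, \<kappa> h) (U((s, \<kappa> s) \<mapsto> k))"
      using slide_frame[OF IH, of "(S, \<kappa> S)" "Some k"] J2 by (simp add: add_box_apply)
  qed
qed

section \<open>Rectification\<close>

abbreviation stab :: "(nat \<Rightarrow> nat) \<Rightarrow> nat list \<Rightarrow> tableau" where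
  "stab \<rho> q \<equiv> tab \<rho> (List.enumerate 1 q)"

lemma rows_enumerate [simp]: "rows (List.enumerate k q) = q"
  by (simp add: enumerate_eq_zip)

lemma inner_cells_I: "(i, j) \<notin> dom T \<Longrightarrow> (k, l) \<in> dom T \<Longrightarrow> i \<le> k \<Longrightarrow> j \<le> l \<Longrightarrow> (i, j) \<in> inner_cells T"
  unfolding inner_cells_def by blast

lemma inner_cells_stab:
  assumes "ballot \<rho> q" "(i, j) \<in> inner_cells (stab \<rho> q)"
  shows "j < \<rho> i"
proof -
  from assms(2) obtain k l where kl: "(i, j) \<notin> dom (stab \<rho> q)" "(k, l) \<in> dom (stab \<rho> q)" "i \<le> k" "j \<le> l"
    unfolding inner_cells_def by auto
  have "grow \<rho> q k \<le> grow \<rho> q i" using decr_antimono[OF ballot_grow_decr[OF assms(1)] kl(3)] .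
  then show ?thesis using kl by (auto simp: dom_tab)
qed

lemma inner_cells_straight: "ballot no_boxes q \<Longrightarrow> inner_cells (stab no_boxes q) = {}"
  using inner_cells_stab by fastforce

lemma inner_corner_stab:
  assumes "ballot (add_box \<rho> d) q" "decr \<rho>" "(d, \<rho> d) \<in> inner_cells (stab (add_box \<rho> d) q)"
  shows "inner_corner (stab (add_box \<rho> d) q) (d, \<rho> d)"
  unfolding inner_corner_def fst_conv snd_conv
proof (intro conjI notI)
  assume "(d, Suc (\<rho> d)) \<in> inner_cells (stab (add_box \<rho> d) q)"
  from inner_cells_stab[OF assms(1) this] show False by (simp add: add_box_apply)
next
  assume "(Suc d, \<rho> d) \<in> inner_cells (stab (add_box \<rho> d) q)"
  from inner_cells_stab[OF assms(1) this] show False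
    using decr_antimono[OF assms(2), of d "Suc d"] by (simp add: add_box_apply)
qed (use assms in simp)

text \<open>No entry lies weakly south-east of a box that is not an inner cell in the minimal sense.
  The slide stops at once, and determinism identifies the result with \<open>jout\<close>.\<close>

lemma trivial_slide:
  assumes "ballot (add_box \<rho> d) q" "decr \<rho>" "(d, \<rho> d) \<notin> inner_cells (stab (add_box \<rho> d) q)"
  shows "stab \<rho> (jout \<rho> d q) = stab (add_box \<rho> d) q"
proof -
  let ?T = "stab (add_box \<rho> d) q"
  have ad: "addable \<rho> d" using decr_add_box[OF assms(2)] ballot_decr[OF assms(1)] by blast
  have "(d, \<rho> d) \<notin> dom ?T" by (simp add: dom_tab add_box_apply)
  then have "(i, j) \<notin> dom ?T" if "d \<le> i" "\<rho> d \<le> j" for i j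
    using assms(3) that unfolding inner_cells_def by blast
  then have "slide ?T (d, \<rho> d) ?T" by (intro slide.stop) (auto simp: domIff)
  then show ?thesis using slide_tab[OF assms(2) ad assms(1)] slide_deterministic by blast
qed

lemma rectifies_grow:
  assumes "rectifies n \<rho> q z" 
  obtains R where "ballot no_boxes R" "grow no_boxes R = \<rho>"
  using assms Q_tab_ballot unfolding rectifies_def by blast

text \<open>A filling of \<open>\<rho>\<close>, read backwards, is an order in which to use up the
  inner boxes. Boxes outside the minimal inner partition contribute no step.\<close>

lemma rect_exists:
  assumes "rectifies n \<rho> q z"
  shows "jdt_step\<^sup>*\<^sup>* (stab \<rho> q) (stab no_boxes z)"
proof -
  obtain R where R: "ballot no_boxes R" "grow no_boxes R = \<rho>" using rectifies_grow[OF assms] .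
  from R assms show ?thesis
  proof (induction R arbitrary: n \<rho> q rule: rev_induct)
    case Nil
    then have "z = q" using rectifies_0 by simp
    then show ?case using Nil by simp
  next
    case (snoc d R)
    let ?r = "grow no_boxes R"
    have \<rho>: "\<rho> = add_box ?r d" and dr: "decr ?r" using snoc.prems(1,2) by (auto dest: ballot_grow_decr)
    obtain m where m: "rectifies m ?r (jout ?r d q) z"
      using rectifies_step snoc.prems(3) \<rho> dr by blast
    have b: "ballot (add_box ?r d) q" using rectifies_ballot snoc.prems(3) \<rho> by simp
    have IH: "jdt_step\<^sup>*\<^sup>* (stab ?r (jout ?r d q)) (stab no_boxes z)"
      using snoc.IH[OF _ refl m] snoc.prems(1) by simp
    show ?case
    proof (cases "(d, ?r d) \<in> inner_cells (stab \<rho> q)")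
      case True
      have "slide (stab \<rho> q) (d, ?r d) (stab ?r (jout ?r d q))"
        using slide_tab[OF dr _ b] decr_add_box[OF dr] ballot_decr[OF b] \<rho> by auto
      then have "jdt_step (stab \<rho> q) (stab ?r (jout ?r d q))"
        using inner_corner_stab[OF b dr] True \<rho> unfolding jdt_step_def by auto
      then show ?thesis using IH by (rule converse_rtranclp_into_rtranclp)
    next
      case False
      then show ?thesis using trivial_slide[OF b dr] IH \<rho> by simp
    qed
  qed
qed

text \<open>Every box of \<open>\<rho>\<close> can be removed by a slide that moves nothing.\<close>

lemma rectifies_no_inner:
  assumes "rectifies n \<rho> q z" "inner_cells (stab \<rho> q) = {}"
  shows "stab \<rho> q = stab no_boxes z"
proof -
  obtain R where R: "ballot no_boxes R" "grow no_boxes R = \<rho>" using rectifies_grow[OF assms(1)] .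
  from R assms show ?thesis
  proof (induction R arbitrary: n \<rho> q rule: rev_induct)
    case Nil
    then have "z = q" using rectifies_0 by simp
    then show ?case using Nil by simp
  next
    case (snoc d R)
    let ?r = "grow no_boxes R"
    have \<rho>: "\<rho> = add_box ?r d" and dr: "decr ?r" using snoc.prems(1,2) by (auto dest: ballot_grow_decr)
    obtain m where m: "rectifies m ?r (jout ?r d q) z"
      using rectifies_step snoc.prems(3) \<rho> dr by blast
    have b: "ballot (add_box ?r d) q" using rectifies_ballot snoc.prems(3) \<rho> by simp
    have t: "stab ?r (jout ?r d q) = stab \<rho> q" using trivial_slide[OF b dr] snoc.prems(4) \<rho> by simp
    then show ?case
      using snoc.IH[OF _ refl m] snoc.prems(1,4) by simp
  qed
qed

text \<open>The inner partition \<open>\<rho>\<close> may be larger than necessary; trivial slides shrink it until the given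
  inner corner of the tableau becomes a corner of \<open>\<rho>\<close>.\<close>

lemma shrink_to_corner:
  assumes "rectifies n \<rho> q z" "inner_corner (stab \<rho> q) (i, j)"
  shows "\<exists>m \<rho>' q'. decr \<rho>' \<and> \<rho>' i = j \<and> rectifies m (add_box \<rho>' i) q' z \<and> stab (add_box \<rho>' i) q' = stab \<rho> q"
  using assms
proof (induction n arbitrary: \<rho> q rule: less_induct)
  case (less n)
  note b = rectifies_ballot[OF less.prems(1)]
  note d\<rho> = rectifies_decr[OF less.prems(1)]
  have ij: "(i, j) \<in> inner_cells (stab \<rho> q)" "(i, Suc j) \<notin> inner_cells (stab \<rho> q)"
    "(Suc i, j) \<notin> inner_cells (stab \<rho> q)"
    using less.prems(2) unfolding inner_corner_def by auto
  have j: "j < \<rho> i" using inner_cells_stab[OF b ij(1)] .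
  obtain R where R: "grow no_boxes R = \<rho>" using rectifies_grow[OF less.prems(1)] by blast
  have "finite {e. j < \<rho> e}"
  proof (rule finite_subset)
    show "{e. j < \<rho> e} \<subseteq> set R" 
    proof
      fix e assume "e \<in> {e. j < \<rho> e}"
      then have "count_list R e \<noteq> 0" using R[symmetric] by (simp add: grow_apply)
      then show "e \<in> set R" by (simp add: count_list_0_iff)
    qed
  qed simp
  \<comment> \<open>The lowest row of \<open>\<rho>\<close> reaching beyond column \<open>j\<close>.
    Its last box is a corner of \<open>\<rho>\<close> and lies weakly south-east of
    \<open>(i, j)\<close>.\<close>
  define d where "d = Max {e. j < \<rho> e}"
  have d: "j < \<rho> d" "i \<le> d" and dS: "\<rho> (Suc d) \<le> j"
  proof -
    show "j < \<rho> d" using Max_in[OF \<open>finite {e. j < \<rho> e}\<close>] j unfolding d_def by auto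
    show "i \<le> d" unfolding d_def using \<open>finite {e. j < \<rho> e}\<close> j by (intro Max_ge) auto
    show "\<rho> (Suc d) \<le> j"
      using Max_ge[OF \<open>finite {e. j < \<rho> e}\<close>, of "Suc d"] unfolding d_def[symmetric] by (metis mem_Collect_eq not_le Suc_n_not_le_n)
  qed
  define \<rho>' where "\<rho>' = \<rho>(d := \<rho> d - 1)"
  have \<rho>: "\<rho> = add_box \<rho>' d" using d(1) by (simp add: \<rho>'_def add_box_def)
  have dr: "decr \<rho>'" unfolding decr_def
  proof
    fix e
    show "\<rho>' (Suc e) \<le> \<rho>' e"
      using d\<rho>[unfolded decr_def, rule_format, of e] dS d(1) by (auto simp: \<rho>'_def)
  qed
  have r'd: "\<rho>' d = \<rho> d - 1" by (simp add: \<rho>'_def)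
  show ?case
  proof (cases "d = i \<and> \<rho>' d = j")
    case True
    then show ?thesis using dr less.prems(1) \<rho> by blast
  next
    case False
    \<comment> \<open>An inner cell there would turn the right or the lower neighbour of
      \<open>(i, j)\<close> into an inner cell too, against the choice of a corner.\<close>
    have "(d, \<rho>' d) \<notin> inner_cells (stab \<rho> q)"
    proof
      assume "(d, \<rho>' d) \<in> inner_cells (stab \<rho> q)"
      then obtain k l where kl: "(k, l) \<in> dom (stab \<rho> q)" "d \<le> k" "\<rho>' d \<le> l" unfolding inner_cells_def by auto
      have jd: "j \<le> \<rho>' d" using d r'd by simp
      show False
      proof (cases "d = i")
        case True
        then have "Suc j \<le> \<rho>' d" using False jd by simp
        moreover have "(i, Suc j) \<notin> dom (stab \<rho> q)"
          using calculation True r'd d(1) by (auto simp: dom_tab)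
        ultimately show False using ij(2) inner_cells_I[OF _ kl(1), of i "Suc j"] kl True by simp
      next
        case n: False
        then have "Suc i \<le> d" using d(2) by simp
        moreover have "(Suc i, j) \<notin> dom (stab \<rho> q)"
          using decr_antimono[OF d\<rho> calculation] d(1) by (auto simp: dom_tab)
        ultimately show False using ij(3) inner_cells_I[OF _ kl(1), of "Suc i" j] kl jd by simp
      qed
    qed
    then have t: "stab \<rho>' (jout \<rho>' d q) = stab \<rho> q" using trivial_slide[of \<rho>' d q] b dr \<rho> by simp
    obtain m where m: "n = Suc m" "rectifies m \<rho>' (jout \<rho>' d q) z"
      using rectifies_step less.prems(1) \<rho> dr by blast
    then show ?thesis using less.IH[of m \<rho>' "jout \<rho>' d q"] t less.prems(2) by simp
  qed
qed

text \<open>Whatever corner a run of slides chooses, the encoded inner shape can be shrunk until it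
  has this corner. The step is then the one of \<open>rectifies_step\<close>, which fixes
  \<open>z\<close>.\<close>

lemma rect_unique:
  assumes "jdt_step\<^sup>*\<^sup>* T S" "inner_cells S = {}" "T = stab \<rho> q" "rectifies n \<rho> q z"
  shows "S = stab no_boxes z"
  using assms
proof (induction arbitrary: n \<rho> q rule: converse_rtranclp_induct)
  case base
  then show ?case using rectifies_no_inner by simp
next
  case (step T T1)
  obtain i j where c: "inner_corner T (i, j)" "slide T (i, j) T1"
  proof -
    from step.hyps(1) obtain c where "inner_corner T c" "slide T c T1" unfolding jdt_step_def by blast
    then show ?thesis using that[of "fst c" "snd c"] by simp
  qed
  have c1: "inner_corner (stab \<rho> q) (i, j)" using c(1) step.prems(2) by simp
  obtain m \<rho>' q' where r: "decr \<rho>'" "\<rho>' i = j" "rectifies m (add_box \<rho>' i) q' z" "stab (add_box \<rho>' i) q' = T"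
    using shrink_to_corner[OF step.prems(3) c1] step.prems(2) by auto
  have b: "ballot (add_box \<rho>' i) q'" using rectifies_ballot r(3) .
  have "slide T (i, j) (stab \<rho>' (jout \<rho>' i q'))"
    using slide_tab[OF r(1) _ b, of 1] decr_add_box[OF r(1)] ballot_decr[OF b] r(2,4) by auto
  then have T1: "T1 = stab \<rho>' (jout \<rho>' i q')" using c(2) slide_deterministic by blast
  obtain m' where "rectifies m' \<rho>' (jout \<rho>' i q') z" using rectifies_step[OF r(3,1)] by blast
  then show ?case using step.IH[OF step.prems(1) T1] by blast
qed

theorem rect_stab:
  assumes "rectifies n \<rho> q z"
  shows "rect (stab \<rho> q) = stab no_boxes z"
  unfolding rect_def
proof (rule the_equality)
  have "ballot no_boxes z" using assms Q_tab_ballot unfolding rectifies_def by blast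
  then show "jdt_step\<^sup>*\<^sup>* (stab \<rho> q) (stab no_boxes z) \<and> inner_cells (stab no_boxes z) = {}"
    using rect_exists[OF assms] inner_cells_straight by blast
next
  fix S assume "jdt_step\<^sup>*\<^sup>* (stab \<rho> q) S \<and> inner_cells S = {}"
  then show "S = stab no_boxes z" using rect_unique[OF _ _ refl assms] by blast
qed

section \<open>Restriction to an interval\<close>

lemma tab_append: "tab \<kappa> (l @ m) = tab (grow \<kappa> (rows l)) m ++ tab \<kappa> l"
proof (induction l arbitrary: \<kappa>)
  case (Cons p l)
  obtain a s where p: "p = (a, s)" by fastforce
  show ?case unfolding p append_Cons tab_Cons Cons.IH by (simp only: list.map snd_conv grow.simps map_add_upd)
qed simp

lemma restrict_stab:
  "restrict_entries (stab \<kappa> (q1 @ q2 @ q3)) {length q1 + 1..length q1 + length q2} =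
     tab (grow \<kappa> q1) (List.enumerate (Suc (length q1)) q2)"
proof
  fix c :: cell
  obtain i j where c: "c = (i, j)" by fastforce
  define A where "A = stab \<kappa> q1"
  define B where "B = tab (grow \<kappa> q1) (List.enumerate (Suc (length q1)) q2)"
  define C where "C = tab (grow (grow \<kappa> q1) q2) (List.enumerate (Suc (length q1 + length q2)) q3)"
  have T: "stab \<kappa> (q1 @ q2 @ q3) = (C ++ B) ++ A"
    unfolding A_def B_def C_def
    by (simp add: enumerate_append_eq tab_append add.commute)
  let ?I = "{length q1 + 1..length q1 + length q2}"
  have A: "v < Suc (length q1)" if "A c = Some v" for v
    using tab_enumerate_ge[of \<kappa> 1 q1 c v] that by (simp add: A_def)
  have B: "v \<in> ?I" if "B c = Some v" for v
    using tab_enumerate_ge[of _ _ q2 c v] that unfolding B_def by fastforce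
  have C: "v > length q1 + length q2" if "C c = Some v" for v
    using tab_enumerate_ge[of _ _ q3 c v] that unfolding C_def by fastforce
  have AB: "A c = None \<or> B c = None"
    unfolding A_def B_def c tab_None by auto
  have "restrict_entries ((C ++ B) ++ A) ?I c = B c"
  proof (cases "A c")
    case (Some v)
    then show ?thesis using A[OF Some] AB by (auto simp: restrict_entries_def restrict_map_def)
  next
    case None
    show ?thesis
    proof (cases "B c")
      case N: None
      show ?thesis
        using None N C by (cases "C c") (auto simp: restrict_entries_def restrict_map_def map_add_def)
    next
      case (Some v)
      then show ?thesis using None B[OF Some]
        by (auto simp: restrict_entries_def restrict_map_def map_add_def)
    qed
  qed
  then show "restrict_entries (stab \<kappa> (q1 @ q2 @ q3)) ?I c = B c" unfolding T .
qed

lemma map_option_tab: "map_option f (tab \<kappa> l c) = tab \<kappa> (map (apfst f) l) c"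
proof (induction l arbitrary: \<kappa>)
  case (Cons p l)
  obtain a s where p: "p = (a, s)" by fastforce
  show ?case unfolding p using Cons.IH by simp
qed simp

lemma standardize_tab: "standardize (tab \<kappa> (List.enumerate k q)) = stab \<kappa> q"
proof
  fix c
  let ?f = "\<lambda>v. card {u \<in> ran (tab \<kappa> (List.enumerate k q)). u \<le> v}"
  have ran: "ran (tab \<kappa> (List.enumerate k q)) = {k..<k + length q}"
    unfolding ran_tab by (metis enumerate_eq_zip length_upt list.set_map map_fst_zip add_diff_cancel_left' set_upt)
  have f: "?f (k + i) = Suc i" if "i < length q" for i
  proof -
    have "{u \<in> ran (tab \<kappa> (List.enumerate k q)). u \<le> k + i} = {k..k + i}"
      unfolding ran using that by auto
    then show ?thesis by simp
  qed
  have "map (apfst ?f) (List.enumerate k q) = List.enumerate 1 q"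
    by (rule nth_equalityI) (simp_all add: nth_enumerate_eq f)
  then show "standardize (tab \<kappa> (List.enumerate k q)) c = stab \<kappa> q c"
    unfolding standardize_def map_option_tab by simp
qed

abbreviation QT :: "nat list \<Rightarrow> tableau" where
  "QT w \<equiv> stab no_boxes (Q_tab w)"

lemma interval_rect_QT:
  "interval_rect (QT (u @ v @ w)) {length u + 1..length u + length v} = QT v"
proof -
  let ?q = "rec_list (P_tab u) v"
  have "restrict_entries (QT (u @ v @ w)) {length u + 1..length u + length v}
     = tab (grow no_boxes (Q_tab u)) (List.enumerate (Suc (length u)) ?q)"
    using restrict_stab[of no_boxes "Q_tab u" ?q "rec_list (P_tab (u @ v)) w"] by simp
  then show ?thesis
    unfolding interval_rect_def using standardize_tab rect_stab[OF rectifies_append] by simp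
qed

section \<open>Descents\<close>

lemma set_tab: "(a, s) \<in> set l \<longleftrightarrow> (\<exists>j. tab \<kappa> l (s, j) = Some a)"
proof (induction l arbitrary: \<kappa>)
  case (Cons p l)
  obtain b t where p: "p = (b, t)" by fastforce
  have n: "tab (add_box \<kappa> t) l (t, \<kappa> t) = None" by (simp add: tab_None add_box_apply)
  show ?case
  proof
    assume "(a, s) \<in> set (p # l)"
    then consider "a = b" "s = t" | "(a, s) \<in> set l" using p by auto
    then show "\<exists>j. tab \<kappa> (p # l) (s, j) = Some a"
    proof cases
      case 1
      then show ?thesis using p by auto
    next
      case 2
      then obtain j where "tab (add_box \<kappa> t) l (s, j) = Some a" using Cons.IH by blast
      moreover from this have "(s, j) \<noteq> (t, \<kappa> t)" using n by auto
      ultimately have "tab \<kappa> (p # l) (s, j) = Some a" unfolding p tab_Cons by auto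
      then show ?thesis by blast
    qed
  next
    assume "\<exists>j. tab \<kappa> (p # l) (s, j) = Some a"
    then obtain j where "tab \<kappa> (p # l) (s, j) = Some a" by blast
    then show "(a, s) \<in> set (p # l)"
      unfolding p tab_Cons using Cons.IH[of "add_box \<kappa> t"] by (auto split: if_splits)
  qed
qed simp

text \<open>Rows are numbered downwards, so descents of the tableau are ascents of its row
  sequence.\<close>

lemma Des_stab: "d \<in> Des (stab \<kappa> q) \<longleftrightarrow> 0 < d \<and> d < length q \<and> q ! (d - 1) < q ! d"
proof -
  have e: "(\<exists>j. stab \<kappa> q (i, j) = Some a) \<longleftrightarrow> 0 < a \<and> a \<le> length q \<and> q ! (a - 1) = i" for i a
    unfolding set_tab[symmetric] by (auto simp: in_set_enumerate_eq)
  have "d \<in> Des (stab \<kappa> q) \<longleftrightarrow> (\<exists>i i'. (\<exists>j. stab \<kappa> q (i, j) = Some d) \<and>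
      (\<exists>j'. stab \<kappa> q (i', j') = Some (Suc d)) \<and> i < i')"
    unfolding Des_def by blast
  then show ?thesis unfolding e by auto
qed

text \<open>Only a move from row \<open>Suc h\<close> to row \<open>h\<close> could alter the
  comparison. After a move to the left within row \<open>h\<close> the next entry cannot move up;
  after a move up the next entry is not in row \<open>Suc h\<close>; and an entry that stays is not
  in row \<open>h\<close>.\<close>

lemma jstep_ascent:
  assumes d: "decr \<kappa>" and h: "addable \<kappa> h" and S: "addable (add_box \<kappa> h) S"
    and S2: "addable (add_box (add_box \<kappa> h) S) S2"
    and j: "jstep \<kappa> h S = (s, H)" and j2: "jstep (add_box \<kappa> s) H S2 = (s2, H2)"
  shows "s < s2 \<longleftrightarrow> S < S2"
  using j
proof (cases rule: jstep_elim)
  case J1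
  have "\<not> (S2 = Suc h \<and> add_box \<kappa> h h = add_box \<kappa> h (Suc h))"
    using decr_antimono[OF d, of h "Suc h"] by (simp add: add_box_apply)
  then show ?thesis using j2 J1 unfolding jstep.simps by (auto split: if_splits)
next
  case J3
  have "S2 \<noteq> Suc h" using S2 J3 by (auto simp: add_box_apply)
  then show ?thesis using j2 J3 unfolding jstep.simps by (auto split: if_splits)
next
  case J2
  then show ?thesis using j2 unfolding jstep.simps by (auto split: if_splits)
qed

lemma jout_ascent:
  assumes "decr \<kappa>" "addable \<kappa> h" "ballot (add_box \<kappa> h) Q" "Suc m < length Q"
  shows "jout \<kappa> h Q ! m < jout \<kappa> h Q ! Suc m \<longleftrightarrow> Q ! m < Q ! Suc m"
  using assms
proof (induction Q arbitrary: \<kappa> h m)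
  case (Cons S Q)
  obtain s H where j: "jstep \<kappa> h S = (s, H)" by fastforce
  have S: "addable (add_box \<kappa> h) S" "ballot (add_box (add_box \<kappa> h) S) Q" using Cons.prems by auto
  note a = jstep_addable[OF Cons.prems(1,2) S(1) j]
  show ?case
  proof (cases m)
    case 0
    obtain S2 Q2 where Q: "Q = S2 # Q2" using Cons.prems(4) 0 by (cases Q) auto
    obtain s2 H2 where j2: "jstep (add_box \<kappa> s) H S2 = (s2, H2)" by fastforce
    have "addable (add_box (add_box \<kappa> h) S) S2" using S(2) Q by simp
    then show ?thesis using jstep_ascent[OF Cons.prems(1,2) S(1) _ j j2] 0 Q j j2 by simp
  next
    case (Suc m')
    have "decr (add_box \<kappa> s)" using decr_add_box Cons.prems(1) a(1) by blast
    moreover have "ballot (add_box (add_box \<kappa> s) H) Q" using S(2) a(3) by simp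
    ultimately show ?thesis using Cons.IH[of "add_box \<kappa> s" H m'] a(2) Suc Cons.prems(4) j by simp
  qed
qed simp

lemma Q_tab_ascent:
  assumes "Suc m < length v"
  shows "Q_tab (u @ v) ! (length u + m) < Q_tab (u @ v) ! (length u + Suc m) \<longleftrightarrow> Q_tab v ! m < Q_tab v ! Suc m"
proof (induction u)
  case (Cons y u)
  let ?q = "Q_tab ((y # u) @ v)"
  have q: "?q = 0 # tl ?q" by simp
  have "ballot no_boxes (0 # tl ?q)" using Q_tab_ballot[of "(y # u) @ v"] q by simp
  then have b: "ballot (add_box no_boxes 0) (tl ?q)" by simp
  have "tl ?q ! (length u + m) < tl ?q ! Suc (length u + m) \<longleftrightarrow>
      jout no_boxes 0 (tl ?q) ! (length u + m) < jout no_boxes 0 (tl ?q) ! Suc (length u + m)"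
    using jout_ascent[OF _ _ b, of "length u + m"] assms by simp
  also have "jout no_boxes 0 (tl ?q) = Q_tab (u @ v)" using Q_tab_tl[of "u @ v" y] by simp
  finally show ?case using Cons.IH by simp
qed simp

lemma Des_QT_interval:
  assumes "0 < d" "d < length v"
  shows "length u + d \<in> Des (QT (u @ v @ w)) \<longleftrightarrow> d \<in> Des (QT v)"
proof -
  have q: "Q_tab (u @ v @ w) = Q_tab (u @ v) @ rec_list (P_tab (u @ v)) w" by simp
  have "Q_tab (u @ v @ w) ! (length u + d) = Q_tab (u @ v) ! (length u + d)"
    "Q_tab (u @ v @ w) ! (length u + (d - 1)) = Q_tab (u @ v) ! (length u + (d - 1))"
    unfolding q using assms by (auto simp: nth_append simp del: rec_list_append)
  then show ?thesis
    using Q_tab_ascent[of "d - 1" v u] assms unfolding Des_stab by (simp del: rec_list_append)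
qed

section \<open>Tableaux and ballot sequences\<close>

lemma valid_snoc: "valid (l @ [p]) \<longleftrightarrow>
    valid l \<and> (l \<noteq> [] \<longrightarrow> fst (last l) < fst p \<or> fst (last l) = fst p \<and> snd p \<le> snd (last l))"
proof (induction l rule: valid.induct)
  case ("2_2" v)
  then show ?case by (cases v; cases p) auto
qed (cases p; auto)+

lemma valid_last:
  "valid (l @ [(a, i)]) \<Longrightarrow> (b, s) \<in> set (l @ [(a, i)]) \<Longrightarrow> b < a \<or> b = a \<and> i \<le> s"
proof (induction l arbitrary: a i rule: rev_induct)
  case (snoc p l)
  obtain c t where p: "p = (c, t)" by fastforce
  have v: "valid (l @ [(c, t)])" "c < a \<or> c = a \<and> i \<le> t"
    using snoc.prems(1) valid_snoc[of "l @ [p]" "(a, i)"] p by auto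
  then show ?case using snoc.IH[OF v(1)] snoc.prems(2) p by fastforce
qed simp

lemma valid_hd:
  "valid ((a, s) # l) \<Longrightarrow> (b, t) \<in> set l \<Longrightarrow> a < b \<or> a = b \<and> t \<le> s"
proof (induction l arbitrary: a s)
  case (Cons p l)
  obtain c r where p: "p = (c, r)" by fastforce
  then show ?case using Cons.IH[of c r] Cons.prems by fastforce
qed simp

lemma sorted_valid: "valid l \<Longrightarrow> sorted (map fst l)"
proof (induction l)
  case (Cons p l)
  obtain a s where p: "p = (a, s)" by fastforce
  have "a \<le> b" if "(b, t) \<in> set l" for b t using valid_hd[of a s l b t] that Cons.prems p by auto
  then show ?case using Cons valid_tl p by fastforce
qed simp

lemma valid_enumerate: "valid (List.enumerate k q)"
proof (induction q arbitrary: k)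
  case (Cons s q)
  then show ?case using Cons.IH[of "Suc k"] by (cases q) (auto simp: enumerate_simps)
qed simp

definition filling :: "tableau \<Rightarrow> bool" where
  "filling T \<longleftrightarrow> (\<forall>i j a b. T (i, j) = Some a \<longrightarrow> T (i, Suc j) = Some b \<longrightarrow> a \<le> b) \<and>
     (\<forall>i j a b. T (i, j) = Some a \<longrightarrow> T (Suc i, j) = Some b \<longrightarrow> a < b)"

text \<open>The order of ties makes the columns strict: a later entry with the same letter is in a
  weakly higher row, hence not below.\<close>

lemma filling_tab:
  assumes "valid l" "ballot \<kappa> (rows l)"
  shows "filling (tab \<kappa> l)"
  using assms
proof (induction l arbitrary: \<kappa>)
  case Nil
  then show ?case by (simp add: filling_def)
next
  case (Cons p l)
  obtain a s where p: "p = (a, s)" by fastforce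
  define T where "T = tab (add_box \<kappa> s) l"
  have T: "tab \<kappa> (p # l) = T((s, \<kappa> s) \<mapsto> a)" by (simp only: p tab_Cons T_def)
  have IH: "filling T" unfolding T_def using Cons.IH Cons.prems p valid_tl by auto
  have later: "a < b \<or> a = b \<and> t \<le> s" if "T (t, j) = Some b" for b t j
    using that valid_hd[of a s l b t] Cons.prems(1) p set_tab unfolding T_def by blast
  have out: "T (t, j) = None" if "j < add_box \<kappa> s t" for t j using that by (simp add: T_def tab_None)
  show ?case unfolding T filling_def
  proof (intro conjI allI impI)
    fix i j x y
    assume x: "(T((s, \<kappa> s) \<mapsto> a)) (i, j) = Some x" and y: "(T((s, \<kappa> s) \<mapsto> a)) (i, Suc j) = Some y"
    show "x \<le> y"
    proof (cases "(i, j) = (s, \<kappa> s)")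
      case True
      then have "x = a" "T (i, Suc j) = Some y" using x y by auto
      then show ?thesis using later by fastforce
    next
      case n: False
      then have Tx: "T (i, j) = Some x" using x by (auto split: if_splits)
      have "(i, Suc j) \<noteq> (s, \<kappa> s)" using out[of j s] Tx by (auto simp: add_box_apply)
      then have "T (i, Suc j) = Some y" using y by (auto split: if_splits)
      then show ?thesis using Tx IH unfolding filling_def by blast
    qed
  next
    fix i j x y
    assume x: "(T((s, \<kappa> s) \<mapsto> a)) (i, j) = Some x" and y: "(T((s, \<kappa> s) \<mapsto> a)) (Suc i, j) = Some y"
    show "x < y"
    proof (cases "(i, j) = (s, \<kappa> s)")
      case True
      then have "x = a" "T (Suc i, j) = Some y" using x y by auto
      then show ?thesis using later[of "Suc i" j y] True by auto
    next
      case n: False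
      then have Tx: "T (i, j) = Some x" using x by (auto split: if_splits)
      have "(Suc i, j) \<noteq> (s, \<kappa> s)"
      proof
        assume e: "(Suc i, j) = (s, \<kappa> s)"
        then have "\<kappa> (Suc i) < \<kappa> i" using Cons.prems(2) p by auto
        then show False using out[of j i] e Tx by (auto simp: add_box_apply)
      qed
      then have "T (Suc i, j) = Some y" using y by (auto split: if_splits)
      then show ?thesis using Tx IH unfolding filling_def by blast
    qed
  qed
qed

lemma tab_snoc: "tab \<kappa> (l @ [(a, i)]) = (tab \<kappa> l)((i, grow \<kappa> (rows l) i) \<mapsto> a)"
proof -
  have "tab \<kappa> l (i, grow \<kappa> (rows l) i) = None" by (simp add: tab_None)
  then show ?thesis unfolding tab_append by (auto simp: map_add_def fun_eq_iff split: option.splits)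
qed

lemma card_dom_tab: "finite (dom (tab \<kappa> l)) \<and> card (dom (tab \<kappa> l)) = length l"
proof (induction l arbitrary: \<kappa>)
  case (Cons p l)
  obtain a s where p: "p = (a, s)" by fastforce
  have "(s, \<kappa> s) \<notin> dom (tab (add_box \<kappa> s) l)" by (simp add: dom_tab add_box_apply)
  moreover have "dom (tab \<kappa> (p # l)) = insert (s, \<kappa> s) (dom (tab (add_box \<kappa> s) l))"
    unfolding p tab_Cons by simp
  ultimately show ?case using Cons.IH[of "add_box \<kappa> s"] by simp
qed simp

lemma grow_dom_tab:
  assumes "dom (tab no_boxes l) = {(i, j). j < \<rho> i}"
  shows "grow no_boxes (rows l) = \<rho>"
proof
  fix i
  have "j < grow no_boxes (rows l) i \<longleftrightarrow> j < \<rho> i" for j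
    using assms unfolding dom_tab by (auto simp: set_eq_iff)
  then show "grow no_boxes (rows l) i = \<rho> i" by (metis nat_neq_iff less_irrefl)
qed

text \<open>The last pair can be read off from the tableau: its letter is the largest one, and its
  row is the highest among the occurrences of this letter.\<close>

lemma tab_inject:
  assumes "valid l" "valid l'" "tab no_boxes l = tab no_boxes l'"
  shows "l = l'"
  using assms
proof (induction l arbitrary: l' rule: rev_induct)
  case Nil
  have "dom (tab no_boxes l') = dom (tab no_boxes [])" by (simp only: Nil.prems(3))
  then have "dom (tab no_boxes l') = {}" by simp
  then have "length l' = 0" using card_dom_tab[of no_boxes l'] by simp
  then show ?case by simp
next
  case (snoc p l)
  obtain a i where p: "p = (a, i)" by fastforce
  have "length l' = Suc (length l)"
    using card_dom_tab[of no_boxes l'] card_dom_tab[of no_boxes "l @ [p]"] snoc.prems(3) by simp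
  then obtain m b k where l': "l' = m @ [(b, k)]" by (metis length_Suc_conv_rev surj_pair)
  have "(b, k) \<in> set (l @ [p])" "(a, i) \<in> set l'"
    using set_tab[of b k] set_tab[of a i] snoc.prems(3) l' p by (metis in_set_conv_decomp)+
  then have e: "b = a" "k = i"
    using valid_last[of l a i b k] valid_last[of m b k a i] snoc.prems(1,2) l' p by auto
  have g: "grow no_boxes (rows (l @ [p])) = grow no_boxes (rows l')"
    by (rule grow_dom_tab) (simp add: snoc.prems(3) dom_tab)
  have "grow no_boxes (rows l) = grow no_boxes (rows m)"
    using g p l' e by simp
  moreover have "tab no_boxes l = (tab no_boxes (l @ [(a, i)]))((i, grow no_boxes (rows l) i) := None)"
    "tab no_boxes m = (tab no_boxes (m @ [(a, i)]))((i, grow no_boxes (rows m) i) := None)"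
    unfolding tab_snoc by (auto simp: fun_eq_iff tab_None)
  ultimately have "tab no_boxes l = tab no_boxes m" using snoc.prems(3) p l' e by (simp only:)
  then have "l = m" using snoc.IH snoc.prems(1,2) p l' valid_snoc by blast
  then show ?case using p l' e by simp
qed

lemma filling_col:
  assumes "filling T" "dom T = {(i, j). j < \<rho> i}" "decr \<rho>" "T (i, j) = Some b" "k < i"
  shows "\<exists>a. T (k, j) = Some a \<and> a < b"
  using assms(4,5)
proof (induction i arbitrary: b)
  case (Suc i)
  have "(Suc i, j) \<in> dom T" using Suc.prems by auto
  then have "j < \<rho> i" using assms(2) decr_antimono[OF assms(3), of i "Suc i"] by simp
  then have "(i, j) \<in> dom T" unfolding assms(2) by simp
  then obtain c where c: "T (i, j) = Some c" by blast
  then have "c < b" using assms(1) Suc.prems(1) unfolding filling_def by blast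
  then show ?case using c Suc.IH[OF c] Suc.prems(2) by (cases "k = i") fastforce+
qed simp

lemma filling_row:
  assumes "filling T" "dom T = {(i, j). j < \<rho> i}" "T (i, j) = Some b" "k \<le> j"
  shows "\<exists>a. T (i, k) = Some a \<and> a \<le> b"
  using assms(3,4)
proof (induction j arbitrary: b)
  case (Suc j)
  have "(i, Suc j) \<in> dom T" using Suc.prems by auto
  then have "j < \<rho> i" using assms(2) by simp
  then have "(i, j) \<in> dom T" unfolding assms(2) by simp
  then obtain c where c: "T (i, j) = Some c" by blast
  then have "c \<le> b" using assms(1) Suc.prems(1) unfolding filling_def by blast
  then show ?case using Suc.prems c Suc.IH[OF c] by (cases "k = Suc j") fastforce+
qed simp

text \<open>The last box is the rightmost one among those with the largest entry.\<close>

lemma filling_tab_exists: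
  assumes "filling T" "dom T = {(i, j). j < \<rho> i}" "decr \<rho>" "finite (dom T)"
  shows "\<exists>l. valid l \<and> ballot no_boxes (rows l) \<and> grow no_boxes (rows l) = \<rho> \<and> tab no_boxes l = T"
  using assms
proof (induction "card (dom T)" arbitrary: T \<rho>)
  case 0
  then have "dom T = {}" by simp
  then have T: "T = Map.empty" by simp
  have "\<rho> i = 0" for i using 0(3) T by (auto simp: set_eq_iff)
  then have "valid [] \<and> ballot no_boxes (rows []) \<and> grow no_boxes (rows []) = \<rho> \<and> tab no_boxes [] = T"
    using T by auto
  then show ?case by blast
next
  case (Suc n)
  have ne: "dom T \<noteq> {}" using Suc(2) by auto
  define a where "a = Max (the ` T ` dom T)"
  have fa: "finite (the ` T ` dom T)" using Suc.prems(4) by simp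
  have amax: "b \<le> a" if "T c = Some b" for b c
    unfolding a_def using fa that by (intro Max_ge) (auto simp: image_iff intro!: bexI[of _ c])
  have "a \<in> the ` T ` dom T" unfolding a_def using fa ne by (intro Max_in) auto
  then obtain c where c: "T c = Some a" by auto
  define J where "J = {j. \<exists>i. T (i, j) = Some a}"
  have "J \<subseteq> snd ` dom T" unfolding J_def by force
  then have fJ: "finite J" using Suc.prems(4) finite_subset by blast
  have neJ: "J \<noteq> {}" using c unfolding J_def by (cases c) auto
  define j where "j = Max J"
  have "j \<in> J" unfolding j_def using fJ neJ by simp
  then obtain i where ij: "T (i, j) = Some a" unfolding J_def by auto
  have jmax: "j' \<le> j" if "T (s, j') = Some a" for s j'
    unfolding j_def using fJ that by (intro Max_ge) (auto simp: J_def)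
  have ji: "j < \<rho> i" using ij Suc.prems(2) by auto
  have right: "T (i, Suc j) = None"
  proof (rule ccontr)
    assume "T (i, Suc j) \<noteq> None"
    then obtain b where b: "T (i, Suc j) = Some b" by auto
    then have "a \<le> b" using ij Suc.prems(1) unfolding filling_def by blast
    then have "b = a" using amax[OF b] by simp
    then show False using jmax b by fastforce
  qed
  have below: "T (Suc i, j) = None"
  proof (rule ccontr)
    assume "T (Suc i, j) \<noteq> None"
    then obtain b where b: "T (Suc i, j) = Some b" by auto
    then have "a < b" using ij Suc.prems(1) unfolding filling_def by blast
    then show False using amax[OF b] by simp
  qed
  have \<rho>i: "\<rho> i = Suc j"
  proof -
    have "(i, Suc j) \<notin> dom T" using right by auto
    then show ?thesis using ji unfolding Suc.prems(2) by auto
  qed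
  have \<rho>S: "\<rho> (Suc i) \<le> j"
  proof -
    have "(Suc i, j) \<notin> dom T" using below by auto
    then show ?thesis unfolding Suc.prems(2) by auto
  qed
  define \<rho>' where "\<rho>' = \<rho>(i := j)"
  define T' where "T' = T((i, j) := None)"
  have \<rho>: "\<rho> = add_box \<rho>' i" using \<rho>i by (auto simp: \<rho>'_def add_box_def fun_eq_iff)
  have dr: "decr \<rho>'" unfolding decr_def
  proof
    fix k
    show "\<rho>' (Suc k) \<le> \<rho>' k"
      using decr_antimono[OF Suc.prems(3), of k "Suc k"] \<rho>i \<rho>S
      by (cases "k = i"; cases "Suc k = i") (simp_all add: \<rho>'_def)
  qed
  have f': "filling T'"
    using Suc.prems(1) unfolding filling_def T'_def by auto
  have dT': "dom T' = dom T - {(i, j)}" unfolding T'_def by simp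
  then have d': "dom T' = {(i, j). j < \<rho>' i}"
    using \<rho>i unfolding Suc.prems(2) \<rho>'_def by (auto split: if_splits)
  have "card (dom T') = n" using dT' Suc(2) ij Suc.prems(4) by (simp add: domI)
  then obtain l where l: "valid l" "ballot no_boxes (rows l)" "grow no_boxes (rows l) = \<rho>'" "tab no_boxes l = T'"
    using Suc.hyps(1)[OF _ f' d' dr] dT' Suc.prems(4) by auto
  have "valid (l @ [(a, i)])"
    unfolding valid_snoc
  proof (intro conjI impI)
    assume "l \<noteq> []"
    obtain b s where bs: "last l = (b, s)" by fastforce
    then have "(b, s) \<in> set l" using \<open>l \<noteq> []\<close> last_in_set by metis
    then obtain j' where j': "T' (s, j') = Some b" using set_tab[of b s l no_boxes] l(4) by auto
    then have Tb: "T (s, j') = Some b" unfolding T'_def by (auto split: if_splits)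
    \<comment> \<open>Otherwise row \<open>s\<close> has an entry less than \<open>a\<close> in
      column \<open>j\<close>, above \<open>(i, j)\<close>, and so has it everywhere further left.
      By the choice of \<open>j\<close> the occurrence of \<open>a\<close> in row \<open>s\<close>
      would be among these.\<close>
    have "i \<le> s" if "b = a"
    proof (rule ccontr)
      assume "\<not> i \<le> s"
      then have "s < i" by simp
      then obtain e where e: "T (s, j) = Some e" "e < a"
        using filling_col[OF Suc.prems(1,2,3) ij] by blast
      have "j' \<le> j" using jmax Tb that by blast
      then obtain e' where "T (s, j') = Some e'" "e' \<le> e"
        using filling_row[OF Suc.prems(1,2) e(1)] by blast
      then show False using Tb that e(2) by simp
    qed
    then show "fst (last l) < fst (a, i) \<or> fst (last l) = fst (a, i) \<and> snd (a, i) \<le> snd (last l)"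
      using amax[OF Tb] bs by auto
  qed (rule l(1))
  moreover have "addable \<rho>' i" using \<rho> Suc.prems(3) decr_add_box[OF dr] by simp
  then have "ballot no_boxes (rows (l @ [(a, i)]))" using l(2,3) dr \<rho> Suc.prems(3) by simp
  moreover have "grow no_boxes (rows (l @ [(a, i)])) = \<rho>" using l(3) \<rho> by simp
  moreover have "tab no_boxes (l @ [(a, i)]) = T"
    unfolding tab_snoc l(3,4) using ij by (auto simp: \<rho>'_def T'_def fun_eq_iff)
  ultimately show ?case by blast
qed

section \<open>Standard and semistandard tableaux\<close>

definition row_len :: "nat list \<Rightarrow> nat \<Rightarrow> nat" where
  "row_len \<mu> i = (if i < length \<mu> then \<mu> ! i else 0)"

lemma diagram_row_len: "diagram \<mu> = {(i, j). j < row_len \<mu> i}"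
  by (auto simp: diagram_def row_len_def split: if_splits)

lemma decr_row_len:
  assumes "sorted_wrt (\<ge>) \<mu>"
  shows "decr (row_len \<mu>)"
  unfolding decr_def row_len_def using sorted_wrt_nth_less[OF assms] by auto

lemma card_diagram: "finite (diagram \<mu>)" "card (diagram \<mu>) = sum_list \<mu>"
proof -
  have d: "diagram \<mu> = Sigma {..<length \<mu>} (\<lambda>i. {..<\<mu> ! i})" by (auto simp: diagram_def)
  show "finite (diagram \<mu>)" unfolding d by simp
  show "card (diagram \<mu>) = sum_list \<mu>" unfolding d by (simp add: sum_list_sum_nth atLeast0LessThan)
qed

text \<open>Padding with zeros loses nothing, because all parts are positive.\<close>

lemma row_len_inject:
  assumes "0 \<notin> set \<mu>" "0 \<notin> set \<nu>" "row_len \<mu> = row_len \<nu>"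
  shows "\<mu> = \<nu>"
proof -
  have le: "length \<mu>' \<le> length \<nu>'" if "0 \<notin> set \<mu>'" "row_len \<mu>' = row_len \<nu>'" for \<mu>' \<nu>'
  proof (rule ccontr)
    assume "\<not> length \<mu>' \<le> length \<nu>'"
    then have "length \<nu>' < length \<mu>'" by simp
    then have "\<mu>' ! length \<nu>' = 0" using fun_cong[OF that(2), of "length \<nu>'"] by (simp add: row_len_def)
    then show False using that(1) \<open>length \<nu>' < length \<mu>'\<close> by (metis nth_mem)
  qed
  have l: "length \<mu> = length \<nu>" using le[OF assms(1,3)] le[OF assms(2) assms(3)[symmetric]] by simp
  show ?thesis
  proof (rule nth_equalityI[OF l])
    fix i assume "i < length \<mu>"
    then show "\<mu> ! i = \<nu> ! i" using fun_cong[OF assms(3), of i] l by (simp add: row_len_def)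
  qed
qed

lemma diagram_eq_iff: "diagram \<mu> = diagram \<nu> \<longleftrightarrow> row_len \<mu> = row_len \<nu>"
proof
  assume e: "diagram \<mu> = diagram \<nu>"
  show "row_len \<mu> = row_len \<nu>"
  proof
    fix i
    have "j < row_len \<mu> i \<longleftrightarrow> j < row_len \<nu> i" for j
      using e unfolding diagram_row_len by (auto simp: set_eq_iff)
    then show "row_len \<mu> i = row_len \<nu> i" by (metis nat_neq_iff less_irrefl)
  qed
qed (simp add: diagram_row_len)

lemma dom_stab_diagram: "grow no_boxes q = row_len \<mu> \<Longrightarrow> dom (stab no_boxes q) = diagram \<mu>"
  by (simp add: dom_tab diagram_row_len)

lemma length_ballot: "grow no_boxes q = row_len \<mu> \<Longrightarrow> length q = sum_list \<mu>"
  using card_dom_tab[of no_boxes "List.enumerate 1 q"] dom_stab_diagram[of q \<mu>] card_diagram[of \<mu>] by simp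

lemma ballot_partition:
  assumes "ballot no_boxes q"
  obtains \<mu> where "\<mu> \<turnstile>p length q" "grow no_boxes q = row_len \<mu>"
proof -
  let ?r = "grow no_boxes q"
  have d: "decr ?r" using ballot_grow_decr[OF assms] .
  define k where "k = (LEAST i. ?r i = 0)"
  have k0: "?r k = 0" unfolding k_def by (rule LeastI_ex) (use grow_0_finite in blast)
  have kn: "?r i \<noteq> 0" if "i < k" for i using not_less_Least that unfolding k_def by blast
  define \<mu> where "\<mu> = map ?r [0..<k]"
  have r: "?r = row_len \<mu>"
  proof
    fix i
    show "?r i = row_len \<mu> i"
      using decr_antimono[OF d, of k i] k0 by (cases "i < k") (simp_all add: row_len_def \<mu>_def)
  qed
  have "sorted_wrt (\<ge>) \<mu>"
    unfolding sorted_wrt_iff_nth_less \<mu>_def using decr_antimono[OF d] by auto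
  moreover have "0 \<notin> set \<mu>" using kn unfolding \<mu>_def by fastforce
  ultimately have "\<mu> \<turnstile>p length q" unfolding partition_of_def using length_ballot[OF r] by simp
  then show ?thesis using that r by blast
qed

lemma shape_stab:
  assumes "grow no_boxes q = row_len \<mu>" "\<mu> \<turnstile>p n"
  shows "shape (stab no_boxes q) = \<mu>"
  unfolding shape_def
proof (rule the_equality)
  have "card (dom (stab no_boxes q)) = n"
    using dom_stab_diagram[OF assms(1)] card_diagram(2)[of \<mu>] assms(2) unfolding partition_of_def by simp
  then show "\<mu> \<turnstile>p card (dom (stab no_boxes q)) \<and> dom (stab no_boxes q) = diagram \<mu>"
    using dom_stab_diagram[OF assms(1)] assms(2) by simp
next
  fix \<nu> assume n: "\<nu> \<turnstile>p card (dom (stab no_boxes q)) \<and> dom (stab no_boxes q) = diagram \<nu>"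
  then have "row_len \<nu> = row_len \<mu>"
    using dom_stab_diagram[OF assms(1)] diagram_eq_iff by metis
  then show "\<nu> = \<mu>" using row_len_inject n assms(2) unfolding partition_of_def by blast
qed

lemma ran_image: "ran T = (\<lambda>c. the (T c)) ` dom T"
proof
  show "ran T \<subseteq> (\<lambda>c. the (T c)) ` dom T"
  proof
    fix x assume "x \<in> ran T"
    then obtain c where "T c = Some x" by (auto simp: ran_def)
    then show "x \<in> (\<lambda>c. the (T c)) ` dom T" by (intro image_eqI[of _ _ c]) auto
  qed
qed (auto intro: ranI)

text \<open>The entries exhaust a set as large as the diagram, hence are distinct, and this turns
  the weak increase along rows into a strict one.\<close>

lemma stab_SYT:
  assumes "ballot no_boxes q" "grow no_boxes q = row_len \<mu>"
  shows "stab no_boxes q \<in> SYT \<mu>"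
proof -
  let ?T = "stab no_boxes q"
  have dom: "dom ?T = diagram \<mu>" using dom_stab_diagram[OF assms(2)] .
  have n: "length q = sum_list \<mu>" using length_ballot[OF assms(2)] .
  have "ran ?T = {1..sum_list \<mu>}"
    unfolding ran_tab using n by (auto simp: in_set_enumerate_eq image_iff intro!: bexI[of _ "(_, q ! (_ - 1))"])
  moreover have "ran ?T = (\<lambda>c. the (?T c)) ` dom ?T"
    by (rule ran_image)
  ultimately have im: "(\<lambda>c. the (?T c)) ` diagram \<mu> = {1..sum_list \<mu>}" using dom by simp
  have inj: "inj_on (\<lambda>c. the (?T c)) (diagram \<mu>)"
  proof (rule eq_card_imp_inj_on)
    show "card ((\<lambda>c. the (?T c)) ` diagram \<mu>) = card (diagram \<mu>)" unfolding im card_diagram by simp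
  qed (rule card_diagram)
  have f: "filling ?T" by (rule filling_tab) (simp_all add: valid_enumerate assms(1))
  have ne: "a \<noteq> b" if "?T c = Some a" "?T c' = Some b" "c \<noteq> c'" for a b c c'
  proof
    assume "a = b"
    moreover have "c \<in> diagram \<mu>" "c' \<in> diagram \<mu>" using that(1,2) dom by blast+
    ultimately show False using inj_onD[OF inj, of c c'] that by simp
  qed
  have "a < b" if "?T (i, j) = Some a" "?T (i, Suc j) = Some b" for i j a b
    using f ne[OF that] that unfolding filling_def by (metis le_neq_implies_less n_not_Suc_n prod.inject)
  then show ?thesis
    unfolding SYT_def bij_betw_def using dom im inj f unfolding filling_def by blast
qed

lemma SYT_iff:
  assumes "\<mu> \<turnstile>p n"
  shows "T \<in> SYT \<mu> \<longleftrightarrow> (\<exists>q. ballot no_boxes q \<and> grow no_boxes q = row_len \<mu> \<and> T = stab no_boxes q)"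
proof
  assume T: "T \<in> SYT \<mu>"
  then have dom: "dom T = diagram \<mu>" and bij: "bij_betw (\<lambda>c. the (T c)) (diagram \<mu>) {1..sum_list \<mu>}"
    unfolding SYT_def by blast+
  have f: "filling T" unfolding filling_def using T unfolding SYT_def by (blast intro: less_imp_le)
  have d: "decr (row_len \<mu>)" using decr_row_len assms unfolding partition_of_def by blast
  obtain l where l: "valid l" "ballot no_boxes (rows l)" "grow no_boxes (rows l) = row_len \<mu>" "tab no_boxes l = T"
    using filling_tab_exists[OF f _ d] dom card_diagram(1) unfolding diagram_row_len[symmetric] by metis
  have len: "length l = sum_list \<mu>"
    using card_dom_tab[of no_boxes l] l(4) dom card_diagram(2) by simp
  have "fst ` set l = ran T" using ran_tab[of no_boxes l] l(4) by simp
  also have "\<dots> = (\<lambda>c. the (T c)) ` dom T" by (rule ran_image)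
  also have "\<dots> = {1..sum_list \<mu>}" using bij dom unfolding bij_betw_def by simp
  finally have s: "set (map fst l) = {1..<Suc (sum_list \<mu>)}" by auto
  \<comment> \<open>There are as many entries as values, so no value repeats; the sorted list of
    letters is then forced to be \<open>1, 2, ...\<close>.\<close>
  have "distinct (map fst l)" by (rule card_distinct) (simp only: s length_map len card_atLeastLessThan diff_Suc_1)
  then have "map fst l = [1..<Suc (sum_list \<mu>)]"
    using sorted_valid[OF l(1)] s by (intro sorted_distinct_set_unique) (simp_all del: upt_Suc)
  then have "l = List.enumerate 1 (rows l)"
    unfolding enumerate_eq_zip by (metis len length_map plus_1_eq_Suc zip_map_fst_snd)
  then show "\<exists>q. ballot no_boxes q \<and> grow no_boxes q = row_len \<mu> \<and> T = stab no_boxes q"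
    using l by metis
qed (use stab_SYT in blast)

lemma stab_inject: "stab no_boxes q = stab no_boxes q' \<Longrightarrow> q = q'"
  using tab_inject[OF valid_enumerate valid_enumerate] by (metis rows_enumerate)

lemma finite_SYT: "finite (SYT \<mu>)" if "\<mu> \<turnstile>p n"
proof -
  have "SYT \<mu> \<subseteq> {T. dom T = diagram \<mu> \<and> ran T \<subseteq> {1..sum_list \<mu>}}"
  proof
    fix T assume "T \<in> SYT \<mu>"
    then have d: "dom T = diagram \<mu>" and b: "(\<lambda>c. the (T c)) ` diagram \<mu> = {1..sum_list \<mu>}"
      unfolding SYT_def bij_betw_def by blast+
    have "ran T = (\<lambda>c. the (T c)) ` dom T" by (rule ran_image)
    then show "T \<in> {T. dom T = diagram \<mu> \<and> ran T \<subseteq> {1..sum_list \<mu>}}" using d b by simp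
  qed
  moreover have "finite {T. dom T = diagram \<mu> \<and> ran T \<subseteq> {1..sum_list \<mu>}}"
    by (rule finite_set_of_finite_maps) (simp_all add: card_diagram)
  ultimately show ?thesis by (rule finite_subset)
qed

lemma semistandard_iff:
  "T \<in> semistandard_tableaux \<mu> N \<longleftrightarrow> dom T = diagram \<mu> \<and> ran T \<subseteq> {..<N} \<and> filling T"
  unfolding semistandard_tableaux_def filling_def by blast

section \<open>Generating functions of words\<close>

definition words :: "nat \<Rightarrow> nat \<Rightarrow> nat list set" where
  "words N m = {w. length w = m \<and> set w \<subseteq> {..<N}}"

definition weight :: "complex list \<Rightarrow> nat list \<Rightarrow> complex" where
  "weight xs w = (\<Prod>a\<leftarrow>w. xs ! a)"

lemma finite_words [simp]: "finite (words N m)"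
  unfolding words_def using finite_lists_length_eq[of "{..<N}" m] by (simp add: conj_commute)

lemma weight_append: "weight xs (u @ v) = weight xs u * weight xs v"
  by (simp add: weight_def)

lemma prod_tab: "(\<Prod>c\<in>dom (tab \<kappa> l). f (the (tab \<kappa> l c))) = (\<Prod>a\<leftarrow>map fst l. f a)" for f :: "nat \<Rightarrow> complex"
proof (induction l arbitrary: \<kappa>)
  case (Cons p l)
  obtain a s where p: "p = (a, s)" by fastforce
  let ?T = "tab (add_box \<kappa> s) l"
  have n: "(s, \<kappa> s) \<notin> dom ?T" by (simp add: dom_tab add_box_apply)
  have "(\<Prod>c\<in>dom (tab \<kappa> (p # l)). f (the (tab \<kappa> (p # l) c))) =
      (\<Prod>c\<in>insert (s, \<kappa> s) (dom ?T). f (the ((?T((s, \<kappa> s) \<mapsto> a)) c)))"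
    unfolding p tab_Cons by (simp only: dom_fun_upd option.distinct if_False) 
  also have "\<dots> = f a * (\<Prod>c\<in>dom ?T. f (the ((?T((s, \<kappa> s) \<mapsto> a)) c)))"
    using n card_dom_tab[of "add_box \<kappa> s" l] by (subst prod.insert) auto
  also have "(\<Prod>c\<in>dom ?T. f (the ((?T((s, \<kappa> s) \<mapsto> a)) c))) = (\<Prod>c\<in>dom ?T. f (the (?T c)))"
    using n by (intro prod.cong) auto
  finally show ?case using Cons.IH p by simp
qed simp

lemma set_P_tab: "fst ` set (P_tab w) = set w"
  using arg_cong[OF mset_P_tab[of w], of set_mset] by simp

lemma schur_words:
  assumes "ballot no_boxes q" "grow no_boxes q = row_len \<mu>" "\<mu> \<turnstile>p n"
  shows "(\<Sum>w | w \<in> words (length xs) n \<and> Q_tab w = q. weight xs w) = schur_poly \<mu> xs"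
proof -
  let ?N = "length xs"
  let ?W = "{w. w \<in> words ?N n \<and> Q_tab w = q}"
  let ?f = "\<lambda>w. tab no_boxes (P_tab w)"
  have d: "decr (row_len \<mu>)" using decr_row_len assms(3) unfolding partition_of_def by blast
  have len: "length q = n" using length_ballot[OF assms(2)] assms(3) unfolding partition_of_def by simp
  have dom: "dom (?f w) = diagram \<mu>" if "Q_tab w = q" for w
    unfolding dom_tab diagram_row_len grow_P_Q that assms(2) by simp
  have bij: "bij_betw ?f ?W (semistandard_tableaux \<mu> ?N)"
    unfolding bij_betw_def
  proof
    show "inj_on ?f ?W"
      by (rule inj_onI) (metis (mono_tags, lifting) mem_Collect_eq rsk_inject tab_inject valid_ins_list valid.simps(2))
    show "?f ` ?W = semistandard_tableaux \<mu> ?N"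
    proof (rule subset_antisym; rule subsetI)
      fix T assume "T \<in> ?f ` ?W"
      then obtain w where w: "w \<in> words ?N n" "Q_tab w = q" "T = ?f w" by blast
      have "filling T" unfolding w(3) by (rule filling_tab) (simp_all add: valid_ins_list P_tab_ballot)
      moreover have "ran T \<subseteq> {..<?N}" using w(1) unfolding w(3) ran_tab set_P_tab words_def by blast
      ultimately show "T \<in> semistandard_tableaux \<mu> ?N" unfolding semistandard_iff using dom w(2,3) by simp
    next
      fix T assume "T \<in> semistandard_tableaux \<mu> ?N"
      then have T: "dom T = diagram \<mu>" "ran T \<subseteq> {..<?N}" "filling T" unfolding semistandard_iff by blast+
      obtain l where l: "valid l" "ballot no_boxes (rows l)" "grow no_boxes (rows l) = row_len \<mu>" "tab no_boxes l = T"
        using filling_tab_exists[OF T(3) _ d] T(1) card_diagram(1) unfolding diagram_row_len[symmetric] by metis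
      obtain w where w: "P_tab w = l" "Q_tab w = q"
        using rsk_surj[OF l(2,1) assms(1)] l(3) assms(2) by metis
      have "set w = ran T" using set_P_tab[of w] ran_tab[of no_boxes l] w(1) l(4) by simp
      moreover have "length w = n" using w(2) len by (metis length_rec_list)
      ultimately have "w \<in> ?W" using w(2) T(2) unfolding words_def by simp
      then show "T \<in> ?f ` ?W" using w(1) l(4) by blast
    qed
  qed
  have "schur_poly \<mu> xs = (\<Sum>w\<in>?W. \<Prod>c\<in>diagram \<mu>. xs ! the (?f w c))"
    unfolding schur_poly_def by (rule sum.reindex_bij_betw[OF bij, symmetric])
  also have "\<dots> = (\<Sum>w\<in>?W. weight xs w)"
  proof (rule sum.cong[OF refl])
    fix w assume "w \<in> ?W"
    then have "dom (?f w) = diagram \<mu>" using dom by blast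
    then have "(\<Prod>c\<in>diagram \<mu>. xs ! the (?f w c)) = (\<Prod>a\<leftarrow>map fst (P_tab w). xs ! a)"
      using prod_tab[of "\<lambda>a. xs ! a" no_boxes "P_tab w"] by simp
    also have "\<dots> = weight xs w"
      unfolding weight_def using mset_P_tab[of w] by (metis mset_map prod_mset_prod_list)
    finally show "(\<Prod>c\<in>diagram \<mu>. xs ! the (?f w c)) = weight xs w" .
  qed
  finally show ?thesis by simp
qed

lemma QT_SYT:
  obtains \<mu> where "\<mu> \<turnstile>p length w" "shape (QT w) = \<mu>" "QT w \<in> SYT \<mu>"
proof -
  obtain \<mu> where m: "\<mu> \<turnstile>p length (Q_tab w)" "grow no_boxes (Q_tab w) = row_len \<mu>"
    using ballot_partition[OF Q_tab_ballot] .
  then have "\<mu> \<turnstile>p length w" "shape (QT w) = \<mu>" "QT w \<in> SYT \<mu>"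
    using shape_stab stab_SYT[OF Q_tab_ballot] by auto
  then show ?thesis by (rule that)
qed

lemma finite_partitions: "finite {\<mu>. \<mu> \<turnstile>p n}"
proof (rule finite_subset)
  show "{\<mu>. \<mu> \<turnstile>p n} \<subseteq> {\<mu>. set \<mu> \<subseteq> {..n} \<and> length \<mu> \<le> n}"
  proof
    fix \<mu> assume "\<mu> \<in> {\<mu>. \<mu> \<turnstile>p n}"
    then have m: "0 \<notin> set \<mu>" "sum_list \<mu> = n" unfolding partition_of_def by auto
    have "x \<le> n" if "x \<in> set \<mu>" for x using member_le_sum_list[OF that] m(2) by simp
    moreover have "length \<mu> \<le> sum_list \<mu>" using m(1)
      by (induction \<mu>) auto
    ultimately show "\<mu> \<in> {\<mu>. set \<mu> \<subseteq> {..n} \<and> length \<mu> \<le> n}" using m(2) by auto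
  qed
qed (rule finite_lists_length_le, simp)

text \<open>Words are grouped by the shape of \<open>QT w\<close> and then by \<open>QT w\<close>
  itself. Coefficients that count tableaux thus become conditions on words, for which a product is a
  concatenation.\<close>

lemma schur_sum_words:
  assumes "\<And>\<nu>. \<nu> \<turnstile>p n \<Longrightarrow> A \<nu> \<subseteq> SYT \<nu>"
  shows "(\<Sum>\<nu> | \<nu> \<turnstile>p n. of_nat (card (A \<nu>)) * schur_poly \<nu> xs) =
    (\<Sum>w | w \<in> words (length xs) n \<and> QT w \<in> A (shape (QT w)). weight xs w)"
proof -
  let ?W = "{w. w \<in> words (length xs) n \<and> QT w \<in> A (shape (QT w))}"
  have sh: "shape (QT w) \<turnstile>p n" if "w \<in> words (length xs) n" for w
    using QT_SYT[of w] that unfolding words_def by fastforce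
  have "(\<Sum>w\<in>?W. weight xs w) = (\<Sum>\<nu> | \<nu> \<turnstile>p n. \<Sum>w | w \<in> ?W \<and> shape (QT w) = \<nu>. weight xs w)"
    by (rule sum.group[symmetric]) (use sh in \<open>auto simp: finite_partitions\<close>)
  also have "\<dots> = (\<Sum>\<nu> | \<nu> \<turnstile>p n. of_nat (card (A \<nu>)) * schur_poly \<nu> xs)"
  proof (rule sum.cong[OF refl])
    fix \<nu> assume "\<nu> \<in> {\<nu>. \<nu> \<turnstile>p n}"
    then have \<nu>: "\<nu> \<turnstile>p n" by simp
    have fin: "finite (A \<nu>)" using assms[OF \<nu>] finite_SYT[OF \<nu>] finite_subset by blast
    let ?V = "{w. w \<in> ?W \<and> shape (QT w) = \<nu>}"
    have "(\<Sum>w\<in>?V. weight xs w) = (\<Sum>T\<in>A \<nu>. \<Sum>w | w \<in> ?V \<and> QT w = T. weight xs w)"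
      by (rule sum.group[symmetric]) (use fin in auto)
    also have "\<dots> = (\<Sum>T\<in>A \<nu>. schur_poly \<nu> xs)"
    proof (rule sum.cong[OF refl])
      fix T assume TA: "T \<in> A \<nu>"
      then obtain q where q: "ballot no_boxes q" "grow no_boxes q = row_len \<nu>" "T = stab no_boxes q"
        using assms[OF \<nu>] SYT_iff[OF \<nu>] by blast
      have "{w. w \<in> ?V \<and> QT w = T} = {w. w \<in> words (length xs) n \<and> Q_tab w = q}"
        using TA shape_stab[OF q(2) \<nu>] stab_inject unfolding q(3) by auto
      then show "(\<Sum>w | w \<in> ?V \<and> QT w = T. weight xs w) = schur_poly \<nu> xs"
        using schur_words[OF q(1,2) \<nu>] by simp
    qed
    finally show "(\<Sum>w\<in>?V. weight xs w) = of_nat (card (A \<nu>)) * schur_poly \<nu> xs" by simp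
  qed
  finally show ?thesis by simp
qed

text \<open>The weight is multiplicative, and the lengths in \<open>ns\<close> fix the places at
  which a word is cut.\<close>

lemma prod_sum_words:
  "(\<Prod>j<length ns. \<Sum>w | w \<in> words N (ns ! j) \<and> B j w. weight xs w) =
   (\<Sum>w | w \<in> words N (sum_list ns) \<and> (\<forall>j<length ns. B j (take (ns ! j) (drop (sum_list (take j ns)) w))). weight xs w)"
proof (induction ns arbitrary: B)
  case Nil
  have "{w. w \<in> words N 0} = {[]}" unfolding words_def by auto
  then show ?case by (simp add: weight_def)
next
  case (Cons n ns)
  let ?m = "sum_list ns"
  let ?A = "{w. w \<in> words N n \<and> B 0 w}"
  let ?C = "{w. w \<in> words N ?m \<and> (\<forall>j<length ns. B (Suc j) (take (ns ! j) (drop (sum_list (take j ns)) w)))}"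
  let ?D = "{w. w \<in> words N (sum_list (n # ns)) \<and> (\<forall>j<length (n # ns). B j (take ((n # ns) ! j) (drop (sum_list (take j (n # ns))) w)))}"
  have bij: "bij_betw (\<lambda>(u, v). u @ v) (?A \<times> ?C) ?D"
  proof (rule bij_betwI[where g = "\<lambda>w. (take n w, drop n w)"])
    show "(\<lambda>(u, v). u @ v) \<in> ?A \<times> ?C \<rightarrow> ?D"
      by (auto simp: words_def All_less_Suc2)
    show "(\<lambda>w. (take n w, drop n w)) \<in> ?D \<rightarrow> ?A \<times> ?C"
      by (auto simp: words_def All_less_Suc2 add.commute dest!: in_set_takeD in_set_dropD)
  qed (auto simp: words_def)
  have "(\<Prod>j<length (n # ns). \<Sum>w | w \<in> words N ((n # ns) ! j) \<and> B j w. weight xs w)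
      = (\<Sum>w\<in>?A. weight xs w) * (\<Prod>j<length ns. \<Sum>w | w \<in> words N (ns ! j) \<and> B (Suc j) w. weight xs w)"
    by (simp only: length_Cons prod.lessThan_Suc_shift nth_Cons_0 nth_Cons_Suc)
  also have "\<dots> = (\<Sum>u\<in>?A. weight xs u) * (\<Sum>v\<in>?C. weight xs v)"
    unfolding Cons.IH ..
  also have "\<dots> = (\<Sum>(u, v)\<in>?A \<times> ?C. weight xs (u @ v))"
    by (simp add: sum_product sum.cartesian_product weight_append)
  also have "\<dots> = (\<Sum>w\<in>?D. weight xs w)"
    using sum.reindex_bij_betw[OF bij, of "weight xs"] by (simp add: case_prod_unfold)
  finally show ?case .
qed

lemma sum_list_take_Suc: "j < length ns \<Longrightarrow> sum_list (take (Suc j) ns) = sum_list (take j ns) + ns ! j"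
  for ns :: "nat list"
  by (simp add: take_Suc_conv_app_nth)

lemma sum_list_take_le: "sum_list (take j ns) \<le> sum_list ns" for ns :: "nat list"
  by (metis append_take_drop_id le_add1 sum_list_append)

lemma word_split:
  assumes "length w = sum_list ns" "j < length ns"
  obtains u z where "w = u @ take (ns ! j) (drop (sum_list (take j ns)) w) @ z"
    "length u = sum_list (take j ns)" "length (take (ns ! j) (drop (sum_list (take j ns)) w)) = ns ! j"
proof
  let ?s = "sum_list (take j ns)"
  have le: "?s + ns ! j \<le> length w"
    using sum_list_take_le[of "Suc j" ns] sum_list_take_Suc[OF assms(2)] assms(1) by simp
  show "w = take ?s w @ take (ns ! j) (drop ?s w) @ drop (ns ! j) (drop ?s w)"
    by (simp only: append_take_drop_id)
  show "length (take ?s w) = ?s" "length (take (ns ! j) (drop ?s w)) = ns ! j" using le by auto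
qed

lemma interval_rect_block:
  assumes "length w = sum_list ns" "j < length ns"
  shows "interval_rect (QT w) (block ns j) = QT (take (ns ! j) (drop (sum_list (take j ns)) w))"
proof -
  let ?v = "take (ns ! j) (drop (sum_list (take j ns)) w)"
  obtain u z where uz: "w = u @ ?v @ z" "length u = sum_list (take j ns)" "length ?v = ns ! j"
    using word_split[OF assms] .
  have "block ns j = {length u + 1..length u + length ?v}"
    unfolding block_def sum_list_take_Suc[OF assms(2)] uz(2,3) ..
  then show ?thesis using interval_rect_QT[of u ?v z] uz(1) by simp
qed

theorem prod_schur_sums:
  assumes "\<And>j \<nu>. j < length ns \<Longrightarrow> \<nu> \<turnstile>p ns ! j \<Longrightarrow> A j \<nu> \<subseteq> SYT \<nu>"
  shows "(\<Prod>j<length ns. \<Sum>\<nu> | \<nu> \<turnstile>p ns ! j. of_nat (card (A j \<nu>)) * schur_poly \<nu> xs) =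
    (\<Sum>\<mu> | \<mu> \<turnstile>p sum_list ns. of_nat (card {T \<in> SYT \<mu>. \<forall>j<length ns.
        interval_rect T (block ns j) \<in> A j (shape (interval_rect T (block ns j)))}) * schur_poly \<mu> xs)"
proof -
  let ?N = "length xs"
  let ?B = "\<lambda>j w. QT w \<in> A j (shape (QT w))"
  let ?S = "\<lambda>\<mu>. {T \<in> SYT \<mu>. \<forall>j<length ns. interval_rect T (block ns j) \<in> A j (shape (interval_rect T (block ns j)))}"
  have "(\<Prod>j<length ns. \<Sum>\<nu> | \<nu> \<turnstile>p ns ! j. of_nat (card (A j \<nu>)) * schur_poly \<nu> xs)
      = (\<Prod>j<length ns. \<Sum>w | w \<in> words ?N (ns ! j) \<and> ?B j w. weight xs w)"
    by (rule prod.cong[OF refl], rule schur_sum_words) (use assms in auto)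
  also have "\<dots> = (\<Sum>w | w \<in> words ?N (sum_list ns) \<and>
      (\<forall>j<length ns. ?B j (take (ns ! j) (drop (sum_list (take j ns)) w))). weight xs w)"
    by (rule prod_sum_words)
  also have "{w. w \<in> words ?N (sum_list ns) \<and> (\<forall>j<length ns. ?B j (take (ns ! j) (drop (sum_list (take j ns)) w)))}
      = {w. w \<in> words ?N (sum_list ns) \<and> QT w \<in> ?S (shape (QT w))}"
  proof (rule Collect_cong, rule conj_cong[OF refl])
    fix w assume "w \<in> words ?N (sum_list ns)"
    then have len: "length w = sum_list ns" unfolding words_def by simp
    have "QT w \<in> SYT (shape (QT w))" using QT_SYT[of w] by metis
    then show "(\<forall>j<length ns. ?B j (take (ns ! j) (drop (sum_list (take j ns)) w))) \<longleftrightarrow> QT w \<in> ?S (shape (QT w))"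
      using interval_rect_block[OF len] by simp
  qed
  also have "(\<Sum>w\<in>\<dots>. weight xs w) = (\<Sum>\<mu> | \<mu> \<turnstile>p sum_list ns. of_nat (card (?S \<mu>)) * schur_poly \<mu> xs)"
    by (rule schur_sum_words[symmetric]) auto
  finally show ?thesis .
qed

section \<open>Traces\<close>

lemma sum_tensor_apply: "(\<Sum>i\<in>I. f i) w = (\<Sum>i\<in>I. f i w)" for f :: "'i \<Rightarrow> tensor"
  by (induction I rule: infinite_finite_induct) auto

lemma representation_tensor_sum:
  assumes "tensor.independent B" "\<And>i. i \<in> I \<Longrightarrow> v i \<in> tensor.span B"
  shows "tensor.representation B (\<Sum>i\<in>I. tscale (a i) (v i)) b = (\<Sum>i\<in>I. a i * tensor.representation B (v i) b)"
  using assms by (simp add: tensor.representation_sum tensor.span_scale tensor.representation_scale)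

text \<open>A degree-preserving algebra endomorphism of the tensor algebra: this is all that the
  trace computations use of the action of a matrix.\<close>

locale tensor_endo =
  fixes N :: nat and \<phi> :: "tensor \<Rightarrow> tensor"
  assumes add: "\<phi> (f + g) = \<phi> f + \<phi> g"
    and scale: "\<phi> (tscale a f) = tscale a (\<phi> f)"
    and mult: "\<phi> (f \<otimes>t g) = \<phi> f \<otimes>t \<phi> g"
    and one: "\<phi> tone = tone"
    and power: "f \<in> tensor_power N m \<Longrightarrow> \<phi> f \<in> tensor_power N m"
begin

lemma zero: "\<phi> 0 = 0"
  using scale[of 0 0] by simp

lemma sum: "\<phi> (\<Sum>i\<in>I. f i) = (\<Sum>i\<in>I. \<phi> (f i))"
  by (induction I rule: infinite_finite_induct)
    (simp_all only: zero add sum.infinite sum.empty sum.insert not_False_eq_True)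

lemma diff: "\<phi> (f - g) = \<phi> f - \<phi> g"
proof -
  have "\<phi> f = \<phi> (f - g + g)" by simp
  also have "\<dots> = \<phi> (f - g) + \<phi> g" by (rule add)
  finally show ?thesis by simp
qed

text \<open>The identity \<open>tr (X Y) = tr (Y X)\<close>: both traces equal one double sum over
  the coordinates of the vectors \<open>b\<close> in \<open>C\<close> and of the images
  \<open>\<phi> c\<close> in \<open>B\<close>.\<close>

lemma trace_basis_independent:
  assumes B: "tensor.independent B" "finite B" and C: "tensor.independent C" "finite C"
    and span: "tensor.span B = tensor.span C" and inv: "\<phi> ` tensor.span B \<subseteq> tensor.span B"
  shows "(\<Sum>b\<in>B. tensor.representation B (\<phi> b) b) = (\<Sum>c\<in>C. tensor.representation C (\<phi> c) c)"
proof -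
  let ?r = tensor.representation
  have B_in: "\<And>b. b \<in> B \<Longrightarrow> b \<in> tensor.span C" using span tensor.span_base by metis
  have C_in: "\<And>c. c \<in> C \<Longrightarrow> \<phi> c \<in> tensor.span B" using span inv tensor.span_base by blast
  have "?r B (\<phi> b) b = (\<Sum>c\<in>C. ?r C b c * ?r B (\<phi> c) b)" if "b \<in> B" for b
  proof -
    have "b = (\<Sum>c\<in>C. tscale (?r C b c) c)"
      using tensor.sum_representation_eq[OF C(1) B_in[OF that] C(2)] by simp
    then have "\<phi> b = (\<Sum>c\<in>C. tscale (?r C b c) (\<phi> c))" by (metis (no_types, lifting) sum scale sum.cong)
    then show ?thesis using representation_tensor_sum[OF B(1), of C \<phi>] C_in by simp
  qed
  then have "(\<Sum>b\<in>B. ?r B (\<phi> b) b) = (\<Sum>b\<in>B. \<Sum>c\<in>C. ?r C b c * ?r B (\<phi> c) b)" by (rule sum.cong[OF refl])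
  also have "\<dots> = (\<Sum>c\<in>C. \<Sum>b\<in>B. ?r B (\<phi> c) b * ?r C b c)"
    by (subst sum.swap) (simp add: mult.commute)
  also have "\<dots> = (\<Sum>c\<in>C. ?r C (\<phi> c) c)"
  proof (rule sum.cong[OF refl])
    fix c assume c: "c \<in> C"
    have "(\<Sum>b\<in>B. tscale (?r B (\<phi> c) b) b) = \<phi> c"
      using tensor.sum_representation_eq[OF B(1) C_in[OF c] B(2)] by simp
    then show "(\<Sum>b\<in>B. ?r B (\<phi> c) b * ?r C b c) = ?r C (\<phi> c) c"
      using representation_tensor_sum[OF C(1), of B "\<lambda>b. b" "?r B (\<phi> c)" c] B_in by simp
  qed
  finally show ?thesis .
qed

text \<open>The basis chosen inside \<open>trace_on\<close> is arbitrary, but it is finite, being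
  independent in the span of the finite set \<open>B\<close>.\<close>

lemma trace_on_basis:
  assumes B: "tensor.independent B" "finite B" "tensor.span B = W" and inv: "\<phi> ` W \<subseteq> W"
  shows "trace_on W \<phi> = (\<Sum>b\<in>B. tensor.representation B (\<phi> b) b)"
proof -
  define C where "C = (SOME B. tensor.independent B \<and> tensor.span B = W)"
  have C: "tensor.independent C \<and> tensor.span C = W"
    unfolding C_def by (rule someI[of _ B]) (use B in blast)
  then have "finite C"
    using tensor.independent_span_bound[OF B(2), of C] tensor.span_superset[of C] B(3) by auto
  then show ?thesis
    unfolding trace_on_def Let_def C_def[symmetric]
    using trace_basis_independent[of C B] C B inv by simp
qed

text \<open>A basis given as a family with an explicit matrix, so that pairs of basis vectors can
  serve as indices for a tensor product. Independence of the family gives injectivity of the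
  indexing.\<close>

lemma trace_on_family:
  assumes fin: "finite I" and span: "tensor.span (b ` I) = W" and inv: "\<phi> ` W \<subseteq> W"
    and indep: "\<And>c i. (\<Sum>i\<in>I. tscale (c i) (b i)) = 0 \<Longrightarrow> i \<in> I \<Longrightarrow> c i = 0"
    and M: "\<And>i. i \<in> I \<Longrightarrow> \<phi> (b i) = (\<Sum>j\<in>I. tscale (M j i) (b j))"
  shows "trace_on W \<phi> = (\<Sum>i\<in>I. M i i)"
proof -
  have inj: "inj_on b I"
  proof (rule inj_onI, rule ccontr)
    fix i j assume ij: "i \<in> I" "j \<in> I" "b i = b j" "i \<noteq> j"
    let ?c = "\<lambda>k. if k = i then 1 else if k = j then -1 else 0 :: complex"
    have "(\<Sum>k\<in>I. tscale (?c k) (b k)) = (\<Sum>k\<in>{i, j}. tscale (?c k) (b k))"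
      by (rule sum.mono_neutral_right) (use fin ij in auto)
    also have "\<dots> = tscale 1 (b i) + tscale (-1) (b j)" using ij(4) by simp
    also have "\<dots> = 0" using ij(3) by (simp add: tscale_def fun_eq_iff)
    finally show False using indep[of ?c i] ij(1) by simp
  qed
  have ind: "tensor.independent (b ` I)"
  proof
    assume "tensor.dependent (b ` I)"
    then obtain u where u: "\<exists>v\<in>b ` I. u v \<noteq> 0" "(\<Sum>v\<in>b ` I. tscale (u v) v) = 0"
      using tensor.dependent_finite[of "b ` I"] fin by blast
    have "(\<Sum>i\<in>I. tscale (u (b i)) (b i)) = 0"
      using u(2) by (simp add: sum.reindex[OF inj])
    then show False using indep[of "\<lambda>i. u (b i)"] u(1) by blast
  qed
  have "tensor.representation (b ` I) (\<phi> (b i)) (b i) = M i i" if i: "i \<in> I" for i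
  proof -
    have "tensor.representation (b ` I) (\<phi> (b i)) (b i)
        = (\<Sum>j\<in>I. M j i * tensor.representation (b ` I) (b j) (b i))"
      unfolding M[OF i] by (rule representation_tensor_sum[OF ind]) (auto intro: tensor.span_base)
    also have "\<dots> = (\<Sum>j\<in>I. if j = i then M i i else 0)"
      using tensor.representation_basis[OF ind] i inj_onD[OF inj] by (intro sum.cong[OF refl]) auto
    also have "\<dots> = M i i" using fin i by simp
    finally show ?thesis .
  qed
  then have "(\<Sum>v\<in>b ` I. tensor.representation (b ` I) (\<phi> v) v) = (\<Sum>i\<in>I. M i i)"
    by (simp add: sum.reindex[OF inj])
  then show ?thesis using trace_on_basis[OF ind _ span inv] fin by simp
qed

end

section \<open>Homogeneous spaces of tensors\<close>

lemma tensor_power_subspace: "tensor.subspace (tensor_power N m)"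
proof (rule tensor.subspaceI)
  fix f g assume fg: "f \<in> tensor_power N m" "g \<in> tensor_power N m"
  show "f + g \<in> tensor_power N m"
    unfolding tensor_power_def
  proof (intro CollectI allI impI)
    fix w assume "(f + g) w \<noteq> 0"
    then have "f w \<noteq> 0 \<or> g w \<noteq> 0" by auto
    then show "length w = m \<and> set w \<subseteq> {..<N}" using fg unfolding tensor_power_def by blast
  qed
qed (auto simp: tensor_power_def tscale_def)

lemma tmult_power:
  assumes "f \<in> tensor_power N a" "g \<in> tensor_power N b"
  shows "f \<otimes>t g \<in> tensor_power N (a + b)"
  unfolding tensor_power_def
proof (intro CollectI allI impI)
  fix w assume "(f \<otimes>t g) w \<noteq> 0"
  then obtain k where k: "k \<le> length w" "f (take k w) * g (drop k w) \<noteq> 0"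
    unfolding tmult_def by (metis (no_types, lifting) sum.neutral atMost_iff)
  then have "length (take k w) = a \<and> set (take k w) \<subseteq> {..<N}" "length (drop k w) = b \<and> set (drop k w) \<subseteq> {..<N}"
    using assms unfolding tensor_power_def by auto
  moreover have "set w = set (take k w) \<union> set (drop k w)" by (metis append_take_drop_id set_append)
  ultimately show "length w = a + b \<and> set w \<subseteq> {..<N}" using k(1) by auto
qed

lemma tone_power: "tone \<in> tensor_power N 0"
  by (auto simp: tensor_power_def tone_def)

text \<open>By homogeneity of \<open>f\<close> only the cut directly after \<open>u\<close>
  contributes.\<close>

lemma tmult_append:
  assumes "f \<in> tensor_power N (length u)"
  shows "(f \<otimes>t g) (u @ v) = f u * g v"
proof -
  have "(f \<otimes>t g) (u @ v) = (\<Sum>k\<in>{length u}. f (take k (u @ v)) * g (drop k (u @ v)))"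
    unfolding tmult_def
  proof (rule sum.mono_neutral_right)
    show "\<forall>k\<in>{..length (u @ v)} - {length u}. f (take k (u @ v)) * g (drop k (u @ v)) = 0"
    proof
      fix k assume "k \<in> {..length (u @ v)} - {length u}"
      then have "length (take k (u @ v)) \<noteq> length u" by auto
      then have "f (take k (u @ v)) = 0" using assms unfolding tensor_power_def by blast
      then show "f (take k (u @ v)) * g (drop k (u @ v)) = 0" by simp
    qed
  qed auto
  then show ?thesis by simp
qed

lemma tmult_sum_left: "(\<Sum>i\<in>I. tscale (a i) (f i)) \<otimes>t g = (\<Sum>i\<in>I. tscale (a i) (f i \<otimes>t g))"
  by (auto simp: fun_eq_iff tmult_def sum_tensor_apply tscale_def sum_distrib_left sum_distrib_right
      sum.swap[of _ I] mult.assoc)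

lemma tmult_sum_right: "f \<otimes>t (\<Sum>i\<in>I. tscale (a i) (g i)) = (\<Sum>i\<in>I. tscale (a i) (f \<otimes>t g i))"
  by (auto simp: fun_eq_iff tmult_def sum_tensor_apply tscale_def sum_distrib_left sum_distrib_right
      sum.swap[of _ I] mult.left_commute)

text \<open>The indicators of the finitely many words of length \<open>m\<close> span the whole
  homogeneous part.\<close>

lemma tensor_power_finite_basis:
  assumes "tensor.subspace W" "W \<subseteq> tensor_power N m"
  obtains B where "tensor.independent B" "finite B" "tensor.span B = W"
proof -
  let ?d = "\<lambda>w u. if u = w then 1 else 0 :: complex"
  let ?D = "?d ` words N m"
  have sub: "tensor_power N m \<subseteq> tensor.span ?D"
  proof
    fix f assume f: "f \<in> tensor_power N m"
    have "f = (\<Sum>w\<in>words N m. tscale (f w) (?d w))"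
    proof
      fix u
      show "f u = (\<Sum>w\<in>words N m. tscale (f w) (?d w)) u"
      proof -
        have "(\<Sum>w\<in>words N m. tscale (f w) (?d w)) u = (\<Sum>w\<in>words N m. if u = w then f w else 0)"
          unfolding sum_tensor_apply tscale_def by (rule sum.cong) auto
        also have "\<dots> = (if u \<in> words N m then f u else 0)" by simp
        also have "\<dots> = f u" using f unfolding tensor_power_def words_def by auto
        finally show ?thesis by simp
      qed
    qed
    also have "\<dots> \<in> tensor.span ?D"
      by (intro tensor.span_sum tensor.span_scale tensor.span_base) auto
    finally show "f \<in> tensor.span ?D" .
  qed
  obtain B where B: "B \<subseteq> W" "tensor.independent B" "W \<subseteq> tensor.span B"
    using tensor.maximal_independent_subset[of W] .
  have "finite B"
    using tensor.independent_span_bound[of ?D B] B sub assms(2) by auto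
  moreover have "tensor.span B = W" using tensor.span_subspace[OF B(1,3) assms(1)] .
  ultimately show ?thesis using that B(2) by blast
qed

lemma tensor_prod_space_power:
  assumes "X \<subseteq> tensor_power N a" "Y \<subseteq> tensor_power N b"
  shows "tensor.subspace (tensor_prod_space X Y)" "tensor_prod_space X Y \<subseteq> tensor_power N (a + b)"
proof -
  have "{x \<otimes>t y | x y. x \<in> X \<and> y \<in> Y} \<subseteq> tensor_power N (a + b)" using assms tmult_power by blast
  then show "tensor_prod_space X Y \<subseteq> tensor_power N (a + b)"
    unfolding tensor_prod_space_def by (rule tensor.span_minimal) (rule tensor_power_subspace)
qed (simp add: tensor_prod_space_def)

lemma independent_finiteD:
  assumes "tensor.independent B" "finite B" "(\<Sum>b\<in>B. tscale (c b) b) = 0" "b \<in> B"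
  shows "c b = 0"
  using assms tensor.dependent_finite by blast

text \<open>Evaluation at \<open>u @ v\<close>, with \<open>u\<close> of length \<open>a\<close>
  fixed and \<open>v\<close> varying, gives a linear relation on \<open>C\<close>. The vanishing of
  its coefficients for all \<open>u\<close> is a linear relation on \<open>B\<close>.\<close>

lemma independent_tmult:
  assumes B: "tensor.independent B" "finite B" "B \<subseteq> tensor_power N a"
    and C: "tensor.independent C" "finite C"
    and z: "(\<Sum>p\<in>B \<times> C. tscale (c p) (fst p \<otimes>t snd p)) = 0" and xy: "x \<in> B" "y \<in> C"
  shows "c (x, y) = 0"
proof -
  have "(\<Sum>x\<in>B. c (x, y) * x u) = 0" if y: "y \<in> C" for u y
  proof (cases "length u = a")
    case True
    have "(\<Sum>y\<in>C. tscale (\<Sum>x\<in>B. c (x, y) * x u) y) = 0"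
    proof
      fix v
      have "(\<Sum>y\<in>C. tscale (\<Sum>x\<in>B. c (x, y) * x u) y) v = (\<Sum>y\<in>C. \<Sum>x\<in>B. c (x, y) * x u * y v)"
        by (simp add: sum_tensor_apply tscale_def sum_distrib_right)
      also have "\<dots> = (\<Sum>p\<in>B \<times> C. c p * (fst p u * snd p v))"
        by (subst sum.swap) (simp add: sum.cartesian_product case_prod_unfold mult.assoc)
      also have "\<dots> = (\<Sum>p\<in>B \<times> C. tscale (c p) (fst p \<otimes>t snd p)) (u @ v)"
        unfolding sum_tensor_apply tscale_def
      proof (rule sum.cong[OF refl])
        fix p assume "p \<in> B \<times> C"
        then have "fst p \<in> tensor_power N (length u)" using B(3) True by auto
        from tmult_append[OF this] show "c p * (fst p u * snd p v) = c p * (fst p \<otimes>t snd p) (u @ v)" by simp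
      qed
      finally show "(\<Sum>y\<in>C. tscale (\<Sum>x\<in>B. c (x, y) * x u) y) v = 0 v" using z by simp
    qed
    from independent_finiteD[OF C this y] show ?thesis .
  next
    case False
    have "z u = 0" if "z \<in> B" for z
      using that B(3) False unfolding tensor_power_def by blast
    then show ?thesis by (intro sum.neutral) simp
  qed
  then have "(\<Sum>x\<in>B. tscale (c (x, y)) x) = 0"
    using xy(2) by (auto simp: fun_eq_iff sum_tensor_apply tscale_def)
  from independent_finiteD[OF B(1,2) this xy(1)] show ?thesis .
qed

context tensor_endo
begin

lemma tensor_prod_space_invariant:
  assumes "\<phi> ` X \<subseteq> X" "\<phi> ` Y \<subseteq> Y"
  shows "\<phi> ` tensor_prod_space X Y \<subseteq> tensor_prod_space X Y"
proof -
  have "\<phi> f \<in> tensor.span {x \<otimes>t y | x y. x \<in> X \<and> y \<in> Y}" if "f \<in> tensor.span {x \<otimes>t y | x y. x \<in> X \<and> y \<in> Y}" for f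
    using that
  proof (induction rule: tensor.span_induct_alt)
    case base
    show ?case unfolding zero by (rule tensor.span_zero)
  next
    case (step a f g)
    then obtain x y where "f = x \<otimes>t y" "x \<in> X" "y \<in> Y" by blast
    then have "\<phi> f \<in> {x \<otimes>t y | x y. x \<in> X \<and> y \<in> Y}" using mult assms by blast
    then show ?case using step.IH by (simp only: add scale tensor.span_add tensor.span_scale tensor.span_base)
  qed
  then show ?thesis unfolding tensor_prod_space_def by blast
qed

text \<open>On products of basis vectors the matrix of \<open>\<phi>\<close> is a Kronecker product,
  and the sum over its diagonal factors.\<close>

lemma trace_tensor_prod_space:
  assumes X: "tensor.subspace X" "X \<subseteq> tensor_power N a" "\<phi> ` X \<subseteq> X"
    and Y: "tensor.subspace Y" "Y \<subseteq> tensor_power N b" "\<phi> ` Y \<subseteq> Y"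
  shows "trace_on (tensor_prod_space X Y) \<phi> = trace_on X \<phi> * trace_on Y \<phi>"
proof -
  obtain B where B: "tensor.independent B" "finite B" "tensor.span B = X"
    using tensor_power_finite_basis[OF X(1,2)] .
  obtain C where C: "tensor.independent C" "finite C" "tensor.span C = Y"
    using tensor_power_finite_basis[OF Y(1,2)] .
  let ?r = tensor.representation
  have BX: "B \<subseteq> X" and CY: "C \<subseteq> Y" using B(3) C(3) tensor.span_superset by blast+
  have rB: "(\<Sum>v\<in>B. tscale (?r B x v) v) = x" if "x \<in> X" for x
    using tensor.sum_representation_eq[OF B(1) _ B(2) subset_refl] that B(3) by blast
  have rC: "(\<Sum>v\<in>C. tscale (?r C y v) v) = y" if "y \<in> Y" for y
    using tensor.sum_representation_eq[OF C(1) _ C(2) subset_refl] that C(3) by blast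
  have prod: "x \<otimes>t y = (\<Sum>p\<in>B \<times> C. tscale (?r B x (fst p) * ?r C y (snd p)) (fst p \<otimes>t snd p))"
    if x: "x \<in> X" and y: "y \<in> Y" for x y
  proof -
    have "x \<otimes>t y = (\<Sum>v\<in>B. tscale (?r B x v) v) \<otimes>t (\<Sum>w\<in>C. tscale (?r C y w) w)"
      using rB[OF x] rC[OF y] by simp
    also have "\<dots> = (\<Sum>v\<in>B. \<Sum>w\<in>C. tscale (?r B x v * ?r C y w) (v \<otimes>t w))"
      by (simp only: tmult_sum_left) (simp only: tmult_sum_right tensor.scale_sum_right tensor.scale_scale)
    finally show ?thesis by (simp add: sum.cartesian_product case_prod_unfold)
  qed
  have "trace_on (tensor_prod_space X Y) \<phi>
      = (\<Sum>p\<in>B \<times> C. ?r B (\<phi> (fst p)) (fst p) * ?r C (\<phi> (snd p)) (snd p))"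
  proof (rule trace_on_family[where b = "\<lambda>p. fst p \<otimes>t snd p" and
        M = "\<lambda>q p. ?r B (\<phi> (fst p)) (fst q) * ?r C (\<phi> (snd p)) (snd q)"])
    show "finite (B \<times> C)" using B(2) C(2) by simp
    show "tensor.span ((\<lambda>p. fst p \<otimes>t snd p) ` (B \<times> C)) = tensor_prod_space X Y"
      unfolding tensor_prod_space_def
    proof (rule tensor.span_eq[THEN iffD2], intro conjI subsetI)
      fix f assume "f \<in> (\<lambda>p. fst p \<otimes>t snd p) ` (B \<times> C)"
      then obtain x y where "f = x \<otimes>t y" "x \<in> B" "y \<in> C" by auto
      then have "f \<in> {x \<otimes>t y | x y. x \<in> X \<and> y \<in> Y}" using BX CY by blast
      then show "f \<in> tensor.span {x \<otimes>t y | x y. x \<in> X \<and> y \<in> Y}" by (rule tensor.span_base)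
    next
      fix f assume "f \<in> {x \<otimes>t y | x y. x \<in> X \<and> y \<in> Y}"
      then obtain x y where "f = x \<otimes>t y" "x \<in> X" "y \<in> Y" by blast
      then have "f = (\<Sum>p\<in>B \<times> C. tscale (?r B x (fst p) * ?r C y (snd p)) (fst p \<otimes>t snd p))"
        using prod by blast
      also have "\<dots> \<in> tensor.span ((\<lambda>p. fst p \<otimes>t snd p) ` (B \<times> C))"
        by (intro tensor.span_sum tensor.span_scale tensor.span_base) auto
      finally show "f \<in> tensor.span ((\<lambda>p. fst p \<otimes>t snd p) ` (B \<times> C))" .
    qed
    show "\<phi> ` tensor_prod_space X Y \<subseteq> tensor_prod_space X Y"
      using tensor_prod_space_invariant X(3) Y(3) .
  next
    fix c i assume c: "(\<Sum>i\<in>B \<times> C. tscale (c i) (fst i \<otimes>t snd i)) = 0" "i \<in> B \<times> C"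
    have "B \<subseteq> tensor_power N a" using BX X(2) by blast
    from independent_tmult[OF B(1,2) this C(1,2) c(1)] c(2) show "c i = 0" by auto
  next
    fix p assume p: "p \<in> B \<times> C"
    then have "fst p \<in> X" "snd p \<in> Y" using BX CY by auto
    then have "\<phi> (fst p) \<in> X" "\<phi> (snd p) \<in> Y" using X(3) Y(3) by blast+
    from prod[OF this] show "\<phi> (fst p \<otimes>t snd p) = (\<Sum>q\<in>B \<times> C.
        tscale (?r B (\<phi> (fst p)) (fst q) * ?r C (\<phi> (snd p)) (snd q)) (fst q \<otimes>t snd q))"
      unfolding mult .
  qed
  also have "\<dots> = (\<Sum>x\<in>B. ?r B (\<phi> x) x) * (\<Sum>y\<in>C. ?r C (\<phi> y) y)"
    by (simp add: sum_product sum.cartesian_product case_prod_unfold)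
  also have "\<dots> = trace_on X \<phi> * trace_on Y \<phi>"
    using trace_on_basis[OF B X(3)] trace_on_basis[OF C Y(3)] by simp
  finally show ?thesis .
qed

lemma trace_span_tone: "trace_on (tensor.span {tone}) \<phi> = 1"
  and span_tone_invariant: "\<phi> ` tensor.span {tone} \<subseteq> tensor.span {tone}"
proof -
  show inv: "\<phi> ` tensor.span {tone} \<subseteq> tensor.span {tone}"
    by (auto simp: tensor.span_singleton scale one)
  have "trace_on (tensor.span {tone}) \<phi> = (\<Sum>i\<in>{()}. 1)"
  proof (rule trace_on_family[where b = "\<lambda>_. tone"])
    fix c :: "unit \<Rightarrow> complex" and i
    assume "(\<Sum>i\<in>{()}. tscale (c i) tone) = 0"
    then have "c () = 0 \<or> tone = 0" by simp
    moreover have "tone [] \<noteq> (0 :: tensor) []" by (simp add: tone_def)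
    then have "tone \<noteq> 0" by metis
    ultimately show "c i = 0" by simp
  qed (use inv in \<open>auto simp: one\<close>)
  then show "trace_on (tensor.span {tone}) \<phi> = 1" by simp
qed

lemma trace_foldr:
  assumes "\<And>X. X \<in> set Xs \<Longrightarrow> tensor.subspace X \<and> (\<exists>m. X \<subseteq> tensor_power N m) \<and> \<phi> ` X \<subseteq> X"
  shows "trace_on (foldr tensor_prod_space Xs (tensor.span {tone})) \<phi> = (\<Prod>X\<leftarrow>Xs. trace_on X \<phi>)"
proof -
  let ?F = "\<lambda>Xs. foldr tensor_prod_space Xs (tensor.span {tone})"
  \<comment> \<open>Subspace, homogeneity and invariance of the partial product are part of the
    induction, since multiplicativity of the trace asks for them at each further factor.\<close>
  have "trace_on (?F Xs) \<phi> = (\<Prod>X\<leftarrow>Xs. trace_on X \<phi>) \<and>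
    tensor.subspace (?F Xs) \<and> (\<exists>m. ?F Xs \<subseteq> tensor_power N m) \<and> \<phi> ` ?F Xs \<subseteq> ?F Xs"
    using assms
  proof (induction Xs)
    case Nil
    have "tensor.span {tone} \<subseteq> tensor_power N 0"
      by (rule tensor.span_minimal) (simp_all add: tone_power tensor_power_subspace)
    then show ?case using trace_span_tone span_tone_invariant tensor.subspace_span by auto
  next
    case (Cons X Xs)
    obtain a where X: "tensor.subspace X" "X \<subseteq> tensor_power N a" "\<phi> ` X \<subseteq> X" using Cons.prems[of X] by auto
    obtain b where Y: "tensor.subspace (?F Xs)" "?F Xs \<subseteq> tensor_power N b" "\<phi> ` ?F Xs \<subseteq> ?F Xs"
      and t: "trace_on (?F Xs) \<phi> = (\<Prod>X\<leftarrow>Xs. trace_on X \<phi>)"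
      using Cons.IH Cons.prems by auto
    have "trace_on (?F (X # Xs)) \<phi> = (\<Prod>X\<leftarrow>X # Xs. trace_on X \<phi>)"
      using trace_tensor_prod_space[OF X Y] t by simp
    moreover have "tensor.subspace (?F (X # Xs))" "?F (X # Xs) \<subseteq> tensor_power N (a + b)"
      using tensor_prod_space_power[OF X(2) Y(2)] by simp_all
    moreover have "\<phi> ` ?F (X # Xs) \<subseteq> ?F (X # Xs)"
      using tensor_prod_space_invariant[OF X(3) Y(3)] by simp
    ultimately show ?case by blast
  qed
  then show ?thesis by blast
qed

section \<open>Higher Lie modules\<close>

lemma free_lie_invariant: "f \<in> free_lie N \<Longrightarrow> \<phi> f \<in> free_lie N"
proof (induction rule: free_lie.induct)
  case (generator v)
  then show ?case by (intro free_lie.generator power)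
next
  case (add f g)
  from free_lie.add[OF add.IH] show ?case by (simp only: tensor_endo.add[OF tensor_endo_axioms])
next
  case (scale f a)
  from free_lie.scale[OF scale.IH] show ?case by (simp only: tensor_endo.scale[OF tensor_endo_axioms])
next
  case (bracket f g)
  from free_lie.bracket[OF bracket.IH] show ?case by (simp only: diff mult)
qed

lemma lie_part_invariant: "\<phi> ` lie_part N m \<subseteq> lie_part N m"
  unfolding lie_part_def using free_lie_invariant power by blast

lemma foldr_tmult: "\<phi> (foldr (\<otimes>t) fs tone) = foldr (\<otimes>t) (map \<phi> fs) tone"
  by (induction fs) (auto simp: mult one)

lemma sym_prod_map: "\<phi> (sym_prod ws) = sym_prod (map \<phi> ws)"
proof -
  have "\<phi> (sym_prod ws) = (\<Sum>\<sigma> | \<sigma> permutes {..<length ws}.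
      foldr (\<otimes>t) (map (\<lambda>i. \<phi> (ws ! \<sigma> i)) [0..<length ws]) tone)"
    unfolding sym_prod_def by (simp add: sum foldr_tmult comp_def)
  also have "\<dots> = sym_prod (map \<phi> ws)"
    unfolding sym_prod_def
  proof (simp only: length_map, rule sum.cong[OF refl])
    fix \<sigma> assume "\<sigma> \<in> {\<sigma>. \<sigma> permutes {..<length ws}}"
    then have "\<sigma> i < length ws" if "i < length ws" for i using permutes_in_image[of \<sigma> "{..<length ws}" i] that by simp
    then have "map (\<lambda>i. \<phi> (ws ! \<sigma> i)) [0..<length ws] = map (\<lambda>i. map \<phi> ws ! \<sigma> i) [0..<length ws]"
      by (intro map_cong) auto
    then show "foldr (\<otimes>t) (map (\<lambda>i. \<phi> (ws ! \<sigma> i)) [0..<length ws]) tone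
       = foldr (\<otimes>t) (map (\<lambda>i. map \<phi> ws ! \<sigma> i) [0..<length ws]) tone" by (simp only:)
  qed
  finally show ?thesis .
qed

lemma sym_power_invariant:
  assumes "\<phi> ` W \<subseteq> W"
  shows "\<phi> ` sym_power k W \<subseteq> sym_power k W"
proof -
  let ?S = "sym_prod ` {ws. length ws = k \<and> set ws \<subseteq> W}"
  have S: "\<phi> f \<in> ?S" if f: "f \<in> ?S" for f
  proof -
    obtain ws where ws: "length ws = k" "set ws \<subseteq> W" "f = sym_prod ws" using f by blast
    then have "map \<phi> ws \<in> {ws. length ws = k \<and> set ws \<subseteq> W}" using assms by auto
    then show ?thesis unfolding ws(3) sym_prod_map by (rule imageI)
  qed
  have "\<phi> f \<in> tensor.span ?S" if "f \<in> tensor.span ?S" for f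
    using that
  proof (induction rule: tensor.span_induct_alt)
    case base
    show ?case unfolding zero by (rule tensor.span_zero)
  next
    case (step a f g)
    show ?case using S[OF step.hyps(1)] step.IH
      by (simp only: add scale tensor.span_add tensor.span_scale tensor.span_base)
  qed
  then show ?thesis unfolding sym_power_def by blast
qed

end

lemma foldr_tmult_power:
  "set fs \<subseteq> tensor_power N m \<Longrightarrow> foldr (\<otimes>t) fs tone \<in> tensor_power N (length fs * m)"
  by (induction fs) (auto simp: tone_power intro: tmult_power)

lemma sym_power_power:
  assumes "W \<subseteq> tensor_power N m"
  shows "sym_power k W \<subseteq> tensor_power N (k * m)"
  unfolding sym_power_def
proof (rule tensor.span_minimal)
  show "sym_prod ` {ws. length ws = k \<and> set ws \<subseteq> W} \<subseteq> tensor_power N (k * m)"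
  proof (rule image_subsetI)
    fix ws assume ws: "ws \<in> {ws. length ws = k \<and> set ws \<subseteq> W}"
    show "sym_prod ws \<in> tensor_power N (k * m)"
      unfolding sym_prod_def
    proof (rule tensor.subspace_sum[OF tensor_power_subspace])
      fix \<sigma> assume "\<sigma> \<in> {\<sigma>. \<sigma> permutes {..<length ws}}"
      then have "\<sigma> i < length ws" if "i < length ws" for i using permutes_in_image[of \<sigma> "{..<length ws}" i] that by simp
      then have "set (map (\<lambda>i. ws ! \<sigma> i) [0..<length ws]) \<subseteq> tensor_power N m"
        using ws assms nth_mem[of _ ws] by (auto simp: subset_iff)
      from foldr_tmult_power[OF this] ws
      show "foldr (\<otimes>t) (map (\<lambda>i. ws ! \<sigma> i) [0..<length ws]) tone \<in> tensor_power N (k * m)" by simp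
    qed
  qed
qed (rule tensor_power_subspace)

text \<open>Part sizes that do not occur contribute the trivial one-dimensional module, with trace
  1.\<close>

lemma sym_power_0: "sym_power 0 W = tensor.span {tone}"
proof -
  have "{ws. length ws = 0 \<and> set ws \<subseteq> W} = {[]}" by auto
  moreover have "sym_prod [] = tone" by (simp add: sym_prod_def)
  ultimately show ?thesis unfolding sym_power_def by simp
qed

context tensor_endo
begin

text \<open>This replaces the range up to \<open>sum_list \<kappa>\<close> by any bound on the
  parts, so that several partitions can share one range. Both ranges are compared inside the larger
  one; the extra indices have multiplicity 0.\<close>

lemma trace_higher_lie:
  assumes "set \<kappa> \<subseteq> {..n}"
  shows "trace_on (higher_lie N \<kappa>) \<phi> = (\<Prod>i=1..n. trace_on (sym_power (count_list \<kappa> i) (lie_part N i)) \<phi>)"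
proof -
  let ?t = "\<lambda>i. trace_on (sym_power (count_list \<kappa> i) (lie_part N i)) \<phi>"
  have "trace_on (higher_lie N \<kappa>) \<phi> = (\<Prod>i\<leftarrow>[1..<Suc (sum_list \<kappa>)]. ?t i)"
    unfolding higher_lie_def
  proof (subst trace_foldr)
    fix X assume "X \<in> set (map (\<lambda>i. sym_power (count_list \<kappa> i) (lie_part N i)) [1..<Suc (sum_list \<kappa>)])"
    then obtain i where X: "X = sym_power (count_list \<kappa> i) (lie_part N i)" by auto
    have "lie_part N i \<subseteq> tensor_power N i" by (simp add: lie_part_def)
    then show "tensor.subspace X \<and> (\<exists>m. X \<subseteq> tensor_power N m) \<and> \<phi> ` X \<subseteq> X"
      unfolding X using sym_power_power[of "lie_part N i" N i "count_list \<kappa> i"]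
        sym_power_invariant[OF lie_part_invariant, of "count_list \<kappa> i" i]
        tensor.subspace_span[of "sym_prod ` {ws. length ws = count_list \<kappa> i \<and> set ws \<subseteq> lie_part N i}"]
      unfolding sym_power_def by blast
  qed (simp only: map_map comp_def)
  also have "\<dots> = (\<Prod>i=1..sum_list \<kappa>. ?t i)"
    by (subst prod.distinct_set_conv_list[symmetric]) (simp_all only: distinct_upt set_upt atLeastLessThanSuc_atLeastAtMost)
  also have "\<dots> = (\<Prod>i=1..max n (sum_list \<kappa>). ?t i)"
  proof (rule prod.mono_neutral_left)
    show "\<forall>i\<in>{1..max n (sum_list \<kappa>)} - {1..sum_list \<kappa>}. ?t i = 1"
    proof
      fix i assume "i \<in> {1..max n (sum_list \<kappa>)} - {1..sum_list \<kappa>}"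
      then have "i \<notin> set \<kappa>" using member_le_sum_list by force
      then have "count_list \<kappa> i = 0" by (simp add: count_list_0_iff)
      then show "?t i = 1" using sym_power_0 trace_span_tone by simp
    qed
  qed auto
  also have "\<dots> = (\<Prod>i=1..n. ?t i)"
  proof (rule prod.mono_neutral_right)
    show "\<forall>i\<in>{1..max n (sum_list \<kappa>)} - {1..n}. ?t i = 1"
    proof
      fix i assume "i \<in> {1..max n (sum_list \<kappa>)} - {1..n}"
      then have "i \<notin> set \<kappa>" using assms by auto
      then have "count_list \<kappa> i = 0" by (simp add: count_list_0_iff)
      then show "?t i = 1" using sym_power_0 trace_span_tone by simp
    qed
  qed auto
  finally show ?thesis .
qed

text \<open>For each part size at most one of the lists has positive multiplicity, so every other
  list contributes the factor 1. For a shared part size the symmetric powers would not multiply in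
  this way.\<close>

lemma trace_higher_lie_concat:
  assumes "\<And>j k i. j < length \<Lambda> \<Longrightarrow> k < length \<Lambda> \<Longrightarrow> i \<in> set (\<Lambda> ! j) \<Longrightarrow> i \<in> set (\<Lambda> ! k) \<Longrightarrow> j = k"
  shows "trace_on (higher_lie N (concat \<Lambda>)) \<phi> = (\<Prod>j<length \<Lambda>. trace_on (higher_lie N (\<Lambda> ! j)) \<phi>)"
proof -
  let ?t = "\<lambda>\<kappa> i. trace_on (sym_power (count_list \<kappa> i) (lie_part N i)) \<phi>"
  define n where "n = Max (insert 0 (set (concat \<Lambda>)))"
  have n: "i \<le> n" if "i \<in> set (concat \<Lambda>)" for i
    unfolding n_def using that by (intro Max_ge) auto
  have nj: "set (\<Lambda> ! j) \<subseteq> {..n}" if "j < length \<Lambda>" for j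
    using n nth_mem[OF that] by auto
  have one: "?t \<kappa> i = 1" if "i \<notin> set \<kappa>" for \<kappa> i
  proof -
    have "count_list \<kappa> i = 0" using that by (simp add: count_list_0_iff)
    then show ?thesis using sym_power_0 trace_span_tone by simp
  qed
  have count: "count_list (concat \<Lambda>) i = (\<Sum>j<length \<Lambda>. count_list (\<Lambda> ! j) i)" for i
    by (induction \<Lambda>) (simp_all add: sum.lessThan_Suc_shift del: sum.lessThan_Suc)
  have "?t (concat \<Lambda>) i = (\<Prod>j<length \<Lambda>. ?t (\<Lambda> ! j) i)" for i
  proof (cases "\<exists>j<length \<Lambda>. i \<in> set (\<Lambda> ! j)")
    case True
    then obtain j where j: "j < length \<Lambda>" "i \<in> set (\<Lambda> ! j)" by blast
    have out: "i \<notin> set (\<Lambda> ! k)" if "k < length \<Lambda>" "k \<noteq> j" for k using assms[OF j(1) that(1) j(2)] that(2) by blast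
    have "count_list (concat \<Lambda>) i = (\<Sum>k\<in>{j}. count_list (\<Lambda> ! k) i)"
      unfolding count by (rule sum.mono_neutral_right) (use j out in \<open>auto simp: count_list_0_iff\<close>)
    moreover have "(\<Prod>k<length \<Lambda>. ?t (\<Lambda> ! k) i) = (\<Prod>k\<in>{j}. ?t (\<Lambda> ! k) i)"
      by (rule prod.mono_neutral_right) (use j out one in auto)
    ultimately show ?thesis by simp
  next
    case False
    then have "i \<notin> set (concat \<Lambda>)" by (auto simp: in_set_conv_nth[of _ \<Lambda>])
    then have "?t (concat \<Lambda>) i = 1" by (rule one)
    moreover have "(\<Prod>j<length \<Lambda>. ?t (\<Lambda> ! j) i) = 1"
      by (rule prod.neutral) (use False one in auto)
    ultimately show ?thesis by simp
  qed
  then have "trace_on (higher_lie N (concat \<Lambda>)) \<phi> = (\<Prod>i=1..n. \<Prod>j<length \<Lambda>. ?t (\<Lambda> ! j) i)"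
    using trace_higher_lie[of "concat \<Lambda>" n] n by (simp add: subset_iff)
  also have "\<dots> = (\<Prod>j<length \<Lambda>. \<Prod>i=1..n. ?t (\<Lambda> ! j) i)" by (rule prod.swap)
  also have "\<dots> = (\<Prod>j<length \<Lambda>. trace_on (higher_lie N (\<Lambda> ! j)) \<phi>)"
    by (rule prod.cong[OF refl]) (simp only: lessThan_iff trace_higher_lie[OF nj])
  finally show ?thesis .
qed

end

section \<open>The action of matrices\<close>

lemma prod_lessThan_add: "(\<Prod>i<k + m. f i) = (\<Prod>i<k. f i) * (\<Prod>i<m. f (k + i))"
  for f :: "nat \<Rightarrow> 'a :: comm_monoid_mult"
  by (induction m) (simp_all add: mult.assoc)

text \<open>The product of matrix entries along a word factors at every cut, and so does the sum
  over words \<open>u @ v\<close>.\<close>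

lemma gl_action_tmult: "gl_action N g (f \<otimes>t h) = gl_action N g f \<otimes>t gl_action N g h"
proof
  fix w
  let ?W = "\<lambda>m. {u :: nat list. length u = m \<and> set u \<subseteq> {..<N}}"
  let ?c = "\<lambda>w u. \<Prod>k<length w. g $$ (w ! k, u ! k)"
  show "gl_action N g (f \<otimes>t h) w = (gl_action N g f \<otimes>t gl_action N g h) w"
  proof (cases "set w \<subseteq> {..<N}")
    case False
    have "gl_action N g f (take k w) * gl_action N g h (drop k w) = 0" for k
    proof -
      have "\<not> (set (take k w) \<subseteq> {..<N} \<and> set (drop k w) \<subseteq> {..<N})"
        using False by (metis append_take_drop_id set_append Un_subset_iff)
      then show ?thesis by (auto simp: gl_action_def)
    qed
    then have "(gl_action N g f \<otimes>t gl_action N g h) w = 0" unfolding tmult_def by (intro sum.neutral) blast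
    then show ?thesis using False by (simp add: gl_action_def)
  next
    case True
    have split: "(\<Sum>u\<in>?W (length w). ?c w u * (f (take k u) * h (drop k u)))
        = gl_action N g f (take k w) * gl_action N g h (drop k w)" if k: "k \<le> length w" for k
    proof -
      have bij: "bij_betw (\<lambda>(u, v). u @ v) (?W k \<times> ?W (length w - k)) (?W (length w))"
        by (rule bij_betwI[where g = "\<lambda>u. (take k u, drop k u)"])
          (use k in \<open>auto dest!: in_set_takeD in_set_dropD\<close>)
      have c: "?c w (u @ v) = ?c (take k w) u * ?c (drop k w) v" if "length u = k" for u v
      proof -
        have "?c w (u @ v) = (\<Prod>i\<in>{..<k + (length w - k)}. g $$ (w ! i, (u @ v) ! i))" using k by simp
        also have "\<dots> = (\<Prod>i<k. g $$ (w ! i, (u @ v) ! i)) * (\<Prod>i<length w - k. g $$ (w ! (k + i), (u @ v) ! (k + i)))"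
          by (rule prod_lessThan_add)
        finally show ?thesis using k that by (simp add: nth_append)
      qed
      have "(\<Sum>u\<in>?W (length w). ?c w u * (f (take k u) * h (drop k u)))
          = (\<Sum>(u, v)\<in>?W k \<times> ?W (length w - k). ?c w (u @ v) * (f (take k (u @ v)) * h (drop k (u @ v))))"
        using sum.reindex_bij_betw[OF bij, of "\<lambda>u. ?c w u * (f (take k u) * h (drop k u))"]
        by (simp add: case_prod_unfold)
      also have "\<dots> = (\<Sum>(u, v)\<in>?W k \<times> ?W (length w - k). (?c (take k w) u * f u) * (?c (drop k w) v * h v))"
        by (rule sum.cong[OF refl]) (auto simp: c simp del: length_take length_drop)
      also have "\<dots> = (\<Sum>u\<in>?W k. ?c (take k w) u * f u) * (\<Sum>v\<in>?W (length w - k). ?c (drop k w) v * h v)"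
        by (simp only: sum_product sum.cartesian_product)
      also have "\<dots> = gl_action N g f (take k w) * gl_action N g h (drop k w)"
        using True k set_take_subset[of k w] set_drop_subset[of k w] by (simp add: gl_action_def min_absorb2 subset_trans)
      finally show ?thesis .
    qed
    have "gl_action N g (f \<otimes>t h) w = (\<Sum>u\<in>?W (length w). \<Sum>k\<le>length w. ?c w u * (f (take k u) * h (drop k u)))"
      using True by (auto simp: gl_action_def tmult_def sum_distrib_left intro!: sum.cong)
    also have "\<dots> = (\<Sum>k\<le>length w. gl_action N g f (take k w) * gl_action N g h (drop k w))"
      by (subst sum.swap) (rule sum.cong[OF refl], simp add: split)
    finally show ?thesis unfolding tmult_def .
  qed
qed

lemma gl_action_endo: "tensor_endo N (gl_action N g)"
proof
  fix f h :: tensor and a m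
  show "gl_action N g (f + h) = gl_action N g f + gl_action N g h"
    by (auto simp: gl_action_def fun_eq_iff distrib_left sum.distrib)
  show "gl_action N g (tscale a f) = tscale a (gl_action N g f)"
    by (auto simp: gl_action_def tscale_def fun_eq_iff sum_distrib_left mult.left_commute)
  show "gl_action N g (f \<otimes>t h) = gl_action N g f \<otimes>t gl_action N g h" by (rule gl_action_tmult)
  show "gl_action N g tone = tone"
  proof
    fix w
    show "gl_action N g tone w = tone w"
    proof (cases w)
      case Nil
      have "{u. length u = length w \<and> set u \<subseteq> {..<N}} = {[]}" using Nil by auto
      then show ?thesis using Nil by (simp add: gl_action_def tone_def)
    next
      case (Cons x v)
      have "tone u = 0" if "length u = length w" for u using that Cons by (auto simp: tone_def)
      then show ?thesis using Cons by (simp add: gl_action_def tone_def)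
    qed
  qed
  assume f: "f \<in> tensor_power N m"
  show "gl_action N g f \<in> tensor_power N m"
    unfolding tensor_power_def
  proof (intro CollectI allI impI)
    fix w assume w: "gl_action N g f w \<noteq> 0"
    then have "set w \<subseteq> {..<N}" by (auto simp: gl_action_def split: if_splits)
    moreover have "\<exists>u. length u = length w \<and> f u \<noteq> 0"
    proof (rule ccontr)
      assume "\<not> (\<exists>u. length u = length w \<and> f u \<noteq> 0)"
      then have "gl_action N g f w = 0" by (auto simp: gl_action_def intro!: sum.neutral)
      then show False using w by simp
    qed
    ultimately show "length w = m \<and> set w \<subseteq> {..<N}" using f unfolding tensor_power_def by fastforce
  qed
qed

section \<open>Linear independence of the Schur functions\<close>

lemma digits_unique:
  fixes f g :: "nat \<Rightarrow> nat"
  assumes "\<And>i. f i < B" "\<And>i. g i < B" "(\<Sum>i<n. f i * B ^ i) = (\<Sum>i<n. g i * B ^ i)" "i < n"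
  shows "f i = g i"
  using assms
proof (induction n arbitrary: f g i)
  case (Suc n)
  have split: "(\<Sum>i<Suc n. h i * B ^ i) = h 0 + B * (\<Sum>i<n. h (Suc i) * B ^ i)" for h :: "nat \<Rightarrow> nat"
    by (simp add: sum.lessThan_Suc_shift sum_distrib_left mult.left_commute del: sum.lessThan_Suc)
  have e: "f 0 + B * (\<Sum>i<n. f (Suc i) * B ^ i) = g 0 + B * (\<Sum>i<n. g (Suc i) * B ^ i)"
    using Suc.prems(3) unfolding split .
  have 0: "f 0 = g 0"
    using arg_cong[OF e, of "\<lambda>x. x mod B"] Suc.prems(1,2)[of 0] by simp
  have B: "0 < B" using Suc.prems(1)[of 0] by simp
  have s: "(\<Sum>i<n. f (Suc i) * B ^ i) = (\<Sum>i<n. g (Suc i) * B ^ i)" using e 0 B by simp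
  have "f (Suc k) = g (Suc k)" if "k < n" for k
    by (rule Suc.IH[of "\<lambda>i. f (Suc i)" "\<lambda>i. g (Suc i)"]) (use Suc.prems(1,2) s that in auto)
  then show ?case using 0 Suc.prems(4) by (cases i) auto
qed simp

lemma partition_le: "\<mu> \<turnstile>p n \<Longrightarrow> row_len \<mu> i \<le> n" "\<mu> \<turnstile>p n \<Longrightarrow> length \<mu> \<le> n"
proof -
  assume m: "\<mu> \<turnstile>p n"
  show "row_len \<mu> i \<le> n"
    using m member_le_sum_list[of "\<mu> ! i" \<mu>] unfolding partition_of_def row_len_def by auto
  have "length \<mu> \<le> sum_list \<mu>" if "0 \<notin> set \<mu>" using that by (induction \<mu>) auto
  then show "length \<mu> \<le> n" using m unfolding partition_of_def by blast
qed

text \<open>The exponent of \<open>t\<close> in the monomial of \<open>T\<close> when the variable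
  with index \<open>i\<close> becomes \<open>t ^ (B ^ i)\<close>.\<close>

definition tab_weight :: "nat \<Rightarrow> nat list \<Rightarrow> tableau \<Rightarrow> nat" where
  "tab_weight B \<mu> T = (\<Sum>c\<in>diagram \<mu>. B ^ the (T c))"

text \<open>The weight of the superstandard tableau, whose row \<open>i\<close> is filled with
  \<open>i\<close>.\<close>

definition min_weight :: "nat \<Rightarrow> nat list \<Rightarrow> nat" where
  "min_weight B \<mu> = (\<Sum>c\<in>diagram \<mu>. B ^ fst c)"

lemma min_weight_sum:
  assumes "length \<mu> \<le> n"
  shows "min_weight B \<mu> = (\<Sum>i<n. row_len \<mu> i * B ^ i)"
proof -
  have "diagram \<mu> = Sigma {..<n} (\<lambda>i. {..<row_len \<mu> i})"
    using assms unfolding diagram_row_len by (auto simp: row_len_def split: if_splits)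
  then have "min_weight B \<mu> = (\<Sum>(i, j)\<in>Sigma {..<n} (\<lambda>i. {..<row_len \<mu> i}). B ^ i)"
    unfolding min_weight_def by (simp add: case_prod_unfold)
  also have "\<dots> = (\<Sum>i<n. \<Sum>j<row_len \<mu> i. B ^ i)" by (rule sum.Sigma[symmetric]) auto
  finally show ?thesis by simp
qed

text \<open>The row lengths are at most \<open>n < B\<close>, so they are the digits of
  \<open>min_weight\<close> to the base \<open>B\<close>.\<close>

lemma min_weight_inject:
  assumes "\<mu> \<turnstile>p n" "\<nu> \<turnstile>p n" "n < B" "min_weight B \<mu> = min_weight B \<nu>"
  shows "\<mu> = \<nu>"
proof -
  note l = partition_le(2)[OF assms(1)] partition_le(2)[OF assms(2)]
  have "row_len \<mu> i = row_len \<nu> i" for i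
  proof (cases "i < n")
    case True
    show ?thesis
    proof (rule digits_unique[of "row_len \<mu>" B "row_len \<nu>" n i])
      show "row_len \<mu> i < B" "row_len \<nu> i < B" for i
        using partition_le(1)[OF assms(1), of i] partition_le(1)[OF assms(2), of i] assms(3) by simp_all
      show "(\<Sum>i<n. row_len \<mu> i * B ^ i) = (\<Sum>i<n. row_len \<nu> i * B ^ i)"
        using assms(4) min_weight_sum[OF l(1)] min_weight_sum[OF l(2)] by simp
    qed (rule True)
  next
    case False
    then show ?thesis using l by (simp add: row_len_def)
  qed
  then have "row_len \<mu> = row_len \<nu>" ..
  then show ?thesis using row_len_inject assms(1,2) unfolding partition_of_def by blast
qed

lemma semistandard_ge_row:
  assumes "sorted_wrt (\<ge>) \<mu>" "T \<in> semistandard_tableaux \<mu> N" "T (i, j) = Some a"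
  shows "i \<le> a"
  using assms(3)
proof (induction i arbitrary: a)
  case (Suc i)
  have T: "filling T" "dom T = {(i, j). j < row_len \<mu> i}"
    using assms(2) unfolding semistandard_iff diagram_row_len by blast+
  obtain b where "T (i, j) = Some b" "b < a"
    using filling_col[OF T decr_row_len[OF assms(1)] Suc.prems, of i] by blast
  then show ?case using Suc.IH by fastforce
qed simp

text \<open>Strict columns make every entry at least its row number. As the powers of
  \<open>B\<close> increase strictly, one larger entry makes the weight larger.\<close>

lemma tab_weight_ge:
  assumes "sorted_wrt (\<ge>) \<mu>" "T \<in> semistandard_tableaux \<mu> N" "1 < B"
  shows "min_weight B \<mu> \<le> tab_weight B \<mu> T"
    and "tab_weight B \<mu> T = min_weight B \<mu> \<Longrightarrow> T = (\<lambda>c. if c \<in> diagram \<mu> then Some (fst c) else None)"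
proof -
  have dom: "dom T = diagram \<mu>" using assms(2) unfolding semistandard_iff by blast
  have le: "fst c \<le> the (T c)" if "c \<in> diagram \<mu>" for c
  proof -
    obtain i j where c: "c = (i, j)" by fastforce
    have "(i, j) \<in> dom T" unfolding dom using that c by simp
    then obtain a where a: "T (i, j) = Some a" by blast
    show ?thesis using semistandard_ge_row[OF assms(1,2) a] a c by simp
  qed
  then have le': "B ^ fst c \<le> B ^ the (T c)" if "c \<in> diagram \<mu>" for c
    using that assms(3) by (intro power_increasing) auto
  then show "min_weight B \<mu> \<le> tab_weight B \<mu> T"
    unfolding min_weight_def tab_weight_def by (rule sum_mono)
  assume e: "tab_weight B \<mu> T = min_weight B \<mu>"
  have eq: "the (T c) = fst c" if c: "c \<in> diagram \<mu>" for c
  proof (rule ccontr)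
    assume "the (T c) \<noteq> fst c"
    then have "B ^ fst c < B ^ the (T c)" using le[OF c] assms(3) by (intro power_strict_increasing) auto
    then have "min_weight B \<mu> < tab_weight B \<mu> T"
      unfolding min_weight_def tab_weight_def
      by (intro sum_strict_mono_ex1 card_diagram ballI le' bexI[OF _ c])
    then show False using e by simp
  qed
  show "T = (\<lambda>c. if c \<in> diagram \<mu> then Some (fst c) else None)"
  proof
    fix c
    show "T c = (if c \<in> diagram \<mu> then Some (fst c) else None)"
    proof (cases "c \<in> diagram \<mu>")
      case True
      then have "c \<in> dom T" unfolding dom .
      then obtain a where "T c = Some a" by blast
      then show ?thesis using eq[OF True] True by simp
    next
      case False
      then have "c \<notin> dom T" unfolding dom .
      then show ?thesis using False by (simp add: domIff)
    qed
  qed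
qed

lemma superstandard_tableau:
  assumes "length \<mu> \<le> N"
  defines "T \<equiv> (\<lambda>c. if c \<in> diagram \<mu> then Some (fst c) else None)"
  shows "T \<in> semistandard_tableaux \<mu> N" "tab_weight B \<mu> T = min_weight B \<mu>"
proof -
  have "filling T" unfolding filling_def T_def by (auto split: if_splits)
  moreover have "dom T = diagram \<mu>" unfolding T_def by (auto split: if_splits)
  moreover have "ran T \<subseteq> {..<N}" using assms(1) unfolding T_def ran_def diagram_def by (auto split: if_splits)
  ultimately show "T \<in> semistandard_tableaux \<mu> N" unfolding semistandard_iff by blast
  show "tab_weight B \<mu> T = min_weight B \<mu>" unfolding tab_weight_def min_weight_def T_def by simp
qed

lemma finite_semistandard: "finite (semistandard_tableaux \<mu> N)"
proof (rule finite_subset)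
  show "semistandard_tableaux \<mu> N \<subseteq> {T. dom T = diagram \<mu> \<and> ran T \<subseteq> {..<N}}"
    unfolding semistandard_tableaux_def by blast
qed (rule finite_set_of_finite_maps, simp_all add: card_diagram)

lemma coeff_sum_monom: "finite A \<Longrightarrow> coeff (\<Sum>x\<in>A. monom 1 (f x)) e = (of_nat (card {x \<in> A. f x = e}) :: complex)"
  by (simp add: coeff_sum sum.If_cases Int_def)

text \<open>Substituting \<open>x\<^sub>i = t ^ B ^ i\<close> turns a Schur polynomial into a polynomial in \<open>t\<close> whose lowest term comes
  only from the tableau with constant rows, and these lowest terms have distinct degrees.\<close>

theorem schur_poly_independent:
  assumes z: "\<And>xs. length xs = n \<Longrightarrow> 0 \<notin> set xs \<Longrightarrow> (\<Sum>\<mu> | \<mu> \<turnstile>p n. d \<mu> * schur_poly \<mu> xs) = 0"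
    and "\<nu> \<turnstile>p n"
  shows "d \<nu> = 0"
proof (rule ccontr)
  assume "d \<nu> \<noteq> 0"
  \<comment> \<open>Greater than \<open>n\<close>, so that row lengths are digits, and greater than
    1 also for \<open>n = 0\<close>, so that powers increase strictly.\<close>
  define B where "B = Suc (Suc n)"
  let ?D = "{\<mu>. \<mu> \<turnstile>p n \<and> d \<mu> \<noteq> 0}"
  have fin: "finite ?D" by (rule finite_subset[OF _ finite_partitions[of n]]) auto
  have "?D \<noteq> {}" using \<open>d \<nu> \<noteq> 0\<close> assms(2) by blast
  \<comment> \<open>Among the partitions with nonzero coefficient, one whose lowest term has the
    least degree; its superstandard tableau alone will account for the coefficient in this
    degree.\<close>
  then obtain \<kappa> where \<kappa>: "\<kappa> \<turnstile>p n" "d \<kappa> \<noteq> 0" and min: "\<And>\<mu>. \<mu> \<turnstile>p n \<Longrightarrow> d \<mu> \<noteq> 0 \<Longrightarrow> min_weight B \<kappa> \<le> min_weight B \<mu>"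
    using ex_min_if_finite[of "min_weight B ` ?D"] fin
    by (metis (mono_tags, lifting) mem_Collect_eq arg_min_if_finite(1) arg_min_least)
  let ?S = "\<lambda>\<mu>. semistandard_tableaux \<mu> n"
  define p :: "complex poly" where
    "p = (\<Sum>\<mu> | \<mu> \<turnstile>p n. Polynomial.smult (d \<mu>) (\<Sum>T\<in>?S \<mu>. monom 1 (tab_weight B \<mu> T)))"
  \<comment> \<open>Only nonzero values may be substituted, as eigenvalues of invertible matrices
    are nonzero; these are still infinitely many roots.\<close>
  have "poly p t = 0" if t: "t \<noteq> 0" for t
  proof -
    let ?xs = "map (\<lambda>i. t ^ (B ^ i)) [0..<n]"
    have s: "schur_poly \<mu> ?xs = (\<Sum>T\<in>?S \<mu>. t ^ tab_weight B \<mu> T)" if "\<mu> \<turnstile>p n" for \<mu>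
      unfolding schur_poly_def
    proof (simp only: length_map length_upt diff_zero, rule sum.cong[OF refl])
      fix T assume T: "T \<in> ?S \<mu>"
      have "?xs ! the (T c) = t ^ (B ^ the (T c))" if "c \<in> diagram \<mu>" for c
      proof -
        have "the (T c) \<in> ran T" using T that unfolding semistandard_iff by (metis domIff option.collapse ranI)
        then have "the (T c) < n" using T unfolding semistandard_iff by blast
        then show ?thesis by simp
      qed
      then show "(\<Prod>c\<in>diagram \<mu>. ?xs ! the (T c)) = t ^ tab_weight B \<mu> T"
        unfolding tab_weight_def power_sum by (intro prod.cong) auto
    qed
    have "poly p t = (\<Sum>\<mu> | \<mu> \<turnstile>p n. d \<mu> * schur_poly \<mu> ?xs)"
      unfolding p_def poly_sum by (rule sum.cong[OF refl]) (simp add: s poly_sum poly_monom)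
    also have "\<dots> = 0" by (rule z) (use t in auto)
    finally show ?thesis .
  qed
  then have "UNIV - {0} \<subseteq> {t. poly p t = 0}" by auto
  moreover have "infinite (UNIV - {0 :: complex})"
    using infinite_UNIV_char_0[where 'a = complex] by simp
  ultimately have "p = 0" using poly_roots_finite[of p] finite_subset by blast
  then have "0 = coeff p (min_weight B \<kappa>)" by simp
  also have "\<dots> = (\<Sum>\<mu> | \<mu> \<turnstile>p n. d \<mu> * of_nat (card {T \<in> ?S \<mu>. tab_weight B \<mu> T = min_weight B \<kappa>}))"
    unfolding p_def by (subst coeff_sum) (simp only: coeff_smult coeff_sum_monom[OF finite_semistandard])
  also have "\<dots> = (\<Sum>\<mu>\<in>{\<kappa>}. d \<mu> * of_nat (card {T \<in> ?S \<mu>. tab_weight B \<mu> T = min_weight B \<kappa>}))"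
  proof (rule sum.mono_neutral_right)
    show "\<forall>\<mu>\<in>{\<mu>. \<mu> \<turnstile>p n} - {\<kappa>}. d \<mu> * of_nat (card {T \<in> ?S \<mu>. tab_weight B \<mu> T = min_weight B \<kappa>}) = 0"
    proof
      fix \<mu> assume "\<mu> \<in> {\<mu>. \<mu> \<turnstile>p n} - {\<kappa>}"
      then have \<mu>: "\<mu> \<turnstile>p n" "\<mu> \<noteq> \<kappa>" by auto
      show "d \<mu> * of_nat (card {T \<in> ?S \<mu>. tab_weight B \<mu> T = min_weight B \<kappa>}) = 0"
      proof (cases "d \<mu> = 0")
        case False
        have "n < B" by (simp add: B_def)
        then have "min_weight B \<kappa> \<noteq> min_weight B \<mu>" using min_weight_inject[OF \<kappa>(1) \<mu>(1)] \<mu>(2) by metis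
        then have "min_weight B \<kappa> < min_weight B \<mu>" using min[OF \<mu>(1) False] by simp
        moreover have "min_weight B \<mu> \<le> tab_weight B \<mu> T" if "T \<in> ?S \<mu>" for T
          using tab_weight_ge(1)[OF _ that] \<mu>(1) unfolding partition_of_def B_def by simp
        ultimately have "{T \<in> ?S \<mu>. tab_weight B \<mu> T = min_weight B \<kappa>} = {}" by fastforce
        then show ?thesis by (metis card.empty mult_zero_right of_nat_0)
      qed simp
    qed
  qed (use \<kappa>(1) finite_partitions in auto)
  also have "\<dots> = d \<kappa>"
  proof -
    let ?T = "\<lambda>c. if c \<in> diagram \<kappa> then Some (fst c) else None"
    have "{T \<in> ?S \<kappa>. tab_weight B \<kappa> T = min_weight B \<kappa>} = {?T}"
    proof (intro subset_antisym subsetI)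
      fix T assume "T \<in> {T \<in> ?S \<kappa>. tab_weight B \<kappa> T = min_weight B \<kappa>}"
      then show "T \<in> {?T}"
        using tab_weight_ge(2)[of \<kappa> T n B] \<kappa>(1) unfolding partition_of_def B_def by simp
    next
      fix T assume "T \<in> {?T}"
      then show "T \<in> {T \<in> ?S \<kappa>. tab_weight B \<kappa> T = min_weight B \<kappa>}"
        using superstandard_tableau[OF partition_le(2)[OF \<kappa>(1)]] by simp
    qed
    then show ?thesis by simp
  qed
  finally show False using \<kappa>(2) by simp
qed

section \<open>Uniqueness of Schur expansions of characters\<close>

text \<open>Every list of nonzero numbers is the spectrum of an invertible matrix, so a trace
  identity becomes an identity in free nonzero variables.\<close>

lemma diagonal_matrix:
  assumes "0 \<notin> set xs"
  obtains g where "g \<in> carrier_mat (length xs) (length xs)" "invertible_mat g" "eigenvalues_of g xs"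
proof -
  let ?n = "length xs"
  let ?d = "\<lambda>ys :: complex list. mat ?n ?n (\<lambda>(i, j). if i = j then ys ! i else 0)"
  have prod: "?d ys * ?d zs = 1\<^sub>m ?n" if "\<And>i. i < ?n \<Longrightarrow> ys ! i * zs ! i = 1" for ys zs
  proof (rule eq_matI)
    fix i j assume ij: "i < dim_row (1\<^sub>m ?n :: complex mat)" "j < dim_col (1\<^sub>m ?n :: complex mat)"
    have "(?d ys * ?d zs) $$ (i, j) = (\<Sum>k<?n. (if i = k then ys ! i else 0) * (if k = j then zs ! k else 0))"
      using ij by (simp add: scalar_prod_def atLeast0LessThan)
    also have "\<dots> = (\<Sum>k<?n. if k = i then (if i = j then ys ! i * zs ! i else 0) else 0)"
      by (rule sum.cong) auto
    also have "\<dots> = 1\<^sub>m ?n $$ (i, j)" using ij that by simp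
    finally show "(?d ys * ?d zs) $$ (i, j) = 1\<^sub>m ?n $$ (i, j)" .
  qed auto
  have nz: "xs ! i \<noteq> 0" if "i < ?n" for i using assms that by (metis nth_mem)
  have inv: "?d xs * ?d (map inverse xs) = 1\<^sub>m ?n" "?d (map inverse xs) * ?d xs = 1\<^sub>m ?n"
    by (rule prod; simp add: nz)+
  have "invertible_mat (?d xs)"
    unfolding invertible_mat_def inverts_mat_def square_mat.simps using inv by auto
  moreover have "diag_mat (?d xs) = xs" by (rule nth_equalityI) (simp_all add: diag_mat_def)
  then have "eigenvalues_of (?d xs) xs"
    unfolding eigenvalues_of_def using char_poly_upper_triangular[of "?d xs" ?n] by (simp add: upper_triangular_def)
  ultimately show ?thesis using that[of "?d xs"] by simp
qed

text \<open>Matrices of size \<open>sum_list \<kappa>\<close> are enough: no partition of this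
  number has more rows, so no Schur polynomial involved vanishes for lack of variables.\<close>

lemma schur_expansion_unique:
  assumes "schur_expansion \<kappa> c" "schur_expansion \<kappa> c'" "\<mu> \<turnstile>p sum_list \<kappa>"
  shows "c \<mu> = c' \<mu>"
proof -
  have "(\<lambda>\<mu>. c \<mu> - c' \<mu>) \<mu> = 0"
  proof (rule schur_poly_independent[OF _ assms(3)])
    fix xs :: "complex list" assume xs: "length xs = sum_list \<kappa>" "0 \<notin> set xs"
    obtain g where g: "g \<in> carrier_mat (length xs) (length xs)" "invertible_mat g" "eigenvalues_of g xs"
      using diagonal_matrix[OF xs(2)] .
    have "(\<Sum>\<mu> | \<mu> \<turnstile>p sum_list \<kappa>. c \<mu> * schur_poly \<mu> xs) = (\<Sum>\<mu> | \<mu> \<turnstile>p sum_list \<kappa>. c' \<mu> * schur_poly \<mu> xs)"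
      using assms(1,2) g unfolding schur_expansion_def by metis
    then show "(\<Sum>\<mu> | \<mu> \<turnstile>p sum_list \<kappa>. (c \<mu> - c' \<mu>) * schur_poly \<mu> xs) = 0"
      by (simp add: left_diff_distrib sum_subtractf)
  qed
  then show ?thesis by simp
qed

section \<open>Blocks of a union of partitions\<close>

text \<open>Only neighbouring lists are compared by hypothesis; a part of each nonempty list in
  between carries the inequality on.\<close>

lemma parts_decrease:
  fixes \<Lambda> :: "nat list list"
  assumes "\<And>i. Suc i < length \<Lambda> \<Longrightarrow>
      \<Lambda> ! i \<noteq> [] \<and> \<Lambda> ! Suc i \<noteq> [] \<and> Min (set (\<Lambda> ! i)) > Max (set (\<Lambda> ! Suc i))"
    and "j < k" "k < length \<Lambda>" "x \<in> set (\<Lambda> ! j)" "y \<in> set (\<Lambda> ! k)"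
  shows "y < x"
  using assms(2-5)
proof (induction k arbitrary: y)
  case (Suc k)
  have k: "\<Lambda> ! k \<noteq> []" "Min (set (\<Lambda> ! k)) > Max (set (\<Lambda> ! Suc k))" using assms(1)[of k] Suc.prems(2) by auto
  have step: "y < z" if "z \<in> set (\<Lambda> ! k)" for z
  proof -
    have "y \<le> Max (set (\<Lambda> ! Suc k))" "Min (set (\<Lambda> ! k)) \<le> z" using Suc.prems(4) that by simp_all
    then show ?thesis using k(2) by linarith
  qed
  show ?case
  proof (cases "j = k")
    case True
    then show ?thesis using step Suc.prems(3) by blast
  next
    case False
    have "hd (\<Lambda> ! k) \<in> set (\<Lambda> ! k)" using k(1) by simp
    moreover from this have "hd (\<Lambda> ! k) < x" using Suc.IH Suc.prems False by auto
    ultimately show ?thesis using step less_trans by blast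
  qed
qed simp

lemma sorted_wrt_concat:
  assumes "\<And>l. l \<in> set L \<Longrightarrow> sorted_wrt P l"
    and "\<And>j k x y. j < k \<Longrightarrow> k < length L \<Longrightarrow> x \<in> set (L ! j) \<Longrightarrow> y \<in> set (L ! k) \<Longrightarrow> P x y"
  shows "sorted_wrt P (concat L)"
  using assms
proof (induction L)
  case (Cons l L)
  have "sorted_wrt P (concat L)"
    using Cons.IH Cons.prems(1) Cons.prems(2)[of "Suc j" "Suc k" for j k] by force
  moreover have "P x y" if x: "x \<in> set l" and y: "y \<in> set (concat L)" for x y
  proof -
    obtain k where "k < length L" "y \<in> set (L ! k)" using y by (auto simp: in_set_conv_nth[of _ L])
    then show ?thesis using Cons.prems(2)[of 0 "Suc k" x y] x by simp
  qed
  ultimately show ?case using Cons.prems(1) by (auto simp: sorted_wrt_append)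
qed simp

lemma sum_list_concat: "sum_list (concat L) = sum_list (map sum_list L)" for L :: "nat list list"
  by (induction L) auto

lemma partition_union_concat:
  assumes "sorted_wrt (\<ge>) (concat \<Lambda>)"
  shows "partition_union \<Lambda> = concat \<Lambda>"
proof -
  have "sort (concat \<Lambda>) = rev (concat \<Lambda>)"
    using assms by (intro properties_for_sort) (simp_all add: sorted_wrt_rev)
  then show ?thesis unfolding partition_union_def by simp
qed

text \<open>Places a block of the union inside the interval that belongs to a single
  \<open>\<Lambda> ! j\<close>, together with its offset there.\<close>

lemma concat_index:
  fixes \<Lambda> :: "nat list list"
  assumes "i < length (concat \<Lambda>)"
  shows "\<exists>j k. j < length \<Lambda> \<and> k < length (\<Lambda> ! j) \<and> concat \<Lambda> ! i = \<Lambda> ! j ! k \<and>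
    sum_list (take i (concat \<Lambda>)) = sum_list (take j (map sum_list \<Lambda>)) + sum_list (take k (\<Lambda> ! j))"
  using assms
proof (induction \<Lambda> arbitrary: i)
  case (Cons l \<Lambda>)
  show ?case
  proof (cases "i < length l")
    case True
    then have "0 < length (l # \<Lambda>) \<and> i < length ((l # \<Lambda>) ! 0) \<and> concat (l # \<Lambda>) ! i = (l # \<Lambda>) ! 0 ! i \<and>
      sum_list (take i (concat (l # \<Lambda>))) = sum_list (take 0 (map sum_list (l # \<Lambda>))) + sum_list (take i ((l # \<Lambda>) ! 0))"
      by (simp add: nth_append)
    then show ?thesis by blast
  next
    case False
    then have lt: "i - length l < length (concat \<Lambda>)" using Cons.prems by simp
    obtain j k where "j < length \<Lambda>" "k < length (\<Lambda> ! j)" "concat \<Lambda> ! (i - length l) = \<Lambda> ! j ! k"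
      "sum_list (take (i - length l) (concat \<Lambda>)) = sum_list (take j (map sum_list \<Lambda>)) + sum_list (take k (\<Lambda> ! j))"
      using Cons.IH[OF lt] by blast
    then have "Suc j < length (l # \<Lambda>) \<and> k < length ((l # \<Lambda>) ! Suc j) \<and> concat (l # \<Lambda>) ! i = (l # \<Lambda>) ! Suc j ! k \<and>
      sum_list (take i (concat (l # \<Lambda>))) = sum_list (take (Suc j) (map sum_list (l # \<Lambda>))) + sum_list (take k ((l # \<Lambda>) ! Suc j))"
      using False by (simp add: nth_append)
    then show ?thesis by blast
  qed
qed simp

text \<open>The bound \<open>e < \<kappa> ! i\<close> is strict because the successor of the last
  entry of a block lies outside the block.\<close>

lemma block_Des_eq:
  assumes "i < length \<kappa>"
  shows "block_Des \<kappa> i T = {e. 0 < e \<and> e < \<kappa> ! i \<and> sum_list (take i \<kappa>) + e \<in> Des T}" (is "_ = ?R")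
proof -
  let ?s = "sum_list (take i \<kappa>)"
  have b: "block \<kappa> i = {?s + 1..?s + \<kappa> ! i}"
    unfolding block_def sum_list_take_Suc[OF assms] ..
  show ?thesis
  proof (intro subset_antisym subsetI)
    fix e assume "e \<in> block_Des \<kappa> i T"
    then obtain d where "e = d - ?s" "d \<in> Des T" "d \<in> block \<kappa> i" "Suc d \<in> block \<kappa> i"
      unfolding block_Des_def by blast
    then show "e \<in> ?R" unfolding b by auto
  next
    fix e assume "e \<in> ?R"
    then have "e = (?s + e) - ?s \<and> ?s + e \<in> Des T \<and> ?s + e \<in> block \<kappa> i \<and> Suc (?s + e) \<in> block \<kappa> i"
      unfolding b by auto
    then show "e \<in> block_Des \<kappa> i T" unfolding block_Des_def by blast
  qed
qed

text \<open>Whether a position inside a factor of the word is a descent depends on this factor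
  alone, so the major index of a block can be read from the rectified interval.\<close>

lemma block_maj_concat:
  assumes w: "length w = sum_list (concat \<Lambda>)" and i: "i < length (concat \<Lambda>)"
  obtains j k where "j < length \<Lambda>" "k < length (\<Lambda> ! j)" "concat \<Lambda> ! i = \<Lambda> ! j ! k"
    "block_maj (concat \<Lambda>) i (QT w) = block_maj (\<Lambda> ! j) k (interval_rect (QT w) (block (map sum_list \<Lambda>) j))"
proof -
  let ?ns = "map sum_list \<Lambda>"
  obtain j k where jk: "j < length \<Lambda>" "k < length (\<Lambda> ! j)" "concat \<Lambda> ! i = \<Lambda> ! j ! k"
    "sum_list (take i (concat \<Lambda>)) = sum_list (take j ?ns) + sum_list (take k (\<Lambda> ! j))"
    using concat_index[OF i] by blast
  have len: "length w = sum_list ?ns" using w by (simp add: sum_list_concat)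
  have j: "j < length ?ns" using jk(1) by simp
  let ?v = "take (?ns ! j) (drop (sum_list (take j ?ns)) w)"
  obtain u z where uz: "w = u @ ?v @ z" "length u = sum_list (take j ?ns)" "length ?v = ?ns ! j"
    using word_split[OF len j] .
  have le: "sum_list (take k (\<Lambda> ! j)) + \<Lambda> ! j ! k \<le> length ?v"
    using sum_list_take_le[of "Suc k" "\<Lambda> ! j"] sum_list_take_Suc[OF jk(2)] uz(3) jk(1) by simp
  have "block_Des (concat \<Lambda>) i (QT w) = block_Des (\<Lambda> ! j) k (QT ?v)"
  proof -
    have "sum_list (take i (concat \<Lambda>)) + e \<in> Des (QT w) \<longleftrightarrow> sum_list (take k (\<Lambda> ! j)) + e \<in> Des (QT ?v)"
      if "0 < e" "e < \<Lambda> ! j ! k" for e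
      using Des_QT_interval[of "sum_list (take k (\<Lambda> ! j)) + e" ?v u z] that le uz jk(4) by (simp add: add.assoc)
    then show ?thesis unfolding block_Des_eq[OF i] block_Des_eq[OF jk(2)] jk(3) by blast
  qed
  then have "block_maj (concat \<Lambda>) i (QT w) = block_maj (\<Lambda> ! j) k (QT ?v)" unfolding block_maj_def by simp
  then show ?thesis using that[OF jk(1-3)] interval_rect_block[OF len j] by simp
qed

lemma QT_surj:
  assumes "\<mu> \<turnstile>p n" "T \<in> SYT \<mu>"
  obtains w where "length w = n" "T = QT w"
proof -
  obtain q where q: "ballot no_boxes q" "grow no_boxes q = row_len \<mu>" "T = stab no_boxes q"
    using SYT_iff[OF assms(1)] assms(2) by blast
  \<comment> \<open>Any insertion tableau of the right shape would do; the standard tableau itself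
    is one.\<close>
  obtain w where w: "Q_tab w = q"
    using rsk_surj[of "List.enumerate 1 q" q] q(1) valid_enumerate by (metis rows_enumerate)
  have "length w = n"
    using w length_ballot[OF q(2)] assms(1) unfolding partition_of_def by (metis length_rec_list)
  then show ?thesis using that w q(3) by blast
qed

text \<open>Membership in the sets \<open>A\<close> transports the congruences from the rectified
  intervals to \<open>T\<close>, which allows counting inside \<open>SYT \<mu>\<close>, the setting
  of \<open>prod_schur_sums\<close>.\<close>

lemma interval_conditions_maj:
  assumes \<mu>: "\<mu> \<turnstile>p sum_list (concat \<Lambda>)" and T: "T \<in> SYT \<mu>"
    and A: "\<And>j \<nu>. j < length \<Lambda> \<Longrightarrow> \<nu> \<turnstile>p sum_list (\<Lambda> ! j) \<Longrightarrow> A j \<nu> \<subseteq> SYT_maj (\<Lambda> ! j) \<nu>"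
    and in_A: "\<And>j. j < length \<Lambda> \<Longrightarrow> interval_rect T (block (map sum_list \<Lambda>) j)
      \<in> A j (shape (interval_rect T (block (map sum_list \<Lambda>) j)))"
  shows "T \<in> SYT_maj (concat \<Lambda>) \<mu>"
proof -
  obtain w where w: "length w = sum_list (concat \<Lambda>)" "T = QT w" using QT_surj[OF \<mu> T] .
  have "[block_maj (concat \<Lambda>) i T = 1] (mod concat \<Lambda> ! i)" if i: "i < length (concat \<Lambda>)" for i
  proof -
    obtain j k where jk: "j < length \<Lambda>" "k < length (\<Lambda> ! j)" "concat \<Lambda> ! i = \<Lambda> ! j ! k"
      "block_maj (concat \<Lambda>) i (QT w) = block_maj (\<Lambda> ! j) k (interval_rect (QT w) (block (map sum_list \<Lambda>) j))"
      using block_maj_concat[OF w(1) i] .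
    let ?S = "interval_rect (QT w) (block (map sum_list \<Lambda>) j)"
    let ?v = "take (map sum_list \<Lambda> ! j) (drop (sum_list (take j (map sum_list \<Lambda>))) w)"
    have len: "length w = sum_list (map sum_list \<Lambda>)" using w(1) by (simp add: sum_list_concat)
    have j: "j < length (map sum_list \<Lambda>)" using jk(1) by simp
    have "length ?v = sum_list (\<Lambda> ! j)"
      using word_split[OF len j] jk(1) by (metis nth_map)
    moreover have "?S = QT ?v" using interval_rect_block[OF len j] .
    ultimately have "shape ?S \<turnstile>p sum_list (\<Lambda> ! j)" using QT_SYT[of ?v] by metis
    then have "?S \<in> SYT_maj (\<Lambda> ! j) (shape ?S)" using A jk(1) in_A w(2) by blast
    then show ?thesis using jk(2-4) w(2) unfolding SYT_maj_def by simp
  qed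
  then show ?thesis using T unfolding SYT_maj_def by blast
qed

section \<open>Thrall subsets as Schur expansions\<close>

text \<open>Each \<open>\<nu>\<close> comes with an expansion of its own, of which only the
  coefficient at \<open>\<nu>\<close> is known. Uniqueness merges them into a single
  expansion.\<close>

lemma refined_thrall_expansion:
  assumes "\<kappa> \<turnstile>p n" "\<And>\<nu>. \<nu> \<turnstile>p n \<Longrightarrow> refined_thrall \<kappa> \<nu> (A \<nu>)"
  shows "schur_expansion \<kappa> (\<lambda>\<nu>. of_nat (card (A \<nu>)))"
proof -
  have n: "sum_list \<kappa> = n" using assms(1) unfolding partition_of_def by blast
  \<comment> \<open>As \<open>\<kappa>\<close> is itself a partition of \<open>n\<close>, the
    hypothesis at \<open>\<kappa>\<close> supplies an expansion.\<close>
  obtain c where c: "schur_expansion \<kappa> c"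
    using assms(2)[OF assms(1)] unfolding refined_thrall_def has_schur_coeff_def by blast
  have "c \<nu> = of_nat (card (A \<nu>))" if \<nu>: "\<nu> \<turnstile>p n" for \<nu>
  proof -
    obtain c' where "schur_expansion \<kappa> c'" "c' \<nu> = of_nat (card (A \<nu>))"
      using assms(2)[OF \<nu>] unfolding refined_thrall_def has_schur_coeff_def by blast
    then show ?thesis using schur_expansion_unique[OF c] \<nu> n by metis
  qed
  then have "(\<Sum>\<mu> | \<mu> \<turnstile>p sum_list \<kappa>. c \<mu> * schur_poly \<mu> xs)
      = (\<Sum>\<mu> | \<mu> \<turnstile>p sum_list \<kappa>. of_nat (card (A \<mu>)) * schur_poly \<mu> xs)" for xs
    unfolding n by (intro sum.cong) auto
  then show ?thesis using c unfolding schur_expansion_def by metis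
qed

theorem proposition3p9:
  fixes \<Lambda> :: "nat list list" and ns :: "nat list"
    and A :: "nat list \<Rightarrow> nat list \<Rightarrow> tableau set" and \<mu> :: "nat list"
  assumes "length \<Lambda> \<ge> 1" and "length ns = length \<Lambda>"
    and "\<And>j. j < length \<Lambda> \<Longrightarrow> \<Lambda> ! j \<turnstile>p ns ! j"
    and "\<And>i. Suc i < length \<Lambda> \<Longrightarrow>
           \<Lambda> ! i \<noteq> [] \<and> \<Lambda> ! Suc i \<noteq> [] \<and> Min (set (\<Lambda> ! i)) > Max (set (\<Lambda> ! Suc i))"
    and "\<And>j \<nu>. j < length \<Lambda> \<Longrightarrow> \<nu> \<turnstile>p ns ! j \<Longrightarrow> refined_thrall (\<Lambda> ! j) \<nu> (A (\<Lambda> ! j) \<nu>)"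
    and "\<mu> \<turnstile>p sum_list ns"
  shows "refined_thrall (partition_union \<Lambda>) \<mu>
           {T \<in> SYT_maj (partition_union \<Lambda>) \<mu>.
              \<forall>j<length \<Lambda>. interval_rect T (block ns j)
                             \<in> A (\<Lambda> ! j) (shape (interval_rect T (block ns j)))}"
proof -
  have ns: "ns = map sum_list \<Lambda>"
    using assms(2,3) unfolding partition_of_def by (intro nth_equalityI) auto
  have nj: "ns ! j = sum_list (\<Lambda> ! j)" if "j < length \<Lambda>" for j using that unfolding ns by simp
  note decrease = parts_decrease[OF assms(4)]
  have sorted: "sorted_wrt (\<ge>) (concat \<Lambda>)"
  proof (rule sorted_wrt_concat)
    fix l assume "l \<in> set \<Lambda>"
    then obtain j where "j < length \<Lambda>" "l = \<Lambda> ! j" by (metis in_set_conv_nth)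
    then show "sorted_wrt (\<ge>) l" using assms(3) unfolding partition_of_def by blast
  next
    fix j k x y assume "j < k" "k < length \<Lambda>" "x \<in> set (\<Lambda> ! j)" "y \<in> set (\<Lambda> ! k)"
    then show "x \<ge> y" using decrease less_imp_le by blast
  qed
  have union: "partition_union \<Lambda> = concat \<Lambda>" using partition_union_concat[OF sorted] .
  have total: "sum_list (concat \<Lambda>) = sum_list ns" unfolding ns by (simp add: sum_list_concat)
  have A_maj: "A (\<Lambda> ! j) \<nu> \<subseteq> SYT_maj (\<Lambda> ! j) \<nu>" if "j < length \<Lambda>" "\<nu> \<turnstile>p ns ! j" for j \<nu>
    using assms(5)[OF that] unfolding refined_thrall_def by blast
  let ?S = "\<lambda>\<mu>. {T \<in> SYT \<mu>. \<forall>j<length ns. interval_rect T (block ns j)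
      \<in> A (\<Lambda> ! j) (shape (interval_rect T (block ns j)))}"
  have set_eq: "{T \<in> SYT_maj (concat \<Lambda>) \<mu>. \<forall>j<length \<Lambda>. interval_rect T (block ns j)
      \<in> A (\<Lambda> ! j) (shape (interval_rect T (block ns j)))} = ?S \<mu>"
  proof (intro subset_antisym subsetI)
    fix T assume "T \<in> ?S \<mu>"
    then have T: "T \<in> SYT \<mu>" and in_A: "\<And>j. j < length \<Lambda> \<Longrightarrow> interval_rect T (block ns j)
      \<in> A (\<Lambda> ! j) (shape (interval_rect T (block ns j)))" using assms(2) by auto
    have "T \<in> SYT_maj (concat \<Lambda>) \<mu>"
      by (rule interval_conditions_maj[where A = "\<lambda>j. A (\<Lambda> ! j)"])
        (use assms(6) total T A_maj nj in_A in \<open>simp_all add: ns[symmetric]\<close>)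
    then show "T \<in> {T \<in> SYT_maj (concat \<Lambda>) \<mu>. \<forall>j<length \<Lambda>. interval_rect T (block ns j)
      \<in> A (\<Lambda> ! j) (shape (interval_rect T (block ns j)))}" using in_A by blast
  qed (use assms(2) in \<open>auto simp: SYT_maj_def\<close>)
  have "schur_expansion (concat \<Lambda>) (\<lambda>\<mu>. of_nat (card (?S \<mu>)))"
    unfolding schur_expansion_def
  proof (intro allI impI)
    fix N g xs assume g: "g \<in> carrier_mat N N" "invertible_mat g" "eigenvalues_of g xs"
    interpret tensor_endo N "gl_action N g" by (rule gl_action_endo)
    have "trace_on (higher_lie N (concat \<Lambda>)) (gl_action N g)
        = (\<Prod>j<length \<Lambda>. trace_on (higher_lie N (\<Lambda> ! j)) (gl_action N g))"
      by (rule trace_higher_lie_concat) (metis decrease less_irrefl linorder_neqE_nat)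
    also have "\<dots> = (\<Prod>j<length ns. \<Sum>\<nu> | \<nu> \<turnstile>p ns ! j. of_nat (card (A (\<Lambda> ! j) \<nu>)) * schur_poly \<nu> xs)"
    proof (rule prod.cong)
      fix j assume "j \<in> {..<length ns}"
      then have j: "j < length \<Lambda>" using assms(2) by simp
      have "schur_expansion (\<Lambda> ! j) (\<lambda>\<nu>. of_nat (card (A (\<Lambda> ! j) \<nu>)))"
        using refined_thrall_expansion[OF assms(3)[OF j]] assms(5)[OF j] by blast
      then show "trace_on (higher_lie N (\<Lambda> ! j)) (gl_action N g)
          = (\<Sum>\<nu> | \<nu> \<turnstile>p ns ! j. of_nat (card (A (\<Lambda> ! j) \<nu>)) * schur_poly \<nu> xs)"
        using g nj[OF j] unfolding schur_expansion_def by simp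
    qed (simp add: assms(2))
    also have "\<dots> = (\<Sum>\<mu> | \<mu> \<turnstile>p sum_list ns. of_nat (card (?S \<mu>)) * schur_poly \<mu> xs)"
      by (rule prod_schur_sums) (use A_maj assms(2) in \<open>auto simp: SYT_maj_def\<close>)
    finally show "trace_on (higher_lie N (concat \<Lambda>)) (gl_action N g)
        = (\<Sum>\<mu> | \<mu> \<turnstile>p sum_list (concat \<Lambda>). of_nat (card (?S \<mu>)) * schur_poly \<mu> xs)" unfolding total .
  qed
  then have "has_schur_coeff (concat \<Lambda>) \<mu> (of_nat (card (?S \<mu>)))"
    unfolding has_schur_coeff_def using assms(6) total by auto
  then show ?thesis
    unfolding refined_thrall_def union set_eq using set_eq by blast
qed

end
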